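(* Let $\{RC_i\}_{1\le i\le p}$ be an independent family of $n\times n$ reverse circulant random matrices satisfying Assumption I of the context. Then, as $n\to\infty$, $\{n^{-1/2}RC_i\}_{1\le i\le p}$, viewed as elements of the noncommutative probability space of $n\times n$ random matrices with functional $\phi_n=\frac1n\mathbb{E}[\mathrm{Tr}(\cdot)]$, converges in law to $\{a_i\}_{1\le i\le p}\subset \big(M_2(L(\mu)),\tfrac12\mathbb{E}[\mathrm{Tr}(\cdot)]\big)$, where $$a_i=\begin{pmatrix}0&\eta_i\\ \bar\eta_i&0\end{pmatrix}$$ and $\eta_1,\dots,\eta_p$ are i.i.d. standard complex Gaussian random variables (circularly symmetric, $\mathbb{E}|\eta_i|^2=1$); and the elements $\{a_i\}_{1\le i\le p}$ are half independent.
   Context: **Noncommutative probability.** A noncommutative probability space is a pair $(\mathcal{A},\phi)$ with $\mathcal{A}$ a unital complex algebra and $\phi:\mathcal{A}\to\mathbb{C}$ linear with $\phi(1)=1$. For a probability space with measure $\mu$, $L(\mu)=\bigcap_{1\le r<\infty}L^r(\mu)$ is the algebra of complex random variables with all moments finite, and $M_2(L(\mu))$ is the algebra of $2\times2$ matrices over it. $\mathrm{Tr}$ is the unnormalized trace. A family $\{a_i^n\}_{1\le i\le p}\subset(\mathcal{A}_n,\phi_n)$ converges in law to $\{a_i\}_{1\le i\le p}\subset(\mathcal{A},\phi)$ if $\phi_n(P(a_1^n,\dots,a_p^n))\to\phi(P(a_1,\dots,a_p))$ for every complex polynomial $P$ in $p$ noncommuting variables. **Half independence.** Elements $\{a_i\}_{i\in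 J}$ of $\mathcal{A}$ half commute if $a_ia_ja_k=a_ka_ja_i$ for all $i,j,k\in J$. A monomial $a=a_{i_1}a_{i_2}\cdots a_{i_k}$ is symmetric if for every $i\in J$ the number of times $a_i$ occurs in even positions equals the number of times it occurs in odd positions; otherwise it is nonsymmetric. Half commuting elements $\{a_i\}_{i\in J}$ are half independent if (i) $\{a_i^2\}_{i\in J}$ are independent, and (ii) $\phi(a)=0$ for every nonsymmetric monomial $a$ in $\{a_i\}_{i\in J}$. Here elements are independent if the unital subalgebras $\mathcal{A}_i$ they generate commute and $\phi(b_1\cdots b_m)=\phi(b_1)\cdots\phi(b_m)$ whenever $b_1,\dots,b_m$ belong to distinct subalgebras $\mathcal{A}_{k(1)},\dots,\mathcal{A}_{k(m)}$. **Reverse circulant matrices and Assumption I.** The $n\times n$ reverse circulant matrix $RC_i=RC_{i,n}$ has $(j,k)$ entry $X_{i,n}(L(j,k))$, $1\le j,k\le n$, with link function $L(j,k)=(j+k)\bmod n$, where $X_{i,n}(t)$, $t\in\{0,\dots,n-1\}$, is its input sequence of real random variables. Assumption I: for each $n$, the input variables of each matrix are independent with mean $0$ and variance $1$, they are also independent across $i\in\{1,\dots,p\}$, and for every integer $k\ge1$ there is $c_k<\infty$ with $\sup_n\sup_{1\le i\le p}\sup_{1\le m\le l\le n}\mathbb{E}[|X_{i,n}(L(m,l))|^k]\le c_k$. *)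

theory Defs
  imports
    "HOL-Probability.Probability"
    "HOL-Library.Function_Algebras"
    "HOL-Library.Poly_Mapping"
    "HOL-Algebra.Subrings"
    "Jordan_Normal_Form.Matrix"
begin

section \<open>Noncommutative probability spaces\<close>

text \<open>The locale \<^locale>\<open>algebra\<close> of HOL-Algebra requires a commutative multiplication, so unital
  complex algebras that need not be commutative are introduced here.\<close>

definition complex_ring :: "complex ring" where
  "complex_ring = \<lparr>carrier = UNIV, mult = (*), one = 1, zero = 0, add = (+)\<rparr>"

locale nc_prob_space = module complex_ring A + ring A
  for A :: "(complex, 'a) module" (structure) +
  fixes \<phi> :: "'a \<Rightarrow> complex"
  assumes smult_mult_left:
      "x \<in> carrier A \<Longrightarrow> y \<in> carrier A \<Longrightarrow> (c \<odot> x) \<otimes> y = c \<odot> (x \<otimes> y)"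
    and smult_mult_right:
      "x \<in> carrier A \<Longrightarrow> y \<in> carrier A \<Longrightarrow> x \<otimes> (c \<odot> y) = c \<odot> (x \<otimes> y)"
    and phi_add: "x \<in> carrier A \<Longrightarrow> y \<in> carrier A \<Longrightarrow> \<phi> (x \<oplus> y) = \<phi> x + \<phi> y"
    and phi_smult: "x \<in> carrier A \<Longrightarrow> \<phi> (c \<odot> x) = c * \<phi> x"
    and phi_one: "\<phi> \<one> = 1"

definition prod_word :: "('c, 'a) module \<Rightarrow> 'a list \<Rightarrow> 'a" where
  "prod_word A xs = foldr (\<lambda>x y. x \<otimes>\<^bsub>A\<^esub> y) xs \<one>\<^bsub>A\<^esub>"

definition monomial :: "('c, 'a) module \<Rightarrow> ('i \<Rightarrow> 'a) \<Rightarrow> 'i list \<Rightarrow> 'a" where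
  "monomial A a w = prod_word A (map a w)"

text \<open>A complex polynomial in noncommuting variables is a finitely supported family of
  coefficients indexed by words in the variables.\<close>

type_synonym 'i nc_poly = "'i list \<Rightarrow>\<^sub>0 complex"

definition nc_polys :: "'i set \<Rightarrow> 'i nc_poly set" where
  "nc_polys J = {P. Poly_Mapping.keys P \<subseteq> lists J}"

definition nc_eval :: "(complex, 'a) module \<Rightarrow> ('i \<Rightarrow> 'a) \<Rightarrow> 'i nc_poly \<Rightarrow> 'a" where
  "nc_eval A a P =
     (\<Oplus>\<^bsub>A\<^esub>w\<in>Poly_Mapping.keys P. Poly_Mapping.lookup P w \<odot>\<^bsub>A\<^esub> monomial A a w)"

text \<open>Sequences are indexed by \<open>n \<ge> 1\<close>. The members for \<open>n = 0\<close> are irrelevant.\<close>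

definition converges_in_law ::
  "'i set \<Rightarrow> (nat \<Rightarrow> (complex, 'a) module) \<Rightarrow> (nat \<Rightarrow> 'a \<Rightarrow> complex) \<Rightarrow> (nat \<Rightarrow> 'i \<Rightarrow> 'a)
   \<Rightarrow> (complex, 'b) module \<Rightarrow> ('b \<Rightarrow> complex) \<Rightarrow> ('i \<Rightarrow> 'b) \<Rightarrow> bool" where
  "converges_in_law J A \<phi> a B \<psi> b \<longleftrightarrow>
     (\<forall>n\<ge>1. nc_prob_space (A n) (\<phi> n) \<and> a n ` J \<subseteq> carrier (A n)) \<and>
     nc_prob_space B \<psi> \<and> b ` J \<subseteq> carrier B \<and>
     (\<forall>P\<in>nc_polys J. (\<lambda>n. \<phi> n (nc_eval (A n) (a n) P)) \<longlonglongrightarrow> \<psi> (nc_eval B b P))"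


section \<open>Half independence\<close>

definition half_commute :: "('c, 'a) module \<Rightarrow> 'i set \<Rightarrow> ('i \<Rightarrow> 'a) \<Rightarrow> bool" where
  "half_commute A J a \<longleftrightarrow>
     (\<forall>i\<in>J. \<forall>j\<in>J. \<forall>k\<in>J. a i \<otimes>\<^bsub>A\<^esub> a j \<otimes>\<^bsub>A\<^esub> a k = a k \<otimes>\<^bsub>A\<^esub> a j \<otimes>\<^bsub>A\<^esub> a i)"

definition symmetric_word :: "'i set \<Rightarrow> 'i list \<Rightarrow> bool" where
  "symmetric_word J w \<longleftrightarrow>
     (\<forall>i\<in>J. card {m \<in> {1..length w}. even m \<and> w ! (m - 1) = i} =
            card {m \<in> {1..length w}. odd m \<and> w ! (m - 1) = i})"

definition unital_subalgebra :: "(complex, 'a) module \<Rightarrow> 'a set \<Rightarrow> bool" where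
  "unital_subalgebra A B \<longleftrightarrow> subring B A \<and> submodule B complex_ring A"

definition gen_subalgebra :: "(complex, 'a) module \<Rightarrow> 'a set \<Rightarrow> 'a set" where
  "gen_subalgebra A S = \<Inter> {B. unital_subalgebra A B \<and> S \<subseteq> B}"

definition nc_independent ::
  "(complex, 'a) module \<Rightarrow> ('a \<Rightarrow> complex) \<Rightarrow> 'i set \<Rightarrow> ('i \<Rightarrow> 'a) \<Rightarrow> bool" where
  "nc_independent A \<phi> J x \<longleftrightarrow>
     (\<forall>i\<in>J. \<forall>j\<in>J. i \<noteq> j \<longrightarrow>
        (\<forall>b\<in>gen_subalgebra A {x i}. \<forall>c\<in>gen_subalgebra A {x j}. b \<otimes>\<^bsub>A\<^esub> c = c \<otimes>\<^bsub>A\<^esub> b)) \<and>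
     (\<forall>ks bs. distinct ks \<and> set ks \<subseteq> J \<and> length bs = length ks \<and>
        (\<forall>m<length ks. bs ! m \<in> gen_subalgebra A {x (ks ! m)})
        \<longrightarrow> \<phi> (prod_word A bs) = prod_list (map \<phi> bs))"

definition half_independent ::
  "(complex, 'a) module \<Rightarrow> ('a \<Rightarrow> complex) \<Rightarrow> 'i set \<Rightarrow> ('i \<Rightarrow> 'a) \<Rightarrow> bool" where
  "half_independent A \<phi> J a \<longleftrightarrow>
     a ` J \<subseteq> carrier A \<and>
     half_commute A J a \<and>
     nc_independent A \<phi> J (\<lambda>i. a i \<otimes>\<^bsub>A\<^esub> a i) \<and>
     (\<forall>w\<in>lists J. \<not> symmetric_word J w \<longrightarrow> \<phi> (monomial A a w) = 0)"


section \<open>Random matrices\<close>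

text \<open>Random variables are functions, with pointwise operations. They are not identified when
  they agree almost everywhere.\<close>

definition moment_algebra :: "'w measure \<Rightarrow> ('w \<Rightarrow> complex) set" where
  "moment_algebra M =
     {f \<in> borel_measurable M. \<forall>r::real. 1 \<le> r \<longrightarrow> integrable M (\<lambda>\<omega>. norm (f \<omega>) powr r)}"

definition random_matrix_algebra :: "'w measure \<Rightarrow> nat \<Rightarrow> (complex, ('w \<Rightarrow> complex) mat) module" where
  "random_matrix_algebra M n =
     \<lparr>carrier = {A \<in> carrier_mat n n. \<forall>j<n. \<forall>k<n. A $$ (j, k) \<in> moment_algebra M},
      mult = (*), one = 1\<^sub>m n, zero = 0\<^sub>m n n, add = (+), smult = (\<lambda>c A. (\<lambda>_. c) \<cdot>\<^sub>m A)\<rparr>"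

definition mat_trace :: "'a :: comm_monoid_add mat \<Rightarrow> 'a" where
  "mat_trace A = (\<Sum>j<dim_row A. A $$ (j, j))"

definition expected_trace :: "'w measure \<Rightarrow> nat \<Rightarrow> ('w \<Rightarrow> complex) mat \<Rightarrow> complex" where
  "expected_trace M n A = (1 / of_nat n) * (\<integral>\<omega>. mat_trace A \<omega> \<partial>M)"


section \<open>Reverse circulant matrices\<close>

definition rc_link :: "nat \<Rightarrow> nat \<Rightarrow> nat \<Rightarrow> nat" where
  "rc_link n j k = (j + k) mod n"

text \<open>Matrices are indexed from \<open>0\<close> in the library, whereas the link function is applied to
  indices in \<open>{1..n}\<close>.\<close>

definition reverse_circulant :: "nat \<Rightarrow> (nat \<Rightarrow> 'w \<Rightarrow> real) \<Rightarrow> ('w \<Rightarrow> complex) mat" where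
  "reverse_circulant n x =
     mat n n (\<lambda>(j, k). \<lambda>\<omega>. complex_of_real (x (rc_link n (j + 1) (k + 1)) \<omega>))"

text \<open>\<open>X n i t\<close> is the entry with index \<open>t < n\<close> of the input sequence of the \<open>i\<close>-th matrix of
  size \<open>n\<close>. The underlying probability space may depend on \<open>n\<close>.\<close>

definition assumption_I ::
  "nat \<Rightarrow> (nat \<Rightarrow> 'w measure) \<Rightarrow> (nat \<Rightarrow> nat \<Rightarrow> nat \<Rightarrow> 'w \<Rightarrow> real) \<Rightarrow> bool" where
  "assumption_I p M X \<longleftrightarrow>
     (\<forall>n\<ge>1.
        prob_space (M n) \<and>
        prob_space.indep_vars (M n) (\<lambda>_. borel) (\<lambda>(i, t). X n i t) ({1..p} \<times> {..<n}) \<and>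
        (\<forall>i\<in>{1..p}. \<forall>t<n.
           prob_space.expectation (M n) (X n i t) = 0 \<and>
           prob_space.variance (M n) (X n i t) = 1)) \<and>
     (\<forall>k\<ge>1. \<exists>c::real. \<forall>n\<ge>1. \<forall>i\<in>{1..p}. \<forall>m l. 1 \<le> m \<and> m \<le> l \<and> l \<le> n \<longrightarrow>
        integrable (M n) (\<lambda>\<omega>. \<bar>X n i (rc_link n m l) \<omega>\<bar> ^ k) \<and>
        prob_space.expectation (M n) (\<lambda>\<omega>. \<bar>X n i (rc_link n m l) \<omega>\<bar> ^ k) \<le> c)"


section \<open>Complex Gaussian variables\<close>

definition standard_complex_gaussian :: "'v measure \<Rightarrow> ('v \<Rightarrow> complex) \<Rightarrow> bool" where
  "standard_complex_gaussian N \<eta> \<longleftrightarrow>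
     \<eta> \<in> borel_measurable N \<and>
     prob_space.indep_var N borel (\<lambda>\<omega>. Re (\<eta> \<omega>)) borel (\<lambda>\<omega>. Im (\<eta> \<omega>)) \<and>
     distributed N lborel (\<lambda>\<omega>. Re (\<eta> \<omega>)) (normal_density 0 (1 / sqrt 2)) \<and>
     distributed N lborel (\<lambda>\<omega>. Im (\<eta> \<omega>)) (normal_density 0 (1 / sqrt 2))"

definition off_diagonal :: "('v \<Rightarrow> complex) \<Rightarrow> ('v \<Rightarrow> complex) mat" where
  "off_diagonal \<eta> = mat_of_rows_list 2 [[0, \<eta>], [\<lambda>\<omega>. cnj (\<eta> \<omega>), 0]]"

end

theory Submission
  imports Defs "HOL-Number_Theory.Cong"
begin

text \<open>
  A reverse circulant matrix acts simply on plane waves. Let \<open>f\<^sub>s(k) = exp (2 \<pi> \<i> s k / n)\<close> for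
  \<open>k = 1, \<dots>, n\<close>. If \<open>x\<close> is the input sequence of \<open>RC\<close> and \<open>\<lambda>\<^sub>s = (\<Sum>t. x(t) exp (2 \<pi> \<i> s t / n))\<close>, then
  \<open>RC f\<^sub>s = \<lambda>\<^sub>s cnj f\<^sub>s\<close>, because the entries depend only on \<open>j + k\<close> modulo \<open>n\<close>, so that
  shifting the summation index by \<open>j\<close> leaves the factor \<open>exp (- 2 \<pi> \<i> s j / n)\<close>; since \<open>x\<close> is real, also
  \<open>RC (cnj f\<^sub>s) = cnj \<lambda>\<^sub>s f\<^sub>s\<close>. On the span of \<open>f\<^sub>s\<close> and \<open>cnj f\<^sub>s\<close> the normalized
  matrices therefore look like off-diagonal two by two matrices with entries \<open>\<lambda>\<^sub>s / sqrt n\<close> and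
  \<open>cnj \<lambda>\<^sub>s / sqrt n\<close>, that is, like the \<open>a\<^sub>i\<close> with \<open>\<lambda>\<^sub>s / sqrt n\<close> in place of \<open>\<eta>\<^sub>i\<close>. A word of
  matrices sends a wave to the wave or its conjugate, times an alternating product \<open>z\<^sub>1 cnj z\<^sub>2 z\<^sub>3 \<dots>\<close> of these numbers
  (\<open>monomial_scaled_rc_fourier\<close>), and its normalized trace averages such products over \<open>s\<close>
  with weights of modulus at most one (\<open>mat_trace_monomial_scaled_rc\<close>).

  By linearity it suffices to treat words (\<open>converges_in_lawI\<close>). Independence across \<open>i\<close> splits
  the expectation of an alternating product into factors \<open>E(z\<^sup>a (cnj z)\<^sup>b)\<close>, where \<open>a\<close> and \<open>b\<close>
  count the odd and even positions of the letter \<open>i\<close>. What remains is a central limit theorem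
  for moments: if \<open>z = (\<Sum>t. c\<^sub>t X\<^sub>t)\<close> with \<open>(\<Sum>t. \<bar>c\<^sub>t\<bar>\<^sup>2) = 1\<close>, \<open>(\<Sum>t. c\<^sub>t\<^sup>2) = 0\<close> and
  all \<open>\<bar>c\<^sub>t\<bar> \<le> \<epsilon>\<close>, then \<open>E(z\<^sup>a (cnj z)\<^sup>b)\<close> is within \<open>O(\<epsilon>)\<close> of \<open>a!\<close> if \<open>a = b\<close> and of \<open>0\<close>
  otherwise, uniformly in everything but the moment bounds (\<open>mixed_moment_approx\<close>). It is proved
  by Stein's method: Taylor expansion in one \<open>X\<^sub>t\<close> at a time gives the recursion
  \<open>m(a + 1, b) = b m(a, b - 1) + O(\<epsilon>)\<close>, which the complex Gaussian variable satisfies without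
  error (\<open>complex_gaussian_moments\<close>). For \<open>\<lambda>\<^sub>s / sqrt n\<close> one has \<open>\<epsilon> = 1 / sqrt n\<close>, and the sum of
  squares vanishes unless \<open>n\<close> divides \<open>2 s\<close>. At most two indices \<open>s < n\<close> are exceptional; their
  moments are still bounded, so they contribute \<open>O(1/n)\<close>.

  For the limit itself, \<open>a\<^sub>i\<^sup>2\<close> is the scalar \<open>\<bar>\<eta>\<^sub>i\<bar>\<^sup>2\<close> times the identity, so the algebra generated
  by it consists of functions of \<open>\<eta>\<^sub>i\<close>, and independence of the squares follows from that of
  the \<open>\<eta>\<^sub>i\<close>. The moment of a word is the product of the Gaussian moments above, which has a zero factor
  as soon as some letter occurs unequally often in odd and in even positions.
\<close>

section \<open>Random variables with finite moments\<close>

lemma sum_fun_apply: "(\<Sum>i\<in>I. f i) x = (\<Sum>i\<in>I. f i x)"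
  for f :: "'i \<Rightarrow> 'a \<Rightarrow> 'b::comm_monoid_add"
  by (induction I rule: infinite_finite_induct) auto

lemma norm_add_power_le: "norm (x + y) ^ k \<le> 2 ^ k * (norm x ^ k + norm y ^ k)"
  for x y :: "'a::real_normed_vector"
proof -
  have "norm (x + y) ^ k \<le> (2 * max (norm x) (norm y)) ^ k"
    by (intro power_mono) (use norm_triangle_ineq[of x y] in auto)
  also have "\<dots> = 2 ^ k * max (norm x) (norm y) ^ k"
    by (simp add: power_mult_distrib)
  also have "\<dots> \<le> 2 ^ k * (norm x ^ k + norm y ^ k)"
    by (intro mult_left_mono) (auto simp: max_def)
  finally show ?thesis .
qed

text \<open>On a probability space the real exponents \<open>r \<ge> 1\<close> are dominated by natural ones, for which
  the closure properties are algebra.\<close>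
lemma (in prob_space) moment_algebra_iff:
  "f \<in> moment_algebra M \<longleftrightarrow>
     f \<in> borel_measurable M \<and> (\<forall>k. integrable M (\<lambda>\<omega>. norm (f \<omega>) ^ k))"
proof (intro iffI conjI allI; (elim conjE)?)
  fix k assume f: "f \<in> moment_algebra M"
  show "integrable M (\<lambda>\<omega>. norm (f \<omega>) ^ k)"
  proof (cases "k = 0")
    case False
    then have "integrable M (\<lambda>\<omega>. norm (f \<omega>) powr real k)"
      using f by (auto simp: moment_algebra_def)
    then show ?thesis
      using False by (simp add: powr_realpow')
  qed auto
next
  assume "f \<in> moment_algebra M" then show "f \<in> borel_measurable M"
    by (auto simp: moment_algebra_def)
next
  assume [measurable]: "f \<in> borel_measurable M"
    and int: "\<forall>k. integrable M (\<lambda>\<omega>. norm (f \<omega>) ^ k)"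
  have "integrable M (\<lambda>\<omega>. norm (f \<omega>) powr r)" if r: "1 \<le> r" for r
  proof (rule Bochner_Integration.integrable_bound)
    show "integrable M (\<lambda>\<omega>. 1 + norm (f \<omega>) ^ nat \<lceil>r\<rceil>)"
      using int by auto
    have "norm (f \<omega>) powr r \<le> 1 + norm (f \<omega>) ^ nat \<lceil>r\<rceil>" for \<omega>
    proof (cases "norm (f \<omega>) \<le> 1")
      case True
      then have "norm (f \<omega>) powr r \<le> 1"
        using r by (intro powr_le1) auto
      then show ?thesis
        by (simp add: add_increasing2)
    next
      case False
      then have "norm (f \<omega>) powr r \<le> norm (f \<omega>) powr (real (nat \<lceil>r\<rceil>))"
        using r by (intro powr_mono) linarith+
      also have "\<dots> = norm (f \<omega>) ^ nat \<lceil>r\<rceil>"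
        using False r by (intro powr_realpow) auto
      finally show ?thesis by simp
    qed
    then show "AE \<omega> in M. norm (norm (f \<omega>) powr r) \<le> norm (1 + norm (f \<omega>) ^ nat \<lceil>r\<rceil>)"
      by (auto simp: add_nonneg_nonneg)
  qed measurable
  then show "f \<in> moment_algebra M"
    by (auto simp: moment_algebra_def)
qed

lemma norm_integral_le:
  fixes f :: "'a \<Rightarrow> 'b::{banach, second_countable_topology}"
  assumes "integrable M f" "integrable M g" "\<And>x. norm (f x) \<le> g x"
  shows "norm (\<integral>x. f x \<partial>M) \<le> (\<integral>x. g x \<partial>M)"
  using assms by (intro order_trans[OF integral_norm_bound] integral_mono) auto

lemma borel_measurable_cnj: "f \<in> borel_measurable M \<Longrightarrow> (\<lambda>x. cnj (f x)) \<in> borel_measurable M"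
  by (rule measurable_compose[of f M borel cnj])
     (auto intro!: borel_measurable_continuous_onI continuous_intros)

context prob_space
begin

lemma moment_algebra_measurable: "f \<in> moment_algebra M \<Longrightarrow> f \<in> borel_measurable M"
  by (simp add: moment_algebra_iff)

lemma moment_algebra_integrable: "f \<in> moment_algebra M \<Longrightarrow> integrable M f"
  using integrable_norm_iff[of f M] by (auto simp: moment_algebra_iff dest: spec[of _ 1])

lemma moment_algebra_integrable_power:
  "f \<in> moment_algebra M \<Longrightarrow> integrable M (\<lambda>\<omega>. norm (f \<omega>) ^ k)"
  by (simp add: moment_algebra_iff)

lemma moment_algebra_add:
  assumes f: "f \<in> moment_algebra M" and g: "g \<in> moment_algebra M"
  shows "(\<lambda>\<omega>. f \<omega> + g \<omega>) \<in> moment_algebra M"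
  unfolding moment_algebra_iff
proof (intro conjI allI)
  note [measurable] = assms[THEN moment_algebra_measurable]
  show "(\<lambda>\<omega>. f \<omega> + g \<omega>) \<in> borel_measurable M" by measurable
  fix k
  show "integrable M (\<lambda>\<omega>. norm (f \<omega> + g \<omega>) ^ k)"
  proof (rule Bochner_Integration.integrable_bound)
    show "integrable M (\<lambda>\<omega>. 2 ^ k * (norm (f \<omega>) ^ k + norm (g \<omega>) ^ k))"
      using assms by (auto intro!: moment_algebra_integrable_power)
    show "AE \<omega> in M. norm (norm (f \<omega> + g \<omega>) ^ k)
            \<le> norm (2 ^ k * (norm (f \<omega>) ^ k + norm (g \<omega>) ^ k))"
      using norm_add_power_le by (auto simp: norm_power abs_mult)
  qed measurable
qed

lemma moment_algebra_mult:
  assumes f: "f \<in> moment_algebra M" and g: "g \<in> moment_algebra M"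
  shows "(\<lambda>\<omega>. f \<omega> * g \<omega>) \<in> moment_algebra M"
  unfolding moment_algebra_iff
proof (intro conjI allI)
  note [measurable] = assms[THEN moment_algebra_measurable]
  show "(\<lambda>\<omega>. f \<omega> * g \<omega>) \<in> borel_measurable M" by measurable
  fix k
  show "integrable M (\<lambda>\<omega>. norm (f \<omega> * g \<omega>) ^ k)"
  proof (rule Bochner_Integration.integrable_bound)
    show "integrable M (\<lambda>\<omega>. norm (f \<omega>) ^ (2 * k) + norm (g \<omega>) ^ (2 * k))"
      using assms by (auto intro!: moment_algebra_integrable_power)
    have "norm (f \<omega> * g \<omega>) ^ k \<le> norm (f \<omega>) ^ (2 * k) + norm (g \<omega>) ^ (2 * k)" for \<omega>
    proof -
      have "2 * (norm (f \<omega>) ^ k * norm (g \<omega>) ^ k) \<le> (norm (f \<omega>) ^ k)\<^sup>2 + (norm (g \<omega>) ^ k)\<^sup>2"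
        using sum_squares_bound[of "norm (f \<omega>) ^ k" "norm (g \<omega>) ^ k"] by (simp add: mult.assoc)
      moreover have "0 \<le> norm (f \<omega>) ^ k * norm (g \<omega>) ^ k" by simp
      ultimately have "norm (f \<omega>) ^ k * norm (g \<omega>) ^ k \<le> (norm (f \<omega>) ^ k)\<^sup>2 + (norm (g \<omega>) ^ k)\<^sup>2"
        by linarith
      then show ?thesis
        by (simp add: norm_mult power_mult_distrib power_mult mult.commute[of 2])
    qed
    then show "AE \<omega> in M. norm (norm (f \<omega> * g \<omega>) ^ k)
            \<le> norm (norm (f \<omega>) ^ (2 * k) + norm (g \<omega>) ^ (2 * k))"
      by (auto simp: norm_mult abs_mult add_nonneg_nonneg)
  qed measurable
qed

lemma moment_algebra_const: "(\<lambda>_. c) \<in> moment_algebra M"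
  by (simp add: moment_algebra_iff)

lemma moment_algebra_cnj: "f \<in> moment_algebra M \<Longrightarrow> (\<lambda>\<omega>. cnj (f \<omega>)) \<in> moment_algebra M"
  by (auto simp: moment_algebra_iff intro: borel_measurable_cnj)

lemma moment_algebra_power: "f \<in> moment_algebra M \<Longrightarrow> (\<lambda>\<omega>. f \<omega> ^ k) \<in> moment_algebra M"
  by (induction k) (auto intro: moment_algebra_const moment_algebra_mult)

lemma moment_algebra_uminus: "f \<in> moment_algebra M \<Longrightarrow> (\<lambda>\<omega>. - f \<omega>) \<in> moment_algebra M"
  by (auto simp: moment_algebra_iff)

lemma moment_algebra_sum:
  "(\<And>i. i \<in> I \<Longrightarrow> f i \<in> moment_algebra M) \<Longrightarrow> (\<lambda>\<omega>. \<Sum>i\<in>I. f i \<omega>) \<in> moment_algebra M"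
  by (induction I rule: infinite_finite_induct)
     (auto intro: moment_algebra_const moment_algebra_add)

lemma moment_algebra_prod:
  "(\<And>i. i \<in> I \<Longrightarrow> f i \<in> moment_algebra M) \<Longrightarrow> (\<lambda>\<omega>. \<Prod>i\<in>I. f i \<omega>) \<in> moment_algebra M"
  by (induction I rule: infinite_finite_induct)
     (auto intro: moment_algebra_const moment_algebra_mult)

lemmas moment_algebra_intros =
  moment_algebra_const moment_algebra_add moment_algebra_mult moment_algebra_cnj
  moment_algebra_power moment_algebra_uminus moment_algebra_sum moment_algebra_prod

lemma complex_of_real_moment_algebra:
  assumes "f \<in> borel_measurable M" and "\<And>k. k \<ge> 1 \<Longrightarrow> integrable M (\<lambda>\<omega>. \<bar>f \<omega>\<bar> ^ k)"
  shows "(\<lambda>\<omega>. complex_of_real (f \<omega>)) \<in> moment_algebra M"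
  unfolding moment_algebra_iff
proof (intro conjI allI)
  show "(\<lambda>\<omega>. complex_of_real (f \<omega>)) \<in> borel_measurable M" using assms(1) by simp
  show "integrable M (\<lambda>\<omega>. norm (complex_of_real (f \<omega>)) ^ k)" for k
    using assms(2)[of k] by (cases "k = 0") auto
qed

end

section \<open>The noncommutative probability space of random matrices\<close>

lemma mult_mat_entry:
  fixes A B :: "('w \<Rightarrow> complex) mat"
  assumes "A \<in> carrier_mat n n" "B \<in> carrier_mat n n" "i < n" "j < n"
  shows "(A * B) $$ (i, j) = (\<lambda>\<omega>. \<Sum>l<n. (A $$ (i, l)) \<omega> * (B $$ (l, j)) \<omega>)"
proof
  fix \<omega>
  show "((A * B) $$ (i, j)) \<omega> = (\<Sum>l<n. (A $$ (i, l)) \<omega> * (B $$ (l, j)) \<omega>)"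
    using assms by (auto simp: scalar_prod_def sum_fun_apply intro!: sum.cong)
qed

lemma random_matrix_algebra_simps:
  "carrier (random_matrix_algebra M n) =
     {A \<in> carrier_mat n n. \<forall>j<n. \<forall>k<n. A $$ (j, k) \<in> moment_algebra M}"
  "mult (random_matrix_algebra M n) = (*)"
  "one (random_matrix_algebra M n) = 1\<^sub>m n"
  "zero (random_matrix_algebra M n) = 0\<^sub>m n n"
  "add (random_matrix_algebra M n) = (+)"
  "smult (random_matrix_algebra M n) = (\<lambda>c A. (\<lambda>_. c) \<cdot>\<^sub>m A)"
  by (simp_all add: random_matrix_algebra_def)

lemma cring_complex_ring: "cring complex_ring"
proof (rule cringI)
  show "abelian_group complex_ring"
    by (rule abelian_groupI)
       (auto simp: complex_ring_def algebra_simps intro: exI[of _ "- x" for x])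
  show "comm_monoid complex_ring"
    by (rule comm_monoidI) (auto simp: complex_ring_def)
qed (auto simp: complex_ring_def algebra_simps)

lemma (in prob_space) abelian_group_random_matrix_algebra:
  "abelian_group (random_matrix_algebra M n)"
proof (rule abelian_groupI; unfold random_matrix_algebra_simps mem_Collect_eq)
  fix A assume A: "A \<in> carrier_mat n n \<and> (\<forall>j<n. \<forall>k<n. A $$ (j, k) \<in> moment_algebra M)"
  show "\<exists>B\<in>{A \<in> carrier_mat n n. \<forall>j<n. \<forall>k<n. A $$ (j, k) \<in> moment_algebra M}. B + A = 0\<^sub>m n n"
  proof (intro bexI[of _ "- A"])
    show "- A \<in> {A \<in> carrier_mat n n. \<forall>j<n. \<forall>k<n. A $$ (j, k) \<in> moment_algebra M}"
      using A by (auto simp: fun_Compl_def intro!: moment_algebra_uminus)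
  qed (use A in auto)
qed (auto simp: plus_fun_def zero_fun_def comm_add_mat intro!: moment_algebra_intros)

lemma (in prob_space) ring_random_matrix_algebra: "ring (random_matrix_algebra M n)"
proof (rule ringI)
  show "abelian_group (random_matrix_algebra M n)"
    by (rule abelian_group_random_matrix_algebra)
  show "monoid (random_matrix_algebra M n)"
  proof (rule monoidI; unfold random_matrix_algebra_simps mem_Collect_eq)
    fix A B assume "A \<in> carrier_mat n n \<and> (\<forall>j<n. \<forall>k<n. A $$ (j, k) \<in> moment_algebra M)"
      "B \<in> carrier_mat n n \<and> (\<forall>j<n. \<forall>k<n. B $$ (j, k) \<in> moment_algebra M)"
    then show "A * B \<in> carrier_mat n n \<and> (\<forall>j<n. \<forall>k<n. (A * B) $$ (j, k) \<in> moment_algebra M)"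
      by (auto simp del: index_mult_mat simp: mult_mat_entry[of _ n] intro!: moment_algebra_intros)
  next
    show "1\<^sub>m n \<in> carrier_mat n n \<and> (\<forall>j<n. \<forall>k<n. 1\<^sub>m n $$ (j, k) \<in> moment_algebra M)"
      by (auto simp: one_fun_def zero_fun_def intro!: moment_algebra_intros)
  qed auto
qed (auto simp: random_matrix_algebra_simps intro: add_mult_distrib_mat mult_add_distrib_mat)

lemma (in prob_space) module_random_matrix_algebra:
  "module complex_ring (random_matrix_algebra M n)"
proof (rule moduleI)
  show "cring complex_ring" by (rule cring_complex_ring)
  show "abelian_group (random_matrix_algebra M n)"
    by (rule abelian_group_random_matrix_algebra)
qed (auto simp: random_matrix_algebra_simps complex_ring_def times_fun_def plus_fun_def one_fun_def
        algebra_simps intro!: eq_matI moment_algebra_intros)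

lemma mat_trace_apply:
  "mat_trace A \<omega> = (\<Sum>j<dim_row A. (A $$ (j, j)) \<omega>)" for A :: "('w \<Rightarrow> complex) mat"
  by (simp add: mat_trace_def sum_fun_apply)

lemma (in prob_space) nc_prob_space_random_matrix_algebra:
  assumes n: "n \<ge> 1"
  shows "nc_prob_space (random_matrix_algebra M n) (expected_trace M n)"
proof -
  interpret A: module complex_ring "random_matrix_algebra M n"
    by (rule module_random_matrix_algebra)
  interpret A: ring "random_matrix_algebra M n"
    by (rule ring_random_matrix_algebra)
  have int: "integrable M (A $$ (j, j))"
    if "A \<in> carrier (random_matrix_algebra M n)" "j < n" for A j
    using that by (auto simp: random_matrix_algebra_simps intro: moment_algebra_integrable)
  show ?thesis
  proof unfold_locales
    fix A B and c :: complex
    assume A: "A \<in> carrier (random_matrix_algebra M n)"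
      and B: "B \<in> carrier (random_matrix_algebra M n)"
    show "c \<odot>\<^bsub>random_matrix_algebra M n\<^esub> A \<otimes>\<^bsub>random_matrix_algebra M n\<^esub> B =
          c \<odot>\<^bsub>random_matrix_algebra M n\<^esub> (A \<otimes>\<^bsub>random_matrix_algebra M n\<^esub> B)"
      using A B by (auto simp: random_matrix_algebra_simps)
    show "A \<otimes>\<^bsub>random_matrix_algebra M n\<^esub> (c \<odot>\<^bsub>random_matrix_algebra M n\<^esub> B) =
          c \<odot>\<^bsub>random_matrix_algebra M n\<^esub> (A \<otimes>\<^bsub>random_matrix_algebra M n\<^esub> B)"
      using A B by (auto simp: random_matrix_algebra_simps)
    have [simp]: "dim_row A = n" "dim_col A = n" "dim_row B = n" "dim_col B = n"
      using A B by (auto simp: random_matrix_algebra_simps)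
    show "expected_trace M n (A \<oplus>\<^bsub>random_matrix_algebra M n\<^esub> B) =
          expected_trace M n A + expected_trace M n B"
    proof -
      have "(\<integral>\<omega>. (\<Sum>j<n. (A $$ (j, j)) \<omega>) + (\<Sum>j<n. (B $$ (j, j)) \<omega>) \<partial>M) =
          (\<integral>\<omega>. (\<Sum>j<n. (A $$ (j, j)) \<omega>) \<partial>M) + (\<integral>\<omega>. (\<Sum>j<n. (B $$ (j, j)) \<omega>) \<partial>M)"
        using int[OF A] int[OF B] by (intro Bochner_Integration.integral_add integrable_sum) auto
      then show ?thesis
        by (simp add: random_matrix_algebra_simps expected_trace_def mat_trace_apply
            sum.distrib add_divide_distrib)
    qed
    show "expected_trace M n (c \<odot>\<^bsub>random_matrix_algebra M n\<^esub> A) = c * expected_trace M n A"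
      using int[OF A]
      by (auto simp: random_matrix_algebra_simps expected_trace_def mat_trace_apply
            sum_distrib_left[symmetric])
  next
    show "expected_trace M n \<one>\<^bsub>random_matrix_algebra M n\<^esub> = 1"
      using n by (simp add: random_matrix_algebra_simps expected_trace_def mat_trace_apply prob_space)
  qed
qed

context nc_prob_space
begin

lemma prod_word_closed: "set xs \<subseteq> carrier A \<Longrightarrow> prod_word A xs \<in> carrier A"
  by (induction xs) (auto simp: prod_word_def)

lemma monomial_closed: "a ` J \<subseteq> carrier A \<Longrightarrow> w \<in> lists J \<Longrightarrow> monomial A a w \<in> carrier A"
  unfolding monomial_def by (rule prod_word_closed) auto

lemma phi_zero: "\<phi> \<zero> = 0"
  using phi_add[of \<zero> \<zero>] by simp

lemma phi_finsum:
  "finite I \<Longrightarrow> (\<And>i. i \<in> I \<Longrightarrow> f i \<in> carrier A) \<Longrightarrow> \<phi> (\<Oplus>i\<in>I. f i) = (\<Sum>i\<in>I. \<phi> (f i))"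
  by (induction I rule: finite_induct) (auto simp: phi_zero phi_add Pi_def)

lemma phi_nc_eval:
  assumes "a ` J \<subseteq> carrier A" "P \<in> nc_polys J"
  shows "\<phi> (nc_eval A a P) =
    (\<Sum>w\<in>Poly_Mapping.keys P. Poly_Mapping.lookup P w * \<phi> (monomial A a w))"
proof -
  have *: "monomial A a w \<in> carrier A" if "w \<in> Poly_Mapping.keys P" for w
    using assms that by (intro monomial_closed[of _ J]) (auto simp: nc_polys_def)
  then have "Poly_Mapping.lookup P w \<odot> monomial A a w \<in> carrier A"
    if "w \<in> Poly_Mapping.keys P" for w
    using that by (intro smult_closed) (auto simp: complex_ring_def)
  then show ?thesis
    using * by (simp add: nc_eval_def phi_finsum phi_smult)
qed

end

text \<open>Both functionals are linear, so convergence need only be checked on monomials.\<close>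
lemma converges_in_lawI:
  fixes J :: "'i set"
  assumes "\<And>n. n \<ge> 1 \<Longrightarrow> nc_prob_space (A n) (\<phi> n)" "\<And>n. n \<ge> 1 \<Longrightarrow> a n ` J \<subseteq> carrier (A n)"
    and "nc_prob_space B \<psi>" "b ` J \<subseteq> carrier B"
    and "\<And>w. w \<in> lists J \<Longrightarrow>
      (\<lambda>n. \<phi> n (monomial (A n) (a n) w)) \<longlonglongrightarrow> \<psi> (monomial B b w)"
  shows "converges_in_law J A \<phi> a B \<psi> b"
  unfolding converges_in_law_def
proof (intro conjI ballI allI impI assms(1-4))
  fix P :: "'i nc_poly" assume P: "P \<in> nc_polys J"
  let ?s = "\<lambda>\<psi> B b. \<Sum>w\<in>Poly_Mapping.keys P. Poly_Mapping.lookup P w * \<psi> (monomial B b w)"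
  have "(\<lambda>n. \<Sum>w\<in>Poly_Mapping.keys P. Poly_Mapping.lookup P w * \<phi> n (monomial (A n) (a n) w))
    \<longlonglongrightarrow> (\<Sum>w\<in>Poly_Mapping.keys P. Poly_Mapping.lookup P w * \<psi> (monomial B b w))"
    using P by (intro tendsto_intros assms(5)) (auto simp: nc_polys_def)
  moreover have "\<forall>\<^sub>F n in sequentially. \<phi> n (nc_eval (A n) (a n) P) =
     (\<Sum>w\<in>Poly_Mapping.keys P. Poly_Mapping.lookup P w * \<phi> n (monomial (A n) (a n) w))"
    using eventually_ge_at_top[of 1]
    by eventually_elim (intro nc_prob_space.phi_nc_eval[where J = J] assms(1,2) P)
  ultimately show "(\<lambda>n. \<phi> n (nc_eval (A n) (a n) P)) \<longlonglongrightarrow> \<psi> (nc_eval B b P)"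
    using nc_prob_space.phi_nc_eval[OF assms(3,4) P] by (simp add: tendsto_cong)
qed

section \<open>Mixed powers and their Taylor expansion\<close>

text \<open>An alternating product \<open>z\<^sub>1 cnj z\<^sub>2 z\<^sub>3 \<dots>\<close> depends on each variable through such a monomial, so
  their expectations are all the moments that matter.\<close>
definition mixed_power :: "nat \<Rightarrow> nat \<Rightarrow> complex \<Rightarrow> complex" where
  "mixed_power a b z = z ^ a * cnj z ^ b"

lemma norm_mixed_power: "norm (mixed_power a b z) = norm z ^ (a + b)"
  by (simp add: mixed_power_def norm_mult norm_power power_add)

lemma mixed_power_diag: "mixed_power m m z = complex_of_real (norm z ^ (2 * m))"
proof -
  have "mixed_power m m z = (z * cnj z) ^ m"
    by (simp add: mixed_power_def power_mult_distrib)
  also have "\<dots> = complex_of_real (norm z ^ (2 * m))"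
    by (simp add: complex_norm_square[symmetric] power_mult)
  finally show ?thesis .
qed

lemma cnj_mixed_power: "cnj (mixed_power a b z) = mixed_power b a z"
  by (simp add: mixed_power_def mult.commute)

lemma mixed_power_measurable: "mixed_power a b \<in> borel_measurable borel"
  unfolding mixed_power_def[abs_def]
  by (auto intro!: borel_measurable_continuous_onI continuous_intros)

lemma (in prob_space) mixed_power_moment_algebra:
  "f \<in> moment_algebra M \<Longrightarrow> (\<lambda>\<omega>. mixed_power a b (f \<omega>)) \<in> moment_algebra M"
  unfolding mixed_power_def by (intro moment_algebra_intros)

text \<open>The remainders are bounded through powers of a common bound \<open>D \<ge> 1\<close> of both base points. This is wasteful but keeps the estimates polynomial, so that they can be integrated
  without any assumption beyond finite moments.\<close>
lemma power_taylor1: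
  fixes u d :: complex
  assumes "norm u \<le> D" "norm (u + d) \<le> D" "1 \<le> D" "norm d \<le> \<delta>"
  shows "norm ((u + d) ^ a - u ^ a) \<le> real a * \<delta> * D ^ a"
proof (induction a)
  case (Suc a)
  have \<delta>: "0 \<le> \<delta>" using assms(4) norm_ge_zero order_trans by blast
  have "(u + d) ^ Suc a - u ^ Suc a = (u + d) * ((u + d) ^ a - u ^ a) + d * u ^ a"
    by (simp add: algebra_simps)
  also have "norm \<dots> \<le> D * (real a * \<delta> * D ^ a) + \<delta> * D ^ a"
    using assms Suc \<delta> by (intro order_trans[OF norm_triangle_ineq] add_mono)
      (auto simp: norm_mult norm_power intro!: mult_mono power_mono)
  also have "\<dots> \<le> D * (real a * \<delta> * D ^ a) + \<delta> * (D * D ^ a)"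
    using \<delta> assms(3) by (intro add_left_mono mult_left_mono) (auto simp: mult_le_cancel_right1)
  also have "\<dots> = real (Suc a) * \<delta> * D ^ Suc a"
    by (simp add: algebra_simps)
  finally show ?case .
qed auto

lemma power_taylor2:
  fixes u d :: complex
  assumes "norm u \<le> D" "norm (u + d) \<le> D" "1 \<le> D" "norm d \<le> \<delta>"
  shows "norm ((u + d) ^ a - u ^ a - of_nat a * u ^ (a - 1) * d) \<le> real a ^ 2 * \<delta>\<^sup>2 * D ^ a"
proof (induction a)
  case (Suc a)
  have \<delta>: "0 \<le> \<delta>" using assms(4) norm_ge_zero order_trans by blast
  have "(u + d) ^ Suc a - u ^ Suc a - of_nat (Suc a) * u ^ (Suc a - 1) * d =
      (u + d) * ((u + d) ^ a - u ^ a - of_nat a * u ^ (a - 1) * d) + of_nat a * u ^ (a - 1) * d\<^sup>2"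
    by (cases a) (simp_all add: algebra_simps power2_eq_square)
  also have "norm \<dots> \<le> D * (real a ^ 2 * \<delta>\<^sup>2 * D ^ a) + real a * D ^ (a - 1) * \<delta>\<^sup>2"
    using assms Suc \<delta> by (intro order_trans[OF norm_triangle_ineq] add_mono)
      (auto simp: norm_mult norm_power intro!: mult_mono power_mono)
  also have "\<dots> \<le> D * (real a ^ 2 * \<delta>\<^sup>2 * D ^ a) + real a * D ^ Suc a * \<delta>\<^sup>2"
    using \<delta> assms(3) by (intro add_left_mono mult_right_mono mult_left_mono power_increasing) auto
  also have "\<dots> = (real a ^ 2 + real a) * (\<delta>\<^sup>2 * D ^ Suc a)"
    by (simp add: algebra_simps)
  also have "\<dots> \<le> real (Suc a) ^ 2 * (\<delta>\<^sup>2 * D ^ Suc a)"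
  proof (rule mult_right_mono)
    show "real a ^ 2 + real a \<le> real (Suc a) ^ 2"
      by (simp add: power2_eq_square algebra_simps)
    show "0 \<le> \<delta>\<^sup>2 * D ^ Suc a"
      using assms(3) by simp
  qed
  finally show ?case by (simp add: mult.assoc)
qed auto

lemma mixed_power_taylor1:
  assumes "norm u \<le> D" "norm (u + d) \<le> D" "1 \<le> D" "norm d \<le> \<delta>"
  shows "norm (mixed_power a b (u + d) - mixed_power a b u) \<le> real (a + b) * \<delta> * D ^ (a + b)"
proof -
  have \<delta>: "0 \<le> \<delta>" using assms(4) norm_ge_zero order_trans by blast
  have 1: "norm ((u + d) ^ a - u ^ a) \<le> real a * \<delta> * D ^ a"
    using assms by (rule power_taylor1)
  have 2: "norm (cnj (u + d) ^ b - cnj u ^ b) \<le> real b * \<delta> * D ^ b"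
    using power_taylor1[of u D d \<delta> b] assms
    by (metis complex_cnj_diff complex_cnj_power complex_mod_cnj)
  have "mixed_power a b (u + d) - mixed_power a b u =
      ((u + d) ^ a - u ^ a) * cnj (u + d) ^ b + u ^ a * (cnj (u + d) ^ b - cnj u ^ b)"
    by (simp add: mixed_power_def algebra_simps)
  also have "norm \<dots> \<le> (real a * \<delta> * D ^ a) * D ^ b + D ^ a * (real b * \<delta> * D ^ b)"
    using assms 1 2 \<delta>
    by (intro order_trans[OF norm_triangle_ineq] add_mono; unfold norm_mult norm_power complex_mod_cnj;
        intro mult_mono power_mono) auto
  also have "\<dots> = real (a + b) * \<delta> * D ^ (a + b)"
    by (simp add: algebra_simps power_add)
  finally show ?thesis .
qed

text \<open>The derivative of \<open>x \<mapsto> mixed_power a b (z + c x)\<close> at the real point \<open>x = 0\<close>. Being real-linear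
  in \<open>c\<close>, it also serves as the first-order term for a complex increment.\<close>
definition mixed_power_deriv :: "nat \<Rightarrow> nat \<Rightarrow> complex \<Rightarrow> complex \<Rightarrow> complex" where
  "mixed_power_deriv a b c z =
     of_nat a * c * mixed_power (a - 1) b z + of_nat b * cnj c * mixed_power a (b - 1) z"

text \<open>The product of the expansions of \<open>(u + d)\<^sup>a\<close> and of its conjugate counterpart; every term other
  than the constant and the linear ones contains two factors of size \<open>\<delta>\<close>.\<close>
lemma mixed_power_taylor2:
  assumes "norm u \<le> D" "norm (u + d) \<le> D" "1 \<le> D" "norm d \<le> \<delta>"
  shows "norm (mixed_power a b (u + d) - mixed_power a b u - mixed_power_deriv a b d u)
           \<le> real (a + b) ^ 2 * \<delta>\<^sup>2 * D ^ (a + b)"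
proof -
  have \<delta>: "0 \<le> \<delta>" using assms(4) norm_ge_zero order_trans by blast
  define L where "L = of_nat b * cnj u ^ (b - 1) * cnj d"
  have 1: "norm ((u + d) ^ a - u ^ a) \<le> real a * \<delta> * D ^ a"
    using assms by (rule power_taylor1)
  have 2: "norm ((u + d) ^ a - u ^ a - of_nat a * u ^ (a - 1) * d) \<le> real a ^ 2 * \<delta>\<^sup>2 * D ^ a"
    using assms by (rule power_taylor2)
  have "norm (cnj ((u + d) ^ b - u ^ b - of_nat b * u ^ (b - 1) * d)) \<le> real b ^ 2 * \<delta>\<^sup>2 * D ^ b"
    unfolding complex_mod_cnj using assms by (rule power_taylor2)
  then have 3: "norm (cnj (u + d) ^ b - cnj u ^ b - L) \<le> real b ^ 2 * \<delta>\<^sup>2 * D ^ b"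
    by (simp add: L_def)
  have "norm L \<le> real b * D ^ (b - 1) * \<delta>"
    using assms unfolding L_def by (auto simp: norm_mult norm_power intro!: mult_mono power_mono)
  also have "\<dots> \<le> real b * D ^ b * \<delta>"
    using \<delta> assms(3) by (intro mult_right_mono mult_left_mono power_increasing) auto
  finally have 4: "norm L \<le> real b * D ^ b * \<delta>" .
  have "mixed_power a b (u + d) - mixed_power a b u - mixed_power_deriv a b d u =
      ((u + d) ^ a - u ^ a - of_nat a * u ^ (a - 1) * d) * cnj u ^ b
      + ((u + d) ^ a - u ^ a) * L
      + (u + d) ^ a * (cnj (u + d) ^ b - cnj u ^ b - L)"
    by (simp add: mixed_power_def mixed_power_deriv_def L_def algebra_simps)
  also have "norm \<dots> \<le> (real a ^ 2 * \<delta>\<^sup>2 * D ^ a) * D ^ b + (real a * \<delta> * D ^ a) * (real b * D ^ b * \<delta>)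
      + D ^ a * (real b ^ 2 * \<delta>\<^sup>2 * D ^ b)"
    using assms 1 2 3 4 \<delta>
    by (intro order_trans[OF norm_triangle_ineq] add_mono; (intro order_trans[OF norm_triangle_ineq] add_mono)?;
        unfold norm_mult norm_power complex_mod_cnj; intro mult_mono power_mono) auto
  also have "\<dots> = (real a ^ 2 + real a * real b + real b ^ 2) * (\<delta>\<^sup>2 * D ^ (a + b))"
    by (simp add: algebra_simps power_add power2_eq_square)
  also have "\<dots> \<le> real (a + b) ^ 2 * (\<delta>\<^sup>2 * D ^ (a + b))"
  proof (rule mult_right_mono)
    show "real a ^ 2 + real a * real b + real b ^ 2 \<le> real (a + b) ^ 2"
      by (simp add: power2_eq_square algebra_simps)
    show "0 \<le> \<delta>\<^sup>2 * D ^ (a + b)"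
      using assms(3) by simp
  qed
  finally show ?thesis by (simp add: mult.assoc)
qed

lemma power_add3_le:
  fixes x y :: real assumes "0 \<le> x" "0 \<le> y"
  shows "(1 + x + y) ^ k \<le> 3 ^ k * (1 + x ^ k + y ^ k)"
proof -
  define m where "m = max 1 (max x y)"
  have "(1 + x + y) ^ k \<le> (3 * m) ^ k"
    using assms by (intro power_mono) (auto simp: m_def)
  also have "\<dots> = 3 ^ k * m ^ k" by (simp add: power_mult_distrib)
  also have "m ^ k \<le> 1 + x ^ k + y ^ k"
    using assms by (auto simp: m_def max_def add_nonneg_nonneg)
  finally show ?thesis by simp
qed

section \<open>The moment recursion of a complex Gaussian variable\<close>

definition gaussian_moment :: "nat \<Rightarrow> nat \<Rightarrow> real" where
  "gaussian_moment a b = (if a = b then fact a else 0)"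

text \<open>The error accumulated by a recursion \<open>m(a + 1, b) = b m(a, b - 1)\<close> that is violated by at most
  \<open>K (a + b)\<close> in suitable units, started from \<open>m(0, 0) = 1\<close>.\<close>
fun moment_error :: "(nat \<Rightarrow> real) \<Rightarrow> nat \<Rightarrow> nat \<Rightarrow> real" where
  "moment_error K 0 0 = 0"
| "moment_error K 0 (Suc b) = K b"
| "moment_error K (Suc a) 0 = K a"
| "moment_error K (Suc a) (Suc b) = K (a + Suc b) + real (Suc b) * moment_error K a b"

lemma moment_error_nonneg: "(\<And>k. 0 \<le> K k) \<Longrightarrow> 0 \<le> moment_error K a b"
  by (induction K a b rule: moment_error.induct) auto

text \<open>The recursion lowers both indices until one of them is \<open>0\<close>. If they reach \<open>0\<close> together the
  factors \<open>b\<close> multiply up to a factorial; if the second one is exhausted first the recursion gives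
  \<open>0\<close>, and conjugation exchanges the roles. The lemma is applied twice: with
  \<open>\<epsilon> = 0\<close> to a Gaussian variable, and with small \<open>\<epsilon>\<close> to sums of many independent terms.\<close>
lemma moment_recursion_error:
  fixes E :: "nat \<Rightarrow> nat \<Rightarrow> complex"
  assumes E00: "E 0 0 = 1" and cnj: "\<And>a b. E a b = cnj (E b a)"
    and rec: "\<And>a b. norm (E (Suc a) b - of_nat b * E a (b - 1)) \<le> K (a + b) * \<epsilon>"
  shows "norm (E a b - complex_of_real (gaussian_moment a b)) \<le> moment_error K a b * \<epsilon>"
proof (induction a arbitrary: b)
  case 0
  show ?case
  proof (cases b)
    case 0
    then show ?thesis by (simp add: gaussian_moment_def E00)
  next
    case (Suc b')
    then show ?thesis
      using rec[of b' 0] cnj[of 0 b] by (simp add: gaussian_moment_def)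
  qed
next
  case (Suc a)
  show ?case
  proof (cases b)
    case 0
    then show ?thesis
      using rec[of a 0] by (simp add: gaussian_moment_def)
  next
    case (Suc b')
    have gm: "gaussian_moment (Suc a) (Suc b') = real (Suc b') * gaussian_moment a b'"
      by (simp add: gaussian_moment_def)
    have "E (Suc a) b - complex_of_real (gaussian_moment (Suc a) b) =
       (E (Suc a) b - of_nat b * E a (b - 1)) + of_nat b * (E a b' - complex_of_real (gaussian_moment a b'))"
      unfolding Suc gm by (simp add: algebra_simps)
    also have "norm \<dots> \<le> K (a + b) * \<epsilon> + real b * (moment_error K a b' * \<epsilon>)"
      using rec[of a b] Suc.IH[of b']
      by (intro order_trans[OF norm_triangle_ineq] add_mono) (auto simp: norm_mult intro!: mult_left_mono)
    finally show ?thesis unfolding Suc by (simp add: algebra_simps)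
  qed
qed

text \<open>Gaussian integration by parts \<open>E(x f) = E(\<partial>f/\<partial>x) / 2\<close>, carried over from monomials in \<open>x\<close> and
  \<open>y\<close> to mixed powers of a linear form: the identity is compatible with the product rule when \<open>f\<close> is
  multiplied by a linear form \<open>\<gamma> x + \<delta> y\<close>. For the induction on the number of linear factors
  the statement is strengthened by a free monomial \<open>x\<^sup>j y\<^sup>l\<close>, which absorbs the \<open>x\<close> and \<open>y\<close> of
  the new factor.\<close>
lemma (in prob_space) stein_product_rule:
  fixes x y :: "'a \<Rightarrow> complex"
  assumes x: "x \<in> moment_algebra M" and y: "y \<in> moment_algebra M"
    and real: "\<And>\<omega>. cnj (x \<omega>) = x \<omega>" "\<And>\<omega>. cnj (y \<omega>) = y \<omega>"
    and stein: "\<And>j l. expectation (\<lambda>\<omega>. x \<omega> ^ Suc j * y \<omega> ^ l) =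
      of_nat j / 2 * expectation (\<lambda>\<omega>. x \<omega> ^ (j - 1) * y \<omega> ^ l)"
  shows "expectation (\<lambda>\<omega>. x \<omega> * mixed_power a b (\<alpha> * x \<omega> + \<beta> * y \<omega>)) =
    1 / 2 * expectation (\<lambda>\<omega>. mixed_power_deriv a b \<alpha> (\<alpha> * x \<omega> + \<beta> * y \<omega>))"
proof -
  \<comment> \<open>\<open>f'\<close> plays the role of the partial derivative of \<open>f\<close> with respect to \<open>x\<close>.\<close>
  define P where "P f f' \<longleftrightarrow> f \<in> moment_algebra M \<and> f' \<in> moment_algebra M \<and>
    (\<forall>j l. expectation (\<lambda>\<omega>. x \<omega> ^ Suc j * y \<omega> ^ l * f \<omega>) =
      1 / 2 * (of_nat j * expectation (\<lambda>\<omega>. x \<omega> ^ (j - 1) * y \<omega> ^ l * f \<omega>)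
         + expectation (\<lambda>\<omega>. x \<omega> ^ j * y \<omega> ^ l * f' \<omega>)))"
    for f f' :: "'a \<Rightarrow> complex"
  have int: "integrable M (\<lambda>\<omega>. x \<omega> ^ j * y \<omega> ^ l * f \<omega>)" if "f \<in> moment_algebra M" for j l f
    by (intro moment_algebra_integrable moment_algebra_intros x y that)
  have P1: "P (\<lambda>_. 1) (\<lambda>_. 0)"
    using stein by (auto simp: P_def intro: moment_algebra_const)
  have step: "P (\<lambda>\<omega>. (\<gamma> * x \<omega> + \<delta> * y \<omega>) * f \<omega>) (\<lambda>\<omega>. \<gamma> * f \<omega> + (\<gamma> * x \<omega> + \<delta> * y \<omega>) * f' \<omega>)"
    if P: "P f f'" for f f' and \<gamma> \<delta> :: complex
    unfolding P_def
  proof (intro conjI allI)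
    have f: "f \<in> moment_algebra M" and f': "f' \<in> moment_algebra M"
      and rec: "expectation (\<lambda>\<omega>. x \<omega> ^ Suc j * y \<omega> ^ l * f \<omega>) =
        1 / 2 * (of_nat j * expectation (\<lambda>\<omega>. x \<omega> ^ (j - 1) * y \<omega> ^ l * f \<omega>)
         + expectation (\<lambda>\<omega>. x \<omega> ^ j * y \<omega> ^ l * f' \<omega>))" for j l
      using P by (auto simp: P_def)
    show "(\<lambda>\<omega>. (\<gamma> * x \<omega> + \<delta> * y \<omega>) * f \<omega>) \<in> moment_algebra M"
      "(\<lambda>\<omega>. \<gamma> * f \<omega> + (\<gamma> * x \<omega> + \<delta> * y \<omega>) * f' \<omega>) \<in> moment_algebra M"
      by (intro moment_algebra_intros x y f f')+
    fix j l
    have split: "expectation (\<lambda>\<omega>. x \<omega> ^ i * y \<omega> ^ l * ((\<gamma> * x \<omega> + \<delta> * y \<omega>) * g \<omega>)) =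
        \<gamma> * expectation (\<lambda>\<omega>. x \<omega> ^ Suc i * y \<omega> ^ l * g \<omega>)
        + \<delta> * expectation (\<lambda>\<omega>. x \<omega> ^ i * y \<omega> ^ Suc l * g \<omega>)"
      if g: "g \<in> moment_algebra M" for i g
    proof -
      have "x \<omega> ^ i * y \<omega> ^ l * ((\<gamma> * x \<omega> + \<delta> * y \<omega>) * g \<omega>) =
        \<gamma> * (x \<omega> ^ Suc i * y \<omega> ^ l * g \<omega>) + \<delta> * (x \<omega> ^ i * y \<omega> ^ Suc l * g \<omega>)" for \<omega>
        by (simp add: algebra_simps)
      then show ?thesis using int[OF g, of "Suc i" l] int[OF g, of i "Suc l"] by (simp del: power_Suc)
    qed
    have split2: "expectation (\<lambda>\<omega>. x \<omega> ^ j * y \<omega> ^ l * (\<gamma> * f \<omega> + (\<gamma> * x \<omega> + \<delta> * y \<omega>) * f' \<omega>)) =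
        \<gamma> * expectation (\<lambda>\<omega>. x \<omega> ^ j * y \<omega> ^ l * f \<omega>)
        + (\<gamma> * expectation (\<lambda>\<omega>. x \<omega> ^ Suc j * y \<omega> ^ l * f' \<omega>)
        + \<delta> * expectation (\<lambda>\<omega>. x \<omega> ^ j * y \<omega> ^ Suc l * f' \<omega>))"
    proof -
      have 1: "x \<omega> ^ j * y \<omega> ^ l * (\<gamma> * f \<omega> + (\<gamma> * x \<omega> + \<delta> * y \<omega>) * f' \<omega>) =
        \<gamma> * (x \<omega> ^ j * y \<omega> ^ l * f \<omega>) + x \<omega> ^ j * y \<omega> ^ l * ((\<gamma> * x \<omega> + \<delta> * y \<omega>) * f' \<omega>)" for \<omega>
        by (simp add: algebra_simps)
      have 2: "integrable M (\<lambda>\<omega>. x \<omega> ^ j * y \<omega> ^ l * ((\<gamma> * x \<omega> + \<delta> * y \<omega>) * f' \<omega>))"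
        by (intro int moment_algebra_intros x y f')
      have "expectation (\<lambda>\<omega>. x \<omega> ^ j * y \<omega> ^ l * (\<gamma> * f \<omega> + (\<gamma> * x \<omega> + \<delta> * y \<omega>) * f' \<omega>)) =
          expectation (\<lambda>\<omega>. \<gamma> * (x \<omega> ^ j * y \<omega> ^ l * f \<omega>) +
            x \<omega> ^ j * y \<omega> ^ l * ((\<gamma> * x \<omega> + \<delta> * y \<omega>) * f' \<omega>))"
        by (simp only: 1)
      also have "\<dots> = expectation (\<lambda>\<omega>. \<gamma> * (x \<omega> ^ j * y \<omega> ^ l * f \<omega>)) +
          expectation (\<lambda>\<omega>. x \<omega> ^ j * y \<omega> ^ l * ((\<gamma> * x \<omega> + \<delta> * y \<omega>) * f' \<omega>))"
        by (intro Bochner_Integration.integral_add 2 integrable_mult_right int f)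
      finally show ?thesis
        by (simp only: split[OF f'] integral_mult_right_zero)
    qed
    show "expectation (\<lambda>\<omega>. x \<omega> ^ Suc j * y \<omega> ^ l * ((\<gamma> * x \<omega> + \<delta> * y \<omega>) * f \<omega>)) =
      1 / 2 * (of_nat j * expectation (\<lambda>\<omega>. x \<omega> ^ (j - 1) * y \<omega> ^ l * ((\<gamma> * x \<omega> + \<delta> * y \<omega>) * f \<omega>))
         + expectation (\<lambda>\<omega>. x \<omega> ^ j * y \<omega> ^ l * (\<gamma> * f \<omega> + (\<gamma> * x \<omega> + \<delta> * y \<omega>) * f' \<omega>)))"
      unfolding split[OF f] split2 rec[of "Suc j"] rec[of j]
      by (cases j) (simp_all add: algebra_simps)
  qed
  let ?z = "\<lambda>\<omega>. \<alpha> * x \<omega> + \<beta> * y \<omega>"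
  have P: "P (\<lambda>\<omega>. mixed_power a b (?z \<omega>)) (\<lambda>\<omega>. mixed_power_deriv a b \<alpha> (?z \<omega>))" for a b
  proof (induction b)
    case 0
    show ?case
    proof (induction a)
      case 0
      then show ?case using P1 by (simp add: mixed_power_def mixed_power_deriv_def)
    next
      case (Suc a)
      have "(\<alpha> * mixed_power a 0 z + z * mixed_power_deriv a 0 \<alpha> z) = mixed_power_deriv (Suc a) 0 \<alpha> z" for z
        by (cases a) (auto simp: mixed_power_def mixed_power_deriv_def algebra_simps)
      moreover have "z * mixed_power a 0 z = mixed_power (Suc a) 0 z" for z
        by (simp add: mixed_power_def)
      ultimately show ?case using step[OF Suc, of \<alpha> \<beta>] by simp
    qed
  next
    case (Suc b)
    have "(cnj \<alpha> * mixed_power a b z + cnj z * mixed_power_deriv a b \<alpha> z) = mixed_power_deriv a (Suc b) \<alpha> z" for z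
      by (cases b) (auto simp: mixed_power_def mixed_power_deriv_def algebra_simps)
    moreover have "cnj z * mixed_power a b z = mixed_power a (Suc b) z" for z
      by (simp add: mixed_power_def)
    moreover have "cnj \<alpha> * x \<omega> + cnj \<beta> * y \<omega> = cnj (?z \<omega>)" for \<omega>
      by (simp add: real)
    ultimately show ?case using step[OF Suc, of "cnj \<alpha>" "cnj \<beta>"] by presburger
  qed
  then have "\<forall>j l. expectation (\<lambda>\<omega>. x \<omega> ^ Suc j * y \<omega> ^ l * mixed_power a b (?z \<omega>)) =
      1 / 2 * (of_nat j * expectation (\<lambda>\<omega>. x \<omega> ^ (j - 1) * y \<omega> ^ l * mixed_power a b (?z \<omega>))
         + expectation (\<lambda>\<omega>. x \<omega> ^ j * y \<omega> ^ l * mixed_power_deriv a b \<alpha> (?z \<omega>)))"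
    unfolding P_def by blast
  from this[rule_format, of 0 0] show ?thesis by simp
qed

lemma (in prob_space) half_normal_moments:
  assumes D: "distributed M lborel x (normal_density 0 (1 / sqrt 2))"
  shows "integrable M (\<lambda>\<omega>. x \<omega> ^ k)"
    and "integrable M (\<lambda>\<omega>. \<bar>x \<omega>\<bar> ^ k)"
    and "expectation (\<lambda>\<omega>. x \<omega> ^ Suc k) = real k / 2 * expectation (\<lambda>\<omega>. x \<omega> ^ (k - 1))"
proof -
  have s: "0 < 1 / sqrt (2 :: real)" by simp
  have eq: "expectation (\<lambda>\<omega>. x \<omega> ^ k) = (\<integral>r. normal_density 0 (1 / sqrt 2) r * (r - 0) ^ k \<partial>lborel)" for k
    using distributed_integral[OF D, of "\<lambda>r. r ^ k"] by simp
  show "integrable M (\<lambda>\<omega>. x \<omega> ^ k)"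
    using distributed_integrable[OF D, of "\<lambda>r. r ^ k"] integrable_normal_moment[OF s, of 0 k] by simp
  show "integrable M (\<lambda>\<omega>. \<bar>x \<omega>\<bar> ^ k)"
    using distributed_integrable[OF D, of "\<lambda>r. \<bar>r\<bar> ^ k"] integrable_normal_moment_abs[OF s, of 0 k] by simp
  have odd: "expectation (\<lambda>\<omega>. x \<omega> ^ (2 * m + 1)) = 0" for m
    unfolding eq by (rule integral_normal_moment_odd[OF s])
  have even: "expectation (\<lambda>\<omega>. x \<omega> ^ (2 * m)) = fact (2 * m) / (4 ^ m * fact m)" for m
    unfolding eq integral_normal_moment_even[OF s] by (simp add: power2_eq_square)
  show "expectation (\<lambda>\<omega>. x \<omega> ^ Suc k) = real k / 2 * expectation (\<lambda>\<omega>. x \<omega> ^ (k - 1))"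
  proof (cases "even k")
    case True
    then obtain m where k: "k = 2 * m" by (elim evenE)
    show ?thesis
      using odd[of m] odd[of "m - 1"] by (cases m) (auto simp: k)
  next
    case False
    then obtain m where k: "k = 2 * m + 1" by (elim oddE)
    have "expectation (\<lambda>\<omega>. x \<omega> ^ (2 * Suc m)) = real (2 * m + 1) / 2 * expectation (\<lambda>\<omega>. x \<omega> ^ (2 * m))"
      unfolding even by (simp add: field_simps del: of_nat_Suc) (simp add: algebra_simps)
    then show ?thesis by (simp add: k)
  qed
qed

text \<open>For \<open>\<eta> = x + \<i> y\<close>, integration by parts in \<open>x\<close> and in \<open>y\<close> gives
  \<open>E(\<eta> f) = (E(\<partial>f/\<partial>x) + \<i> E(\<partial>f/\<partial>y)) / 2\<close>, the expectation of the antiholomorphic derivative. On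
  mixed powers this is the recursion \<open>m(a + 1, b) = b m(a, b - 1)\<close>.\<close>
lemma (in prob_space) complex_gaussian_moments:
  assumes "standard_complex_gaussian M \<eta>"
  shows "\<eta> \<in> moment_algebra M"
    and "expectation (\<lambda>\<omega>. mixed_power a b (\<eta> \<omega>)) = complex_of_real (gaussian_moment a b)"
proof -
  define x where "x = (\<lambda>\<omega>. Re (\<eta> \<omega>))"
  define y where "y = (\<lambda>\<omega>. Im (\<eta> \<omega>))"
  have [measurable]: "\<eta> \<in> borel_measurable M"
    and ind: "indep_var borel x borel y"
    and Dx: "distributed M lborel x (normal_density 0 (1 / sqrt 2))"
    and Dy: "distributed M lborel y (normal_density 0 (1 / sqrt 2))"
    using assms by (auto simp: standard_complex_gaussian_def x_def y_def)
  have xm: "(\<lambda>\<omega>. complex_of_real (x \<omega>)) \<in> moment_algebra M"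
    by (intro complex_of_real_moment_algebra half_normal_moments(2)[OF Dx]) (simp add: x_def)
  have ym: "(\<lambda>\<omega>. complex_of_real (y \<omega>)) \<in> moment_algebra M"
    by (intro complex_of_real_moment_algebra half_normal_moments(2)[OF Dy]) (simp add: y_def)
  have \<eta>: "\<eta> \<omega> = x \<omega> + \<i> * y \<omega>" for \<omega>
    by (simp add: x_def y_def complex_eq_iff)
  then have \<eta>': "\<eta> = (\<lambda>\<omega>. x \<omega> + \<i> * y \<omega>)" by auto
  show ma: "\<eta> \<in> moment_algebra M"
    unfolding \<eta>' by (intro moment_algebra_intros xm ym)
  have xy: "expectation (\<lambda>\<omega>. complex_of_real (x \<omega> ^ j * y \<omega> ^ l)) =
      complex_of_real (expectation (\<lambda>\<omega>. x \<omega> ^ j) * expectation (\<lambda>\<omega>. y \<omega> ^ l))" for j l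
  proof -
    have "indep_var borel ((\<lambda>r. r ^ j) \<circ> x) borel ((\<lambda>r. r ^ l) \<circ> y)"
      by (rule indep_var_compose[OF ind]) auto
    then have "expectation (\<lambda>\<omega>. x \<omega> ^ j * y \<omega> ^ l) = expectation (\<lambda>\<omega>. x \<omega> ^ j) * expectation (\<lambda>\<omega>. y \<omega> ^ l)"
      using half_normal_moments(1)[OF Dx] half_normal_moments(1)[OF Dy]
      by (intro indep_var_lebesgue_integral) (auto simp: comp_def)
    then show ?thesis by (simp only: integral_complex_of_real)
  qed
  have stein_x: "expectation (\<lambda>\<omega>. complex_of_real (x \<omega>) ^ Suc j * complex_of_real (y \<omega>) ^ l) =
      of_nat j / 2 * expectation (\<lambda>\<omega>. complex_of_real (x \<omega>) ^ (j - 1) * complex_of_real (y \<omega>) ^ l)" for j l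
    unfolding of_real_power[symmetric] of_real_mult[symmetric] xy half_normal_moments(3)[OF Dx] by simp
  have stein_y: "expectation (\<lambda>\<omega>. complex_of_real (y \<omega>) ^ Suc j * complex_of_real (x \<omega>) ^ l) =
      of_nat j / 2 * expectation (\<lambda>\<omega>. complex_of_real (y \<omega>) ^ (j - 1) * complex_of_real (x \<omega>) ^ l)" for j l
    unfolding of_real_power[symmetric] of_real_mult[symmetric] mult.commute[of "y _ ^ _"] xy half_normal_moments(3)[OF Dy] by simp
  define E where "E = (\<lambda>a b. expectation (\<lambda>\<omega>. mixed_power a b (\<eta> \<omega>)))"
  have int: "integrable M (\<lambda>\<omega>. mixed_power a b (\<eta> \<omega>))" for a b
    by (intro moment_algebra_integrable mixed_power_moment_algebra ma)
  have deriv: "expectation (\<lambda>\<omega>. mixed_power_deriv a b \<alpha> (\<eta> \<omega>)) =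
      of_nat a * \<alpha> * E (a - 1) b + of_nat b * cnj \<alpha> * E a (b - 1)" for a b \<alpha>
    unfolding mixed_power_deriv_def E_def using int by simp
  have rec: "E (Suc a) b = of_nat b * E a (b - 1)" for a b
  proof -
    have "mixed_power (Suc a) b (\<eta> \<omega>) = x \<omega> * mixed_power a b (\<eta> \<omega>) + \<i> * (y \<omega> * mixed_power a b (\<eta> \<omega>))" for \<omega>
      by (simp add: mixed_power_def \<eta> algebra_simps)
    moreover have "integrable M (\<lambda>\<omega>. x \<omega> * mixed_power a b (\<eta> \<omega>))" "integrable M (\<lambda>\<omega>. y \<omega> * mixed_power a b (\<eta> \<omega>))"
      by (intro moment_algebra_integrable moment_algebra_intros mixed_power_moment_algebra ma xm ym)+
    ultimately have "E (Suc a) b = expectation (\<lambda>\<omega>. x \<omega> * mixed_power a b (\<eta> \<omega>))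
        + \<i> * expectation (\<lambda>\<omega>. y \<omega> * mixed_power a b (\<eta> \<omega>))"
      unfolding E_def by simp
    also have "expectation (\<lambda>\<omega>. x \<omega> * mixed_power a b (\<eta> \<omega>)) =
        1 / 2 * expectation (\<lambda>\<omega>. mixed_power_deriv a b 1 (\<eta> \<omega>))"
      using stein_product_rule[OF xm ym _ _ stein_x, where a = a and b = b and \<alpha> = 1 and \<beta> = \<i>] by (simp add: \<eta>)
    also have "expectation (\<lambda>\<omega>. y \<omega> * mixed_power a b (\<eta> \<omega>)) =
        1 / 2 * expectation (\<lambda>\<omega>. mixed_power_deriv a b \<i> (\<eta> \<omega>))"
      using stein_product_rule[OF ym xm _ _ stein_y, where a = a and b = b and \<alpha> = \<i> and \<beta> = 1] by (simp add: \<eta> add.commute)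
    finally show ?thesis unfolding deriv by (simp add: algebra_simps)
  qed
  have "norm (E a b - complex_of_real (gaussian_moment a b)) \<le> moment_error (\<lambda>_. 0) a b * 0"
  proof (rule moment_recursion_error)
    show "E 0 0 = 1" by (simp add: E_def mixed_power_def prob_space)
    show "E a b = cnj (E b a)" for a b
      unfolding E_def by (simp add: cnj_mixed_power flip: Bochner_Integration.integral_cnj)
  qed (simp add: rec)
  then show "expectation (\<lambda>\<omega>. mixed_power a b (\<eta> \<omega>)) = complex_of_real (gaussian_moment a b)"
    by (simp add: E_def)
qed

section \<open>Linear forms in independent variables\<close>

definition linear_form :: "('t \<Rightarrow> complex) \<Rightarrow> ('t \<Rightarrow> 'w \<Rightarrow> real) \<Rightarrow> 't set \<Rightarrow> 'w \<Rightarrow> complex" where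
  "linear_form c X I \<omega> = (\<Sum>t\<in>I. c t * complex_of_real (X t \<omega>))"

text \<open>\<open>C\<close> bounds all absolute moments of all members. Every estimate below depends on the family
  only through \<open>C\<close>, which makes the estimates uniform in the size of the matrices.\<close>
locale standardized_family = prob_space M for M :: "'w measure" +
  fixes C :: "nat \<Rightarrow> real" and I :: "'t set" and X :: "'t \<Rightarrow> 'w \<Rightarrow> real"
  assumes finite_I: "finite I"
    and indep: "indep_vars (\<lambda>_. borel) X I"
    and mean: "t \<in> I \<Longrightarrow> expectation (X t) = 0"
    and second_moment: "t \<in> I \<Longrightarrow> expectation (\<lambda>\<omega>. (X t \<omega>)\<^sup>2) = 1"
    and abs_integrable: "t \<in> I \<Longrightarrow> integrable M (\<lambda>\<omega>. \<bar>X t \<omega>\<bar> ^ k)"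
    and abs_moment: "t \<in> I \<Longrightarrow> expectation (\<lambda>\<omega>. \<bar>X t \<omega>\<bar> ^ k) \<le> C k"
begin

lemma subfamily: "J \<subseteq> I \<Longrightarrow> standardized_family M C J X"
  using finite_I indep mean second_moment abs_integrable abs_moment
  by (intro standardized_family.intro standardized_family_axioms.intro prob_space_axioms)
     (auto intro: finite_subset indep_vars_subset)

lemma measurable_X [measurable]: "t \<in> I \<Longrightarrow> X t \<in> borel_measurable M"
  using indep by (auto simp: indep_vars_def)

lemma X_moment_algebra: "t \<in> I \<Longrightarrow> (\<lambda>\<omega>. complex_of_real (X t \<omega>)) \<in> moment_algebra M"
  by (intro complex_of_real_moment_algebra measurable_X abs_integrable)

lemma moment_bound_nonneg: "t \<in> I \<Longrightarrow> 0 \<le> C k"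
  by (rule order_trans[OF _ abs_moment]) auto

lemma linear_form_moment_algebra: "linear_form c X I \<in> moment_algebra M"
  unfolding linear_form_def[abs_def] by (intro moment_algebra_intros X_moment_algebra)

lemma linear_form_split:
  "t \<in> I \<Longrightarrow> linear_form c X I \<omega> = linear_form c X (I - {t}) \<omega> + c t * complex_of_real (X t \<omega>)"
  using finite_I by (simp add: linear_form_def sum.remove[of I t])

lemma expectation_mult_linear_form:
  fixes h :: "complex \<Rightarrow> complex" and g :: "real \<Rightarrow> complex"
  assumes t: "t \<in> I"
    and [measurable]: "g \<in> borel_measurable borel" "h \<in> borel_measurable borel"
    and int: "integrable M (\<lambda>\<omega>. g (X t \<omega>))" "integrable M (\<lambda>\<omega>. h (linear_form c X (I - {t}) \<omega>))"
  shows "expectation (\<lambda>\<omega>. g (X t \<omega>) * h (linear_form c X (I - {t}) \<omega>)) =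
         expectation (\<lambda>\<omega>. g (X t \<omega>)) * expectation (\<lambda>\<omega>. h (linear_form c X (I - {t}) \<omega>))"
proof -
  have "indep_var (PiM {t} (\<lambda>_. borel)) (\<lambda>\<omega>. restrict (\<lambda>i. X i \<omega>) {t})
      (PiM (I - {t}) (\<lambda>_. borel)) (\<lambda>\<omega>. restrict (\<lambda>i. X i \<omega>) (I - {t}))"
    using t by (intro indep_var_restrict[OF indep]) auto
  then have "indep_var borel ((\<lambda>f. g (f t)) \<circ> (\<lambda>\<omega>. restrict (\<lambda>i. X i \<omega>) {t}))
      borel ((\<lambda>f. h (\<Sum>s\<in>I - {t}. c s * complex_of_real (f s))) \<circ> (\<lambda>\<omega>. restrict (\<lambda>i. X i \<omega>) (I - {t})))"
    by (rule indep_var_compose) measurable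
  moreover have "(\<lambda>f. g (f t)) \<circ> (\<lambda>\<omega>. restrict (\<lambda>i. X i \<omega>) {t}) = (\<lambda>\<omega>. g (X t \<omega>))"
    by auto
  moreover have "(\<lambda>f. h (\<Sum>s\<in>I - {t}. c s * complex_of_real (f s))) \<circ> (\<lambda>\<omega>. restrict (\<lambda>i. X i \<omega>) (I - {t}))
      = (\<lambda>\<omega>. h (linear_form c X (I - {t}) \<omega>))"
    by (auto simp: linear_form_def fun_eq_iff intro!: arg_cong[of _ _ h] sum.cong)
  ultimately show ?thesis
    using int by (intro indep_var_lebesgue_integral) auto
qed

text \<open>Since \<open>X\<^sub>t\<close> is independent of the form in the other variables, a function of the latter cannot
  distinguish \<open>X\<^sub>t\<close> from \<open>0\<close> or \<open>X\<^sub>t\<^sup>2\<close> from \<open>1\<close> in expectation.\<close>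
lemma expectation_X_mult_linear_form:
  assumes t: "t \<in> I"
  shows "expectation (\<lambda>\<omega>. X t \<omega> * mixed_power a b (linear_form c X (I - {t}) \<omega>)) = 0"
    "expectation (\<lambda>\<omega>. ((X t \<omega>)\<^sup>2 - 1) * mixed_power a b (linear_form c X (I - {t}) \<omega>)) = 0"
proof -
  interpret J: standardized_family M C "I - {t}" X by (rule subfamily) auto
  note int = moment_algebra_integrable
  note ma = mixed_power_moment_algebra[OF J.linear_form_moment_algebra]
  have X2: "(\<lambda>\<omega>. complex_of_real (X t \<omega>) ^ 2 + (- 1)) \<in> moment_algebra M"
    by (intro moment_algebra_intros X_moment_algebra t)
  have "expectation (\<lambda>\<omega>. complex_of_real (X t \<omega>) * mixed_power a b (linear_form c X (I - {t}) \<omega>)) =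
     expectation (\<lambda>\<omega>. complex_of_real (X t \<omega>)) * expectation (\<lambda>\<omega>. mixed_power a b (linear_form c X (I - {t}) \<omega>))"
    using int[OF X_moment_algebra[OF t]] int[OF ma]
    by (intro expectation_mult_linear_form t mixed_power_measurable) auto
  then show "expectation (\<lambda>\<omega>. X t \<omega> * mixed_power a b (linear_form c X (I - {t}) \<omega>)) = 0"
    using mean[OF t] by simp
  have i2: "integrable M (\<lambda>\<omega>. (X t \<omega>)\<^sup>2)"
    using abs_integrable[OF t, of 2] by simp
  have "expectation (\<lambda>\<omega>. complex_of_real ((X t \<omega>)\<^sup>2 - 1) * mixed_power a b (linear_form c X (I - {t}) \<omega>)) =
     expectation (\<lambda>\<omega>. complex_of_real ((X t \<omega>)\<^sup>2 - 1)) * expectation (\<lambda>\<omega>. mixed_power a b (linear_form c X (I - {t}) \<omega>))"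
    using int[OF X2] int[OF ma]
    by (intro expectation_mult_linear_form[where g = "\<lambda>x. complex_of_real (x\<^sup>2 - 1)"] t mixed_power_measurable) auto
  moreover have "expectation (\<lambda>\<omega>. complex_of_real ((X t \<omega>)\<^sup>2 - 1)) = 0"
    unfolding integral_complex_of_real using i2 second_moment[OF t] by (simp add: prob_space)
  ultimately show "expectation (\<lambda>\<omega>. ((X t \<omega>)\<^sup>2 - 1) * mixed_power a b (linear_form c X (I - {t}) \<omega>)) = 0"
    by simp
qed

end

text \<open>In the expansion of \<open>\<bar>u + c X\<^sub>t\<bar>\<^sup>2\<^sup>m\<close> around \<open>u\<close> the linear term has mean zero, and the quadratic
  remainder costs only a factor \<open>1 + O(\<bar>c\<bar>\<^sup>2)\<close>. The extra summand \<open>1\<close> makes the estimate multiplicative,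
  so that it can be iterated over the family.\<close>
lemma (in standardized_family) norm_moment_step:
  assumes t: "t \<in> I" and c: "norm (c t) \<le> 1"
  shows "1 + expectation (\<lambda>\<omega>. norm (linear_form c X I \<omega>) ^ (2 * m)) \<le>
    (1 + expectation (\<lambda>\<omega>. norm (linear_form c X (I - {t}) \<omega>) ^ (2 * m))) *
    (1 + (real (2 * m))\<^sup>2 * 3 ^ (2 * m) * (1 + C (2 * m + 2)) * (norm (c t))\<^sup>2)"
proof -
  interpret J: standardized_family M C "I - {t}" X by (rule subfamily) auto
  define u where "u = linear_form c X (I - {t})"
  define d where "d = (\<lambda>\<omega>. c t * complex_of_real (X t \<omega>))"
  define K where "K = (real (2 * m))\<^sup>2 * (norm (c t))\<^sup>2 * 3 ^ (2 * m)"
  have K: "0 \<le> K" by (simp add: K_def)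
  have S: "linear_form c X I \<omega> = u \<omega> + d \<omega>" for \<omega>
    using linear_form_split[OF t] by (simp add: u_def d_def)
  have u: "u \<in> moment_algebra M"
    unfolding u_def by (rule J.linear_form_moment_algebra)
  have d: "d \<in> moment_algebra M"
    unfolding d_def by (intro moment_algebra_intros X_moment_algebra t)
  note [measurable] = u[THEN moment_algebra_measurable] measurable_X[OF t]
  have X2: "integrable M (\<lambda>\<omega>. (X t \<omega>)\<^sup>2)"
    using abs_integrable[OF t, of 2] by simp
  have Xm: "integrable M (\<lambda>\<omega>. X t \<omega> ^ (2 * m + 2))"
    using abs_integrable[OF t, of "2 * m + 2"] by (subst (asm) power_even_abs) auto
  have meas: "(\<lambda>z. complex_of_real (norm z ^ (2 * m))) \<in> borel_measurable borel"
    by measurable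
  have iu: "integrable M (\<lambda>\<omega>. norm (u \<omega>) ^ (2 * m))"
    using u by (rule moment_algebra_integrable_power)
  have iXu: "integrable M (\<lambda>\<omega>. (X t \<omega>)\<^sup>2 * norm (u \<omega>) ^ (2 * m))"
    and EXu: "expectation (\<lambda>\<omega>. (X t \<omega>)\<^sup>2 * norm (u \<omega>) ^ (2 * m)) =
      expectation (\<lambda>\<omega>. norm (u \<omega>) ^ (2 * m))"
  proof -
    have "(\<lambda>\<omega>. complex_of_real (X t \<omega>) ^ 2 * mixed_power m m (u \<omega>)) \<in> moment_algebra M"
      by (intro moment_algebra_intros X_moment_algebra t mixed_power_moment_algebra u)
    from moment_algebra_integrable[OF this]
    have "integrable M (\<lambda>\<omega>. complex_of_real ((X t \<omega>)\<^sup>2 * norm (u \<omega>) ^ (2 * m)))"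
      by (simp add: mixed_power_diag)
    then show "integrable M (\<lambda>\<omega>. (X t \<omega>)\<^sup>2 * norm (u \<omega>) ^ (2 * m))"
      by (simp only: complex_of_real_integrable_eq)
    have "expectation (\<lambda>\<omega>. complex_of_real ((X t \<omega>)\<^sup>2) * complex_of_real (norm (u \<omega>) ^ (2 * m))) =
        expectation (\<lambda>\<omega>. complex_of_real ((X t \<omega>)\<^sup>2)) * expectation (\<lambda>\<omega>. complex_of_real (norm (u \<omega>) ^ (2 * m)))"
      unfolding u_def
      by (intro expectation_mult_linear_form[where g = "\<lambda>x. complex_of_real (x\<^sup>2)"] t meas)
         (use X2 iu in \<open>auto simp: u_def simp del: of_real_power\<close>)
    then have "complex_of_real (expectation (\<lambda>\<omega>. (X t \<omega>)\<^sup>2 * norm (u \<omega>) ^ (2 * m))) =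
        complex_of_real (expectation (\<lambda>\<omega>. norm (u \<omega>) ^ (2 * m)))"
      by (simp only: of_real_mult[symmetric] integral_complex_of_real second_moment[OF t] of_real_1 mult_1)
    then show "expectation (\<lambda>\<omega>. (X t \<omega>)\<^sup>2 * norm (u \<omega>) ^ (2 * m)) =
      expectation (\<lambda>\<omega>. norm (u \<omega>) ^ (2 * m))" by (simp only: of_real_eq_iff)
  qed
  have point: "norm (mixed_power m m (u \<omega> + d \<omega>) - mixed_power m m (u \<omega>) - mixed_power_deriv m m (d \<omega>) (u \<omega>))
      \<le> K * ((X t \<omega>)\<^sup>2 + (X t \<omega>)\<^sup>2 * norm (u \<omega>) ^ (2 * m) + X t \<omega> ^ (2 * m + 2))" for \<omega>
  proof -
    let ?D = "1 + norm (u \<omega>) + \<bar>X t \<omega>\<bar>"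
    have d_le: "norm (d \<omega>) \<le> \<bar>X t \<omega>\<bar>"
      using mult_right_mono[OF c, of "\<bar>X t \<omega>\<bar>"] by (simp add: d_def norm_mult)
    have "norm (mixed_power m m (u \<omega> + d \<omega>) - mixed_power m m (u \<omega>) - mixed_power_deriv m m (d \<omega>) (u \<omega>))
      \<le> real (m + m) ^ 2 * (norm (c t) * \<bar>X t \<omega>\<bar>)\<^sup>2 * ?D ^ (m + m)"
      using d_le norm_triangle_ineq[of "u \<omega>" "d \<omega>"]
      by (intro mixed_power_taylor2) (auto simp: d_def norm_mult)
    also have "\<dots> \<le> real (m + m) ^ 2 * (norm (c t) * \<bar>X t \<omega>\<bar>)\<^sup>2 *
        (3 ^ (m + m) * (1 + norm (u \<omega>) ^ (m + m) + \<bar>X t \<omega>\<bar> ^ (m + m)))"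
      by (intro mult_left_mono power_add3_le) auto
    also have "\<dots> = K * ((X t \<omega>)\<^sup>2 + (X t \<omega>)\<^sup>2 * norm (u \<omega>) ^ (2 * m) + X t \<omega> ^ (2 * m + 2))"
      by (simp add: K_def power_mult_distrib mult_2[symmetric] power_even_abs algebra_simps power2_eq_square)
    finally show ?thesis .
  qed
  note ma = moment_algebra_integrable
  have i1: "integrable M (\<lambda>\<omega>. mixed_power m m (u \<omega> + d \<omega>))"
    by (intro ma mixed_power_moment_algebra moment_algebra_intros u d)
  have i2: "integrable M (\<lambda>\<omega>. mixed_power m m (u \<omega>))"
    by (intro ma mixed_power_moment_algebra u)
  have i3: "integrable M (\<lambda>\<omega>. mixed_power_deriv m m (d \<omega>) (u \<omega>))"
    unfolding mixed_power_deriv_def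
    by (intro ma mixed_power_moment_algebra moment_algebra_intros u d)
  have E3: "expectation (\<lambda>\<omega>. mixed_power_deriv m m (d \<omega>) (u \<omega>)) = 0"
  proof -
    have iX: "integrable M (\<lambda>\<omega>. X t \<omega> * mixed_power a b (u \<omega>))" for a b
      by (intro ma moment_algebra_intros mixed_power_moment_algebra X_moment_algebra t u)
    have "mixed_power_deriv m m (d \<omega>) (u \<omega>) =
        of_nat m * c t * (X t \<omega> * mixed_power (m - 1) m (u \<omega>)) +
        of_nat m * cnj (c t) * (X t \<omega> * mixed_power m (m - 1) (u \<omega>))" for \<omega>
      by (simp add: mixed_power_deriv_def d_def)
    then show ?thesis
      using expectation_X_mult_linear_form(1)[OF t] iX by (simp add: u_def)
  qed
  have "expectation (\<lambda>\<omega>. norm (u \<omega> + d \<omega>) ^ (2 * m)) - expectation (\<lambda>\<omega>. norm (u \<omega>) ^ (2 * m)) =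
      Re (expectation (\<lambda>\<omega>. mixed_power m m (u \<omega> + d \<omega>)) - expectation (\<lambda>\<omega>. mixed_power m m (u \<omega>)))"
    unfolding mixed_power_diag integral_complex_of_real by simp
  also have "\<dots> = Re (expectation (\<lambda>\<omega>. mixed_power m m (u \<omega> + d \<omega>) - mixed_power m m (u \<omega>)
      - mixed_power_deriv m m (d \<omega>) (u \<omega>)))"
    using i1 i2 i3 E3 by simp
  also have "\<dots> \<le> norm (expectation (\<lambda>\<omega>. mixed_power m m (u \<omega> + d \<omega>) - mixed_power m m (u \<omega>)
      - mixed_power_deriv m m (d \<omega>) (u \<omega>)))"
    by (rule complex_Re_le_cmod)
  also have "\<dots> \<le> expectation (\<lambda>\<omega>. K * ((X t \<omega>)\<^sup>2 + (X t \<omega>)\<^sup>2 * norm (u \<omega>) ^ (2 * m) + X t \<omega> ^ (2 * m + 2)))"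
    using point i1 i2 i3 X2 iXu Xm by (intro norm_integral_le) auto
  also have "\<dots> = K * (1 + expectation (\<lambda>\<omega>. norm (u \<omega>) ^ (2 * m)) + expectation (\<lambda>\<omega>. X t \<omega> ^ (2 * m + 2)))"
    using X2 iXu Xm EXu second_moment[OF t] by simp
  also have "\<dots> \<le> K * (1 + expectation (\<lambda>\<omega>. norm (u \<omega>) ^ (2 * m)) + C (2 * m + 2))"
    using abs_moment[OF t, of "2 * m + 2"] K
    by (subst (asm) power_even_abs) (auto intro!: mult_left_mono)
  also have "\<dots> \<le> K * ((1 + C (2 * m + 2)) * (1 + expectation (\<lambda>\<omega>. norm (u \<omega>) ^ (2 * m))))"
  proof (rule mult_left_mono[OF _ K])
    have "0 \<le> C (2 * m + 2)" using t by (rule moment_bound_nonneg)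
    moreover have "0 \<le> expectation (\<lambda>\<omega>. norm (u \<omega>) ^ (2 * m))" by simp
    ultimately show "1 + expectation (\<lambda>\<omega>. norm (u \<omega>) ^ (2 * m)) + C (2 * m + 2) \<le>
      (1 + C (2 * m + 2)) * (1 + expectation (\<lambda>\<omega>. norm (u \<omega>) ^ (2 * m)))"
      by (simp add: algebra_simps)
  qed
  finally show ?thesis
    unfolding S by (simp add: u_def[symmetric] K_def algebra_simps)
qed

text \<open>The factors \<open>1 + K \<bar>c\<^sub>t\<bar>\<^sup>2\<close> collected from the single variables multiply to at most
  \<open>exp (K (\<Sum>t. \<bar>c\<^sub>t\<bar>\<^sup>2))\<close>, whatever the number of variables.\<close>
lemma (in standardized_family) norm_moment_bound:
  assumes "\<And>t. t \<in> I \<Longrightarrow> norm (c t) \<le> 1"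
  shows "1 + expectation (\<lambda>\<omega>. norm (linear_form c X I \<omega>) ^ (2 * m)) \<le>
    2 * exp ((real (2 * m))\<^sup>2 * 3 ^ (2 * m) * (1 + C (2 * m + 2)) * (\<Sum>t\<in>I. (norm (c t))\<^sup>2))"
  using finite_I assms standardized_family_axioms
proof (induction I rule: finite_induct)
  case empty
  have "0 ^ (2 * m) \<le> (1 :: real)" by (cases m) auto
  then show ?case by (simp add: linear_form_def prob_space)
next
  case (insert t J)
  interpret I: standardized_family M C "insert t J" X by (rule insert.prems)
  have J: "insert t J - {t} = J" using insert.hyps by auto
  let ?K = "(real (2 * m))\<^sup>2 * 3 ^ (2 * m) * (1 + C (2 * m + 2))"
  have "0 \<le> C (2 * m + 2)" by (rule I.moment_bound_nonneg[of t]) simp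
  then have K: "0 \<le> ?K" by simp
  have "1 + expectation (\<lambda>\<omega>. norm (linear_form c X (insert t J) \<omega>) ^ (2 * m)) \<le>
      (1 + expectation (\<lambda>\<omega>. norm (linear_form c X J \<omega>) ^ (2 * m))) * (1 + ?K * (norm (c t))\<^sup>2)"
    using I.norm_moment_step[of t c m] insert.prems(1) J by simp
  also have "\<dots> \<le> (2 * exp (?K * (\<Sum>t\<in>J. (norm (c t))\<^sup>2))) * exp (?K * (norm (c t))\<^sup>2)"
  proof (rule mult_mono)
    show "1 + expectation (\<lambda>\<omega>. norm (linear_form c X J \<omega>) ^ (2 * m)) \<le> 2 * exp (?K * (\<Sum>t\<in>J. (norm (c t))\<^sup>2))"
      using insert.prems(1) I.subfamily[of J] by (intro insert.IH) auto
    show "1 + ?K * (norm (c t))\<^sup>2 \<le> exp (?K * (norm (c t))\<^sup>2)"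
      by (rule exp_ge_add_one_self)
    show "0 \<le> 1 + ?K * (norm (c t))\<^sup>2" using K by (simp add: add_nonneg_nonneg)
  qed auto
  also have "\<dots> = 2 * exp (?K * (\<Sum>t\<in>insert t J. (norm (c t))\<^sup>2))"
    using insert.hyps by (simp add: exp_add[symmetric] algebra_simps)
  finally show ?case .
qed

text \<open>The moment of order \<open>k\<close> is at most one plus the moment of the even order \<open>2 k\<close>, hence the
  exponents. The
  absolute value keeps the bound nonnegative for an arbitrary function \<open>C\<close>.\<close>
definition form_moment_bound :: "(nat \<Rightarrow> real) \<Rightarrow> nat \<Rightarrow> real" where
  "form_moment_bound C k = 2 * exp ((real (2 * k))\<^sup>2 * 3 ^ (2 * k) * (1 + \<bar>C (2 * k + 2)\<bar>))"

lemma form_moment_bound_nonneg: "0 \<le> form_moment_bound C k"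
  by (simp add: form_moment_bound_def)

lemma (in standardized_family) linear_form_moment_le:
  assumes "(\<Sum>t\<in>I. (norm (c t))\<^sup>2) \<le> 1"
  shows "expectation (\<lambda>\<omega>. norm (linear_form c X I \<omega>) ^ k) \<le> form_moment_bound C k"
proof -
  let ?S = "linear_form c X I"
  have c: "norm (c t) \<le> 1" if "t \<in> I" for t
  proof -
    have "(norm (c t))\<^sup>2 \<le> (\<Sum>t\<in>I. (norm (c t))\<^sup>2)"
      using finite_I that by (intro member_le_sum) auto
    then have "(norm (c t))\<^sup>2 \<le> 1\<^sup>2" using assms by simp
    then show ?thesis by (rule power2_le_imp_le) simp
  qed
  have le: "x ^ k \<le> 1 + x ^ (2 * k)" if "0 \<le> x" for x :: real
    using sum_squares_bound[of "x ^ k" 1] that by (simp add: power_mult mult.commute[of 2])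
      (smt (verit) zero_le_power)
  have "expectation (\<lambda>\<omega>. norm (?S \<omega>) ^ k) \<le> expectation (\<lambda>\<omega>. 1 + norm (?S \<omega>) ^ (2 * k))"
    using moment_algebra_integrable_power[OF linear_form_moment_algebra] le
    by (intro integral_mono) auto
  also have "\<dots> = 1 + expectation (\<lambda>\<omega>. norm (?S \<omega>) ^ (2 * k))"
    using moment_algebra_integrable_power[OF linear_form_moment_algebra] by (simp add: prob_space)
  also have "\<dots> \<le> 2 * exp ((real (2 * k))\<^sup>2 * 3 ^ (2 * k) * (1 + C (2 * k + 2)) * (\<Sum>t\<in>I. (norm (c t))\<^sup>2))"
    by (rule norm_moment_bound) (rule c)
  also have "\<dots> \<le> form_moment_bound C k"
  proof -
    have "(1 + C (2 * k + 2)) * (\<Sum>t\<in>I. (norm (c t))\<^sup>2) \<le> (1 + \<bar>C (2 * k + 2)\<bar>) * 1"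
      using assms by (intro mult_mono) (auto intro: sum_nonneg)
    then have "(real (2 * k))\<^sup>2 * 3 ^ (2 * k) * ((1 + C (2 * k + 2)) * (\<Sum>t\<in>I. (norm (c t))\<^sup>2)) \<le>
       (real (2 * k))\<^sup>2 * 3 ^ (2 * k) * ((1 + \<bar>C (2 * k + 2)\<bar>) * 1)"
      by (rule mult_left_mono) simp
    then show ?thesis by (simp add: form_moment_bound_def mult.assoc)
  qed
  finally show ?thesis .
qed

text \<open>In \<open>stein_step\<close>, \<open>2 k\<^sup>2\<close> collects the coefficients of the second-order terms and the remaining factor is a
  bound for the moment of order \<open>k + 3\<close> of \<open>1 + \<bar>u\<bar> + \<bar>X\<^sub>t\<bar>\<close>.\<close>
definition stein_bound :: "(nat \<Rightarrow> real) \<Rightarrow> nat \<Rightarrow> real" where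
  "stein_bound C k = 2 * (real k)\<^sup>2 * 3 ^ (k + 3) * (1 + form_moment_bound C (k + 3) + \<bar>C (k + 3)\<bar>)"

lemma stein_bound_nonneg: "0 \<le> stein_bound C k"
  using form_moment_bound_nonneg[of C "k + 3"] by (simp add: stein_bound_def)

context standardized_family
begin

text \<open>Approximate integration by parts in one variable. Write the form as \<open>u + c X\<^sub>t\<close> with \<open>u\<close> independent
  of \<open>X\<^sub>t\<close>. Expanding \<open>X\<^sub>t f(u + c X\<^sub>t)\<close> to first order in \<open>c\<close> gives \<open>X\<^sub>t f(u) + X\<^sub>t\<^sup>2 f'(u)\<close>, whose
  expectation is that of \<open>f'(u)\<close>; replacing \<open>f'(u)\<close> by \<open>f'(u + c X\<^sub>t)\<close> costs one more factor \<open>c\<close>, and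
  \<open>f'\<close> carries a factor \<open>c\<close> already.\<close>
lemma stein_step:
  assumes t: "t \<in> I" and c: "(\<Sum>t\<in>I. (norm (c t))\<^sup>2) \<le> 1"
  shows "norm (expectation (\<lambda>\<omega>. X t \<omega> * mixed_power a b (linear_form c X I \<omega>))
      - expectation (\<lambda>\<omega>. mixed_power_deriv a b (c t) (linear_form c X I \<omega>)))
    \<le> stein_bound C (a + b) * (norm (c t))\<^sup>2"
proof -
  interpret J: standardized_family M C "I - {t}" X by (rule subfamily) auto
  define u where "u = linear_form c X (I - {t})"
  define d where "d = (\<lambda>\<omega>. c t * complex_of_real (X t \<omega>))"
  define D where "D = (\<lambda>\<omega>. 1 + norm (u \<omega>) + \<bar>X t \<omega>\<bar>)"
  define k where "k = a + b"
  have S: "linear_form c X I \<omega> = u \<omega> + d \<omega>" for \<omega>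
    using linear_form_split[OF t] by (simp add: u_def d_def)
  have u: "u \<in> moment_algebra M"
    unfolding u_def by (rule J.linear_form_moment_algebra)
  have d: "d \<in> moment_algebra M"
    unfolding d_def by (intro moment_algebra_intros X_moment_algebra t)
  have sum_J: "(norm (c t))\<^sup>2 + (\<Sum>t\<in>I - {t}. (norm (c t))\<^sup>2) \<le> 1"
    using c finite_I t by (simp add: sum.remove[of I t])
  have "0 \<le> (\<Sum>t\<in>I - {t}. (norm (c t))\<^sup>2)" by (intro sum_nonneg) auto
  then have "(norm (c t))\<^sup>2 \<le> 1\<^sup>2" using sum_J by simp
  then have c1: "norm (c t) \<le> 1" by (rule power2_le_imp_le) simp
  have cJ: "(\<Sum>t\<in>I - {t}. (norm (c t))\<^sup>2) \<le> 1"
    using sum_J by (smt (verit) zero_le_power2)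
  \<comment> \<open>The last two subtracted terms have mean zero, so the expectation of \<open>R\<close> is the quantity to
    be estimated.\<close>
  define R where "R = (\<lambda>\<omega>. X t \<omega> * mixed_power a b (u \<omega> + d \<omega>)
      - mixed_power_deriv a b (c t) (u \<omega> + d \<omega>) - X t \<omega> * mixed_power a b (u \<omega>)
      - ((X t \<omega>)\<^sup>2 - 1) * mixed_power_deriv a b (c t) (u \<omega>))"
  have D1: "1 \<le> D \<omega>" for \<omega> by (simp add: D_def)
  have XD: "\<bar>X t \<omega>\<bar> \<le> D \<omega>" for \<omega> by (simp add: D_def)
  have point: "norm (R \<omega>) \<le> 2 * (real k)\<^sup>2 * (norm (c t))\<^sup>2 * D \<omega> ^ (k + 3)" for \<omega>
  proof -
    have d_le: "norm (d \<omega>) \<le> \<bar>X t \<omega>\<bar>"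
      using mult_right_mono[OF c1, of "\<bar>X t \<omega>\<bar>"] by (simp add: d_def norm_mult)
    have prems: "norm (u \<omega>) \<le> D \<omega>" "norm (u \<omega> + d \<omega>) \<le> D \<omega>" "norm (d \<omega>) \<le> norm (c t) * \<bar>X t \<omega>\<bar>"
      using d_le norm_triangle_ineq[of "u \<omega>" "d \<omega>"] by (auto simp: D_def d_def norm_mult)
    define R1 where "R1 = mixed_power a b (u \<omega> + d \<omega>) - mixed_power a b (u \<omega>) - mixed_power_deriv a b (d \<omega>) (u \<omega>)"
    define R2 where "R2 = mixed_power (a - 1) b (u \<omega> + d \<omega>) - mixed_power (a - 1) b (u \<omega>)"
    define R3 where "R3 = mixed_power a (b - 1) (u \<omega> + d \<omega>) - mixed_power a (b - 1) (u \<omega>)"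
    have R: "R \<omega> = X t \<omega> * R1 - of_nat a * c t * R2 - of_nat b * cnj (c t) * R3"
      unfolding R_def R1_def R2_def R3_def mixed_power_deriv_def d_def
      by (simp add: algebra_simps power2_eq_square)
    have "norm R1 \<le> (real k)\<^sup>2 * (norm (c t) * \<bar>X t \<omega>\<bar>)\<^sup>2 * D \<omega> ^ k"
      unfolding R1_def k_def using prems D1 by (intro mixed_power_taylor2)
    also have "\<dots> = (real k)\<^sup>2 * (norm (c t))\<^sup>2 * (\<bar>X t \<omega>\<bar>\<^sup>2 * D \<omega> ^ k)"
      by (simp add: power_mult_distrib)
    also have "\<dots> \<le> (real k)\<^sup>2 * (norm (c t))\<^sup>2 * (D \<omega> ^ 2 * D \<omega> ^ k)"
      using XD[of \<omega>] D1[of \<omega>] by (intro mult_left_mono mult_right_mono power_mono) auto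
    finally have "norm (X t \<omega> * R1) \<le> D \<omega> * ((real k)\<^sup>2 * (norm (c t))\<^sup>2 * (D \<omega> ^ 2 * D \<omega> ^ k))"
      using XD[of \<omega>] D1[of \<omega>] unfolding norm_mult by (intro mult_mono) auto
    then have 1: "norm (X t \<omega> * R1) \<le> (real k)\<^sup>2 * (norm (c t))\<^sup>2 * D \<omega> ^ (k + 3)"
      by (simp add: power_add power2_eq_square power3_eq_cube algebra_simps)
    have le: "real j * norm (R') \<le> real j * (real k * norm (c t) * D \<omega> ^ (k + 3))"
      if "norm R' \<le> real i * (norm (c t) * \<bar>X t \<omega>\<bar>) * D \<omega> ^ i" "i < k" for R' :: complex and i j
    proof (rule mult_left_mono)
      have "norm R' \<le> real i * (norm (c t) * \<bar>X t \<omega>\<bar>) * D \<omega> ^ i" by (rule that)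
      also have "\<dots> \<le> real k * (norm (c t) * D \<omega>) * D \<omega> ^ (k + 2)"
        using that(2) XD[of \<omega>] D1[of \<omega>] by (intro mult_mono power_increasing) auto
      finally show "norm R' \<le> real k * norm (c t) * D \<omega> ^ (k + 3)"
        by (simp add: power_add power2_eq_square power3_eq_cube algebra_simps)
    qed simp
    have 2: "real a * norm R2 \<le> real a * (real k * norm (c t) * D \<omega> ^ (k + 3))"
    proof (cases "a = 0")
      case False
      show ?thesis
        unfolding R2_def using prems D1 False
        by (intro le[of _ "a - 1 + b"] mixed_power_taylor1) (auto simp: k_def)
    qed simp
    have 3: "real b * norm R3 \<le> real b * (real k * norm (c t) * D \<omega> ^ (k + 3))"
    proof (cases "b = 0")
      case False
      show ?thesis
        unfolding R3_def using prems D1 False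
        by (intro le[of _ "a + (b - 1)"] mixed_power_taylor1) (auto simp: k_def)
    qed simp
    have "norm (R \<omega>) \<le> norm (X t \<omega> * R1) + norm (of_nat a * c t * R2) + norm (of_nat b * cnj (c t) * R3)"
      unfolding R by (intro order_trans[OF norm_triangle_ineq4] add_mono order_refl norm_triangle_ineq4)
    also have "\<dots> = norm (X t \<omega> * R1) + norm (c t) * (real a * norm R2) + norm (c t) * (real b * norm R3)"
      by (simp add: norm_mult)
    also have "\<dots> \<le> (real k)\<^sup>2 * (norm (c t))\<^sup>2 * D \<omega> ^ (k + 3)
        + norm (c t) * (real a * (real k * norm (c t) * D \<omega> ^ (k + 3)))
        + norm (c t) * (real b * (real k * norm (c t) * D \<omega> ^ (k + 3)))"
      by (intro add_mono mult_left_mono[OF 2] mult_left_mono[OF 3] 1) auto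
    also have "\<dots> = 2 * (real k)\<^sup>2 * (norm (c t))\<^sup>2 * D \<omega> ^ (k + 3)"
      by (simp add: k_def power2_eq_square algebra_simps)
    finally show ?thesis .
  qed
  note ma = moment_algebra_integrable
  note intros = mixed_power_moment_algebra moment_algebra_intros X_moment_algebra t u d
  have deriv_ma: "(\<lambda>\<omega>. mixed_power_deriv a b (c t) (f \<omega>)) \<in> moment_algebra M"
    if "f \<in> moment_algebra M" for f
    unfolding mixed_power_deriv_def by (intro intros that)
  have i1: "integrable M (\<lambda>\<omega>. X t \<omega> * mixed_power a b (u \<omega> + d \<omega>))"
    by (intro ma intros)
  have i2: "integrable M (\<lambda>\<omega>. mixed_power_deriv a b (c t) (u \<omega> + d \<omega>))"
    by (intro ma deriv_ma intros)
  have i3: "integrable M (\<lambda>\<omega>. X t \<omega> * mixed_power a b (u \<omega>))"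
    by (intro ma intros)
  have "(\<lambda>\<omega>. (complex_of_real (X t \<omega>) ^ 2 + (- 1)) * mixed_power a' b' (u \<omega>)) \<in> moment_algebra M" for a' b'
    by (intro intros)
  from ma[OF this] have i4': "integrable M (\<lambda>\<omega>. ((X t \<omega>)\<^sup>2 - 1) * mixed_power a' b' (u \<omega>))" for a' b'
    by simp
  have deriv: "((X t \<omega>)\<^sup>2 - 1) * mixed_power_deriv a b (c t) (u \<omega>) =
      of_nat a * c t * (((X t \<omega>)\<^sup>2 - 1) * mixed_power (a - 1) b (u \<omega>)) +
      of_nat b * cnj (c t) * (((X t \<omega>)\<^sup>2 - 1) * mixed_power a (b - 1) (u \<omega>))" for \<omega>
    by (simp add: mixed_power_deriv_def algebra_simps)
  have i4: "integrable M (\<lambda>\<omega>. ((X t \<omega>)\<^sup>2 - 1) * mixed_power_deriv a b (c t) (u \<omega>))"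
    unfolding deriv using i4' by auto
  have E3: "expectation (\<lambda>\<omega>. X t \<omega> * mixed_power a b (u \<omega>)) = 0"
    unfolding u_def by (rule expectation_X_mult_linear_form(1)[OF t])
  have E4: "expectation (\<lambda>\<omega>. ((X t \<omega>)\<^sup>2 - 1) * mixed_power_deriv a b (c t) (u \<omega>)) = 0"
    unfolding deriv using i4' expectation_X_mult_linear_form(2)[OF t] by (simp add: u_def)
  have iD: "integrable M (\<lambda>\<omega>. 1 + norm (u \<omega>) ^ (k + 3) + \<bar>X t \<omega>\<bar> ^ (k + 3))"
    using moment_algebra_integrable_power[OF u] abs_integrable[OF t] by auto
  have "norm (expectation (\<lambda>\<omega>. X t \<omega> * mixed_power a b (u \<omega> + d \<omega>))
      - expectation (\<lambda>\<omega>. mixed_power_deriv a b (c t) (u \<omega> + d \<omega>))) = norm (expectation R)"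
    unfolding R_def using i1 i2 i3 i4 E3 E4 by simp
  also have "\<dots> \<le> expectation (\<lambda>\<omega>. 2 * (real k)\<^sup>2 * (norm (c t))\<^sup>2 *
      (3 ^ (k + 3) * (1 + norm (u \<omega>) ^ (k + 3) + \<bar>X t \<omega>\<bar> ^ (k + 3))))"
  proof (rule norm_integral_le)
    show "integrable M R" unfolding R_def using i1 i2 i3 i4 by auto
    show "integrable M (\<lambda>\<omega>. 2 * (real k)\<^sup>2 * (norm (c t))\<^sup>2 *
      (3 ^ (k + 3) * (1 + norm (u \<omega>) ^ (k + 3) + \<bar>X t \<omega>\<bar> ^ (k + 3))))"
      using iD by auto
    fix \<omega>
    show "norm (R \<omega>) \<le> 2 * (real k)\<^sup>2 * (norm (c t))\<^sup>2 *
      (3 ^ (k + 3) * (1 + norm (u \<omega>) ^ (k + 3) + \<bar>X t \<omega>\<bar> ^ (k + 3)))"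
      unfolding D_def
      by (rule order_trans[OF point], unfold D_def, intro mult_left_mono power_add3_le) auto
  qed
  also have "\<dots> = 2 * (real k)\<^sup>2 * (norm (c t))\<^sup>2 * (3 ^ (k + 3) *
      (1 + expectation (\<lambda>\<omega>. norm (u \<omega>) ^ (k + 3)) + expectation (\<lambda>\<omega>. \<bar>X t \<omega>\<bar> ^ (k + 3))))"
    using moment_algebra_integrable_power[OF u] abs_integrable[OF t] by (simp add: prob_space)
  also have "\<dots> \<le> 2 * (real k)\<^sup>2 * (norm (c t))\<^sup>2 * (3 ^ (k + 3) *
      (1 + form_moment_bound C (k + 3) + \<bar>C (k + 3)\<bar>))"
    using J.linear_form_moment_le[OF cJ, of "k + 3"] abs_moment[OF t, of "k + 3"]
    by (intro mult_left_mono add_mono) (auto simp: u_def)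
  also have "\<dots> = stein_bound C (a + b) * (norm (c t))\<^sup>2"
    by (simp add: stein_bound_def k_def)
  finally show ?thesis unfolding S .
qed

text \<open>Sum the approximate integration by parts over \<open>t\<close> with weights \<open>c\<^sub>t\<close>. The holomorphic part of the
  derivative acquires the factor \<open>(\<Sum>t. c\<^sub>t\<^sup>2) = 0\<close>, the antiholomorphic part the factor
  \<open>(\<Sum>t. \<bar>c\<^sub>t\<bar>\<^sup>2) = 1\<close>, and the errors add up to \<open>(\<Sum>t. \<bar>c\<^sub>t\<bar>\<^sup>3) \<le> \<epsilon>\<close>.\<close>
lemma mixed_moment_recursion:
  assumes c1: "(\<Sum>t\<in>I. (norm (c t))\<^sup>2) = 1" and c0: "(\<Sum>t\<in>I. (c t)\<^sup>2) = 0"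
    and \<epsilon>: "\<And>t. t \<in> I \<Longrightarrow> norm (c t) \<le> \<epsilon>"
  shows "norm (expectation (\<lambda>\<omega>. mixed_power (Suc a) b (linear_form c X I \<omega>))
      - of_nat b * expectation (\<lambda>\<omega>. mixed_power a (b - 1) (linear_form c X I \<omega>)))
    \<le> stein_bound C (a + b) * \<epsilon>"
proof -
  define S where "S = linear_form c X I"
  define E where "E = (\<lambda>a b. expectation (\<lambda>\<omega>. mixed_power a b (S \<omega>)))"
  note ma = moment_algebra_integrable
  have Sma: "S \<in> moment_algebra M"
    unfolding S_def by (rule linear_form_moment_algebra)
  have iX: "integrable M (\<lambda>\<omega>. X t \<omega> * mixed_power a b (S \<omega>))" if "t \<in> I" for t
    by (intro ma mixed_power_moment_algebra moment_algebra_intros X_moment_algebra Sma that)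
  have iS: "integrable M (\<lambda>\<omega>. mixed_power a b (S \<omega>))" for a b
    by (intro ma mixed_power_moment_algebra Sma)
  have deriv: "expectation (\<lambda>\<omega>. mixed_power_deriv a b (c t) (S \<omega>)) =
      of_nat a * c t * E (a - 1) b + of_nat b * cnj (c t) * E a (b - 1)" for t
    unfolding mixed_power_deriv_def E_def using iS by simp
  have lhs: "E (Suc a) b = (\<Sum>t\<in>I. c t * expectation (\<lambda>\<omega>. X t \<omega> * mixed_power a b (S \<omega>)))"
  proof -
    have "mixed_power (Suc a) b (S \<omega>) = (\<Sum>t\<in>I. c t * (X t \<omega> * mixed_power a b (S \<omega>)))" for \<omega>
    proof -
      have "mixed_power (Suc a) b (S \<omega>) = S \<omega> * mixed_power a b (S \<omega>)"
        by (simp add: mixed_power_def)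
      also have "\<dots> = (\<Sum>t\<in>I. c t * complex_of_real (X t \<omega>)) * mixed_power a b (S \<omega>)"
        by (subst (1) S_def) (simp add: linear_form_def)
      finally show ?thesis by (simp add: sum_distrib_right mult.assoc)
    qed
    then show ?thesis
      unfolding E_def using iX by (simp add: Bochner_Integration.integral_sum)
  qed
  have "(\<Sum>t\<in>I. c t * (of_nat a * c t * E (a - 1) b + of_nat b * cnj (c t) * E a (b - 1))) =
      of_nat a * E (a - 1) b * (\<Sum>t\<in>I. (c t)\<^sup>2) + of_nat b * E a (b - 1) * (\<Sum>t\<in>I. c t * cnj (c t))"
    by (simp add: sum.distrib sum_distrib_left algebra_simps power2_eq_square)
  also have "(\<Sum>t\<in>I. c t * cnj (c t)) = complex_of_real (\<Sum>t\<in>I. (norm (c t))\<^sup>2)"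
    by (simp add: complex_norm_square[symmetric])
  finally have rhs: "of_nat b * E a (b - 1) =
      (\<Sum>t\<in>I. c t * (of_nat a * c t * E (a - 1) b + of_nat b * cnj (c t) * E a (b - 1)))"
    using c0 c1 by simp
  have "norm (E (Suc a) b - of_nat b * E a (b - 1)) =
      norm (\<Sum>t\<in>I. c t * (expectation (\<lambda>\<omega>. X t \<omega> * mixed_power a b (S \<omega>))
         - expectation (\<lambda>\<omega>. mixed_power_deriv a b (c t) (S \<omega>))))"
    unfolding lhs rhs deriv by (simp add: sum_subtractf right_diff_distrib)
  also have "\<dots> \<le> (\<Sum>t\<in>I. \<epsilon> * (stein_bound C (a + b) * (norm (c t))\<^sup>2))"
    using stein_step[of _ c a b] c1 \<epsilon>
    by (intro sum_norm_le; unfold norm_mult; intro mult_mono)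
       (auto simp: S_def intro: order_trans[OF norm_ge_zero])
  also have "\<dots> = stein_bound C (a + b) * \<epsilon> * (\<Sum>t\<in>I. (norm (c t))\<^sup>2)"
    by (simp add: sum_distrib_left algebra_simps)
  finally show ?thesis using c1 by (simp add: E_def S_def)
qed

end

text \<open>The central limit theorem for the mixed moments of a linear form, with a rate.\<close>
lemma (in standardized_family) mixed_moment_approx:
  assumes c: "(\<Sum>t\<in>I. (norm (c t))\<^sup>2) = 1" "(\<Sum>t\<in>I. (c t)\<^sup>2) = 0"
    and \<epsilon>: "\<And>t. t \<in> I \<Longrightarrow> norm (c t) \<le> \<epsilon>"
  shows "norm (expectation (\<lambda>\<omega>. mixed_power a b (linear_form c X I \<omega>)) - complex_of_real (gaussian_moment a b))
    \<le> moment_error (stein_bound C) a b * \<epsilon>"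
proof (rule moment_recursion_error)
  show "expectation (\<lambda>\<omega>. mixed_power 0 0 (linear_form c X I \<omega>)) = 1"
    by (simp add: mixed_power_def prob_space)
  show "expectation (\<lambda>\<omega>. mixed_power a b (linear_form c X I \<omega>)) =
      cnj (expectation (\<lambda>\<omega>. mixed_power b a (linear_form c X I \<omega>)))" for a b
    by (simp add: cnj_mixed_power flip: Bochner_Integration.integral_cnj)
qed (rule mixed_moment_recursion[OF c \<epsilon>])

lemma (in standardized_family) mixed_moment_bound:
  assumes c: "(\<Sum>t\<in>I. (norm (c t))\<^sup>2) \<le> 1"
  shows "norm (expectation (\<lambda>\<omega>. mixed_power a b (linear_form c X I \<omega>))) \<le> form_moment_bound C (a + b)"
proof -
  have "norm (expectation (\<lambda>\<omega>. mixed_power a b (linear_form c X I \<omega>))) \<le>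
      expectation (\<lambda>\<omega>. norm (linear_form c X I \<omega>) ^ (a + b))"
    by (intro norm_integral_le moment_algebra_integrable mixed_power_moment_algebra
        linear_form_moment_algebra moment_algebra_integrable_power) (simp add: norm_mixed_power)
  also have "\<dots> \<le> form_moment_bound C (a + b)"
    by (rule linear_form_moment_le[OF c])
  finally show ?thesis .
qed

section \<open>Alternating products\<close>

text \<open>The product \<open>z\<^sub>1 cnj z\<^sub>2 z\<^sub>3 cnj z\<^sub>4 \<dots>\<close> along a word. The recursion conjugates the whole tail
  because removing the first letter exchanges odd and even positions.\<close>
primrec altprod :: "('i \<Rightarrow> complex) \<Rightarrow> 'i list \<Rightarrow> complex" where
  "altprod z [] = 1"
| "altprod z (i # w) = z i * cnj (altprod z w)"

definition odd_count :: "'i list \<Rightarrow> 'i \<Rightarrow> nat" where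
  "odd_count w i = card {m \<in> {1..length w}. odd m \<and> w ! (m - 1) = i}"

definition even_count :: "'i list \<Rightarrow> 'i \<Rightarrow> nat" where
  "even_count w i = card {m \<in> {1..length w}. even m \<and> w ! (m - 1) = i}"

lemma count_Nil [simp]: "odd_count [] i = 0" "even_count [] i = 0"
  by (simp_all add: odd_count_def even_count_def)

lemma Collect_positions_Cons:
  "{m \<in> {1..length (j # w)}. P m \<and> (j # w) ! (m - 1) = i} =
     (if P 1 \<and> j = i then {1} else {}) \<union> Suc ` {m \<in> {1..length w}. P (Suc m) \<and> w ! (m - 1) = i}"
proof -
  have "m \<in> Suc ` {m \<in> {1..length w}. P (Suc m) \<and> w ! (m - 1) = i}"
    if "m \<in> {1..length (j # w)}" "P m" "(j # w) ! (m - 1) = i" "m \<noteq> 1" for m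
    using that by (intro image_eqI[of _ _ "m - 1"]) (auto simp: nth_Cons')
  then show ?thesis
    by (auto simp: nth_Cons' split: if_splits)
qed

lemma odd_count_Cons: "odd_count (j # w) i = (if j = i then 1 else 0) + even_count w i"
  unfolding odd_count_def even_count_def Collect_positions_Cons
  by (subst card_Un_disjoint) (auto simp: card_image)

lemma even_count_Cons: "even_count (j # w) i = odd_count w i"
  unfolding odd_count_def even_count_def Collect_positions_Cons
  by (subst card_Un_disjoint) (auto simp: card_image)

lemma symmetric_word_iff: "symmetric_word J w \<longleftrightarrow> (\<forall>i\<in>J. even_count w i = odd_count w i)"
  by (simp add: symmetric_word_def odd_count_def even_count_def)

lemma sum_counts:
  assumes "finite J" "w \<in> lists J"
  shows "(\<Sum>i\<in>J. odd_count w i) = (length w + 1) div 2 \<and> (\<Sum>i\<in>J. even_count w i) = length w div 2"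
  using assms(2)
proof (induction w)
  case (Cons j w)
  then show ?case
    using assms(1) by (simp add: odd_count_Cons even_count_Cons sum.distrib)
qed auto

lemma symmetric_word_even:
  assumes "finite J" "w \<in> lists J" "symmetric_word J w"
  shows "even (length w)"
proof -
  have "(length w + 1) div 2 = length w div 2"
    using sum_counts[OF assms(1,2)] assms(3) by (simp add: symmetric_word_iff)
  then show ?thesis by presburger
qed

lemma altprod_eq_prod:
  assumes "finite J" "w \<in> lists J"
  shows "altprod z w = (\<Prod>i\<in>J. mixed_power (odd_count w i) (even_count w i) (z i))"
  using assms(2)
proof (induction w)
  case Nil
  then show ?case by (simp add: mixed_power_def)
next
  case (Cons j w)
  have "altprod z (j # w) = z j * (\<Prod>i\<in>J. mixed_power (even_count w i) (odd_count w i) (z i))"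
    using Cons by (simp add: cnj_mixed_power)
  also have "z j = (\<Prod>i\<in>J. if j = i then z i else 1)"
    using Cons.hyps assms(1) by simp
  also have "\<dots> * (\<Prod>i\<in>J. mixed_power (even_count w i) (odd_count w i) (z i)) =
      (\<Prod>i\<in>J. mixed_power (odd_count (j # w) i) (even_count (j # w) i) (z i))"
    unfolding prod.distrib[symmetric]
    by (intro prod.cong) (auto simp: odd_count_Cons even_count_Cons mixed_power_def)
  finally show ?case .
qed

context prob_space
begin

lemma altprod_in_moment_algebra:
  "(\<And>i. i \<in> set w \<Longrightarrow> Z i \<in> moment_algebra M) \<Longrightarrow> (\<lambda>\<omega>. altprod (\<lambda>i. Z i \<omega>) w) \<in> moment_algebra M"
  by (induction w) (auto intro!: moment_algebra_intros)

lemma expectation_altprod: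
  assumes "finite J" "w \<in> lists J" and indep: "indep_vars (\<lambda>_. borel) Z J"
    and ma: "\<And>i. i \<in> J \<Longrightarrow> Z i \<in> moment_algebra M"
  shows "expectation (\<lambda>\<omega>. altprod (\<lambda>i. Z i \<omega>) w) =
    (\<Prod>i\<in>J. expectation (\<lambda>\<omega>. mixed_power (odd_count w i) (even_count w i) (Z i \<omega>)))"
  unfolding altprod_eq_prod[OF assms(1,2)]
proof (rule indep_vars_lebesgue_integral)
  show "indep_vars (\<lambda>_. borel) (\<lambda>i \<omega>. mixed_power (odd_count w i) (even_count w i) (Z i \<omega>)) J"
    using indep by (rule indep_vars_compose2) (rule mixed_power_measurable)
  show "integrable M (\<lambda>\<omega>. mixed_power (odd_count w i) (even_count w i) (Z i \<omega>))" if "i \<in> J" for i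
    using ma[OF that] by (intro moment_algebra_integrable mixed_power_moment_algebra)
qed fact

end

text \<open>The common value of the limiting moment of a word and of its moment in the \<open>a\<^sub>i\<close>.\<close>
definition word_limit :: "'i set \<Rightarrow> 'i list \<Rightarrow> real" where
  "word_limit J w = (\<Prod>i\<in>J. gaussian_moment (odd_count w i) (even_count w i))"

lemma word_limit_nonsymmetric:
  "finite J \<Longrightarrow> \<not> symmetric_word J w \<Longrightarrow> word_limit J w = 0"
proof -
  assume "finite J" "\<not> symmetric_word J w"
  then obtain i where "i \<in> J" "odd_count w i \<noteq> even_count w i"
    by (force simp: symmetric_word_iff)
  with \<open>finite J\<close> show ?thesis
    by (auto simp: word_limit_def gaussian_moment_def intro!: bexI[of _ i])
qed

lemma word_limit_odd:
  "finite J \<Longrightarrow> w \<in> lists J \<Longrightarrow> odd (length w) \<Longrightarrow> word_limit J w = 0"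
  using symmetric_word_even word_limit_nonsymmetric by blast

section \<open>Reverse circulant matrices in the Fourier basis\<close>

definition unity_root :: "nat \<Rightarrow> nat \<Rightarrow> nat \<Rightarrow> complex" where
  "unity_root n s t = cis (2 * pi * real s * real t / real n)"

lemma unity_root_commute: "unity_root n s t = unity_root n t s"
  by (simp add: unity_root_def mult.commute mult.left_commute)

lemma unity_root_add: "unity_root n s (t + t') = unity_root n s t * unity_root n s t'"
  by (simp add: unity_root_def cis_mult distrib_left add_divide_distrib)

lemma unity_root_power: "unity_root n s t = unity_root n s 1 ^ t"
proof -
  have "real t * (2 * pi * real s * real 1 / real n) = 2 * pi * real s * real t / real n"
    by simp
  then show ?thesis
    by (simp only: unity_root_def Complex.DeMoivre)
qed

lemma norm_unity_root [simp]: "norm (unity_root n s t) = 1"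
  by (simp add: unity_root_def)

lemma unity_root_cnj: "unity_root n s t * cnj (unity_root n s t) = 1"
  by (simp add: complex_norm_square[symmetric])

lemma unity_root_1_eq_1_iff: "n > 0 \<Longrightarrow> unity_root n s 1 = 1 \<longleftrightarrow> n dvd s"
  using complex_root_unity_eq_1[of n s] by (simp add: unity_root_def cis_conv_exp mult_ac)

lemma unity_root_dvd: "n > 0 \<Longrightarrow> n dvd t \<Longrightarrow> unity_root n s t = 1"
  by (metis unity_root_1_eq_1_iff unity_root_commute unity_root_power power_one)

lemma unity_root_mod: "n > 0 \<Longrightarrow> unity_root n s (t mod n) = unity_root n s t"
  using unity_root_add[of n s "n * (t div n)" "t mod n"] unity_root_dvd[of n "n * (t div n)" s]
  by simp

lemma sum_unity_root:
  assumes n: "n > 0"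
  shows "(\<Sum>t<n. unity_root n s t) = (if n dvd s then of_nat n else 0)"
proof (cases "n dvd s")
  case True
  then show ?thesis using n by (simp add: unity_root_commute[of n s] unity_root_dvd)
next
  case False
  then have ne: "unity_root n s 1 \<noteq> 1" using unity_root_1_eq_1_iff[OF n] by blast
  have "(\<Sum>t<n. unity_root n s t) = (\<Sum>t<n. unity_root n s 1 ^ t)"
    by (intro sum.cong refl unity_root_power)
  also have "\<dots> = (unity_root n s 1 ^ n - 1) / (unity_root n s 1 - 1)"
    using ne by (rule geometric_sum)
  also have "unity_root n s 1 ^ n = 1"
    using unity_root_power[of n s n] unity_root_dvd[OF n dvd_refl] by simp
  finally show ?thesis using False by simp
qed

lemma unity_root_orthogonal:
  assumes j: "j < n" and k: "k < n"
  shows "(\<Sum>s<n. cnj (unity_root n s (j + 1)) * unity_root n s (k + 1)) = (if j = k then of_nat n else 0)"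
proof -
  have *: "(\<Sum>s<n. cnj (unity_root n s (j + 1)) * unity_root n s (k + 1)) = (if j = k then of_nat n else 0)"
    if "j \<le> k" "k < n" for j k
  proof -
    have "cnj (unity_root n s (j + 1)) * unity_root n s (k + 1) = unity_root n (k - j) s" for s
    proof -
      have "unity_root n s (k + 1) = unity_root n s (j + 1) * unity_root n s (k - j)"
        using that by (simp add: unity_root_add[symmetric])
      then show ?thesis
        using unity_root_cnj[of n s "j + 1"] by (simp add: unity_root_commute[of n "k - j"] mult_ac)
    qed
    moreover have "n dvd k - j \<longleftrightarrow> j = k"
      using that by (auto dest: dvd_imp_le)
    ultimately show ?thesis
      using that by (simp add: sum_unity_root)
  qed
  show ?thesis
  proof (cases "j \<le> k")
    case False
    have 1: "(\<Sum>s<n. cnj (unity_root n s (j + 1)) * unity_root n s (k + 1)) =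
      cnj (\<Sum>s<n. cnj (unity_root n s (k + 1)) * unity_root n s (j + 1))"
      by (simp add: mult.commute)
    have 2: "(\<Sum>s<n. cnj (unity_root n s (k + 1)) * unity_root n s (j + 1)) = 0"
      using *[of k j] False j by simp
    show ?thesis unfolding 1 2 using False by simp
  qed (use *[of j k] k in auto)
qed

lemma bij_betw_rc_link:
  assumes "n > 0"
  shows "bij_betw (\<lambda>k. rc_link n j (k + 1)) {..<n} {..<n}"
proof -
  have inj: "inj_on (\<lambda>k. rc_link n j (k + 1)) {..<n}"
  proof (rule inj_onI)
    fix k l assume "k \<in> {..<n}" "l \<in> {..<n}" "rc_link n j (k + 1) = rc_link n j (l + 1)"
    then have "[(j + 1) + k = (j + 1) + l] (mod n)" "k < n" "l < n"
      by (auto simp: rc_link_def cong_def)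
    then show "k = l"
      by (metis cong_add_lcancel_nat cong_less_modulus_unique_nat)
  qed
  moreover have "(\<lambda>k. rc_link n j (k + 1)) ` {..<n} = {..<n}"
  proof (rule card_subset_eq)
    show "(\<lambda>k. rc_link n j (k + 1)) ` {..<n} \<subseteq> {..<n}"
      using assms by (auto simp: rc_link_def)
    show "card ((\<lambda>k. rc_link n j (k + 1)) ` {..<n}) = card {..<n}"
      by (rule card_image[OF inj])
  qed simp
  ultimately show ?thesis by (simp add: bij_betw_def)
qed

text \<open>Up to the phase of row \<open>j\<close>, the \<open>j\<close>-th entry of the image of a wave is the sum of
  \<open>x(l) exp (2 \<pi> \<i> s l / n)\<close> over the values \<open>l\<close> of the link function in that row, and these
  run once through \<open>{0, \<dots>, n - 1}\<close>.\<close>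
lemma rc_link_fourier:
  fixes x :: "nat \<Rightarrow> complex"
  assumes n: "n > 0"
  shows "(\<Sum>k<n. x (rc_link n (j + 1) (k + 1)) * unity_root n s (k + 1)) =
    (\<Sum>t<n. unity_root n s t * x t) * cnj (unity_root n s (j + 1))"
proof -
  let ?l = "\<lambda>k. rc_link n (j + 1) (k + 1)"
  have root: "unity_root n s (k + 1) = cnj (unity_root n s (j + 1)) * unity_root n s (?l k)" for k
  proof -
    have "unity_root n s (?l k) = unity_root n s (j + 1) * unity_root n s (k + 1)"
      by (simp only: rc_link_def unity_root_mod[OF n] unity_root_add)
    then show ?thesis using unity_root_cnj[of n s "j + 1"] by (simp add: mult_ac)
  qed
  have root: "x (?l k) * unity_root n s (k + 1) =
      unity_root n s (?l k) * x (?l k) * cnj (unity_root n s (j + 1))" for k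
    by (subst root[of k]) (simp add: mult_ac)
  have "(\<Sum>k<n. x (?l k) * unity_root n s (k + 1)) =
      (\<Sum>k<n. unity_root n s (?l k) * x (?l k)) * cnj (unity_root n s (j + 1))"
    unfolding sum_distrib_right by (intro sum.cong refl) (rule root)
  also have "(\<Sum>k<n. unity_root n s (?l k) * x (?l k)) = (\<Sum>t<n. unity_root n s t * x t)"
    by (rule sum.reindex_bij_betw[OF bij_betw_rc_link[OF n]])
  finally show ?thesis .
qed

definition fourier_coeffs :: "nat \<Rightarrow> nat \<Rightarrow> nat \<Rightarrow> complex" where
  "fourier_coeffs n s t = unity_root n s t / complex_of_real (sqrt (real n))"

definition scaled_rc :: "'w measure \<Rightarrow> nat \<Rightarrow> (nat \<Rightarrow> 'w \<Rightarrow> real) \<Rightarrow> ('w \<Rightarrow> complex) mat" where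
  "scaled_rc M n x =
     complex_of_real (1 / sqrt (real n)) \<odot>\<^bsub>random_matrix_algebra M n\<^esub> reverse_circulant n x"

lemma scaled_rc_carrier_mat: "scaled_rc M n x \<in> carrier_mat n n"
  by (simp add: scaled_rc_def random_matrix_algebra_simps reverse_circulant_def)

lemma scaled_rc_entry:
  "j < n \<Longrightarrow> k < n \<Longrightarrow> (scaled_rc M n x $$ (j, k)) \<omega> =
     complex_of_real (x (rc_link n (j + 1) (k + 1)) \<omega>) / complex_of_real (sqrt (real n))"
  by (simp add: scaled_rc_def random_matrix_algebra_simps reverse_circulant_def)

lemma scaled_rc_fourier:
  assumes n: "n > 0" and j: "j < n"
  shows "(\<Sum>k<n. (scaled_rc M n x $$ (j, k)) \<omega> * unity_root n s (k + 1)) =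
      linear_form (fourier_coeffs n s) x {..<n} \<omega> * cnj (unity_root n s (j + 1))"
    and "(\<Sum>k<n. (scaled_rc M n x $$ (j, k)) \<omega> * cnj (unity_root n s (k + 1))) =
      cnj (linear_form (fourier_coeffs n s) x {..<n} \<omega>) * unity_root n s (j + 1)"
proof -
  show 1: "(\<Sum>k<n. (scaled_rc M n x $$ (j, k)) \<omega> * unity_root n s (k + 1)) =
      linear_form (fourier_coeffs n s) x {..<n} \<omega> * cnj (unity_root n s (j + 1))"
    using rc_link_fourier[OF n, of "\<lambda>t. complex_of_real (x t \<omega>) / complex_of_real (sqrt (real n))" j s] j
    by (simp add: scaled_rc_entry linear_form_def fourier_coeffs_def del: One_nat_def)
  have "(\<Sum>k<n. (scaled_rc M n x $$ (j, k)) \<omega> * cnj (unity_root n s (k + 1))) =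
     cnj (\<Sum>k<n. (scaled_rc M n x $$ (j, k)) \<omega> * unity_root n s (k + 1))"
    using j by (simp add: scaled_rc_entry)
  then show "(\<Sum>k<n. (scaled_rc M n x $$ (j, k)) \<omega> * cnj (unity_root n s (k + 1))) =
      cnj (linear_form (fourier_coeffs n s) x {..<n} \<omega>) * unity_root n s (j + 1)"
    unfolding 1 by simp
qed

lemma monomial_Nil: "monomial A a [] = \<one>\<^bsub>A\<^esub>"
  and monomial_Cons: "monomial A a (i # w) = a i \<otimes>\<^bsub>A\<^esub> monomial A a w"
  by (simp_all add: monomial_def prod_word_def)

lemma monomial_carrier_mat:
  "(\<And>i. i \<in> set w \<Longrightarrow> a i \<in> carrier_mat n n) \<Longrightarrow>
     monomial (random_matrix_algebra M n) a w \<in> carrier_mat n n"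
  by (induction w)
     (auto simp: monomial_Nil monomial_Cons random_matrix_algebra_simps intro!: mult_carrier_mat[of _ n n])

text \<open>The wave on which a word is evaluated. It is conjugated according to the parity of the length so
  that the image is always a multiple of \<open>cnj f\<^sub>s\<close>, and the multiple is the alternating product
  starting with an unconjugated factor.\<close>
definition wave :: "nat \<Rightarrow> 'i list \<Rightarrow> nat \<Rightarrow> nat \<Rightarrow> complex" where
  "wave n w s k = (if even (length w) then cnj (unity_root n s (k + 1)) else unity_root n s (k + 1))"

lemma wave_Cons: "wave n (i # w) s k = cnj (wave n w s k)"
  by (simp add: wave_def)

lemma sum_mult_mat_entry:
  fixes A B :: "('w \<Rightarrow> complex) mat"
  assumes "A \<in> carrier_mat n n" "B \<in> carrier_mat n n" "j < n"
  shows "(\<Sum>k<n. ((A * B) $$ (j, k)) \<omega> * g k) = (\<Sum>l<n. (A $$ (j, l)) \<omega> * (\<Sum>k<n. (B $$ (l, k)) \<omega> * g k))"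
proof -
  have "(\<Sum>k<n. ((A * B) $$ (j, k)) \<omega> * g k) =
      (\<Sum>k<n. \<Sum>l<n. (A $$ (j, l)) \<omega> * ((B $$ (l, k)) \<omega> * g k))"
    using assms by (simp add: mult_mat_entry[of _ n] sum_distrib_right mult.assoc del: index_mult_mat)
  also have "\<dots> = (\<Sum>l<n. \<Sum>k<n. (A $$ (j, l)) \<omega> * ((B $$ (l, k)) \<omega> * g k))"
    by (rule sum.swap)
  finally show ?thesis by (simp add: sum_distrib_left)
qed

text \<open>Each matrix exchanges \<open>f\<^sub>s\<close> and \<open>cnj f\<^sub>s\<close>, so the claim about a word needs, in the induction, the
  conjugate claim about its tail.\<close>
lemma monomial_scaled_rc_fourier:
  fixes M :: "'w measure" and X :: "'i \<Rightarrow> nat \<Rightarrow> 'w \<Rightarrow> real"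
  assumes n: "n > 0" and "j < n"
  defines "W \<equiv> \<lambda>w. monomial (random_matrix_algebra M n) (\<lambda>i. scaled_rc M n (X i)) w"
    and "eig \<equiv> \<lambda>s \<omega> i. linear_form (fourier_coeffs n s) (X i) {..<n} \<omega>"
  shows "(\<Sum>k<n. (W w $$ (j, k)) \<omega> * wave n w s k) = altprod (eig s \<omega>) w * cnj (unity_root n s (j + 1)) \<and>
    (\<Sum>k<n. (W w $$ (j, k)) \<omega> * cnj (wave n w s k)) = cnj (altprod (eig s \<omega>) w) * unity_root n s (j + 1)"
  using \<open>j < n\<close>
proof (induction w arbitrary: j)
  case Nil
  have "(\<Sum>k<n. ((1\<^sub>m n :: ('w \<Rightarrow> complex) mat) $$ (j, k)) \<omega> * g k) = g j" for g
  proof -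
    have "(\<Sum>k<n. ((1\<^sub>m n :: ('w \<Rightarrow> complex) mat) $$ (j, k)) \<omega> * g k) = (\<Sum>k<n. if j = k then g k else 0)"
      using Nil by (intro sum.cong) auto
    then show ?thesis using Nil by simp
  qed
  then show ?case
    by (simp add: W_def monomial_Nil random_matrix_algebra_simps wave_def)
next
  case (Cons i w)
  have W_Cons: "W (i # w) = scaled_rc M n (X i) * W w"
    unfolding W_def monomial_Cons random_matrix_algebra_simps(2) ..
  have carr: "W w \<in> carrier_mat n n"
    unfolding W_def by (rule monomial_carrier_mat) (rule scaled_rc_carrier_mat)
  have A: "(\<Sum>k<n. (W w $$ (l, k)) \<omega> * wave n w s k) = altprod (eig s \<omega>) w * cnj (unity_root n s (l + 1))"
    and B: "(\<Sum>k<n. (W w $$ (l, k)) \<omega> * cnj (wave n w s k)) = cnj (altprod (eig s \<omega>) w) * unity_root n s (l + 1)"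
    if "l < n" for l
    using Cons.IH[OF that] by auto
  have "(\<Sum>k<n. (W (i # w) $$ (j, k)) \<omega> * wave n (i # w) s k) =
      (\<Sum>l<n. (scaled_rc M n (X i) $$ (j, l)) \<omega> * (cnj (altprod (eig s \<omega>) w) * unity_root n s (l + 1)))"
    unfolding W_Cons sum_mult_mat_entry[OF scaled_rc_carrier_mat carr Cons.prems] wave_Cons
    by (intro sum.cong arg_cong2[of _ _ _ _ "(*)"] B) auto
  also have "\<dots> = (\<Sum>l<n. (scaled_rc M n (X i) $$ (j, l)) \<omega> * unity_root n s (l + 1)) * cnj (altprod (eig s \<omega>) w)"
    unfolding sum_distrib_right by (intro sum.cong) (simp_all only: mult_ac)
  also have "\<dots> = altprod (eig s \<omega>) (i # w) * cnj (unity_root n s (j + 1))"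
    unfolding scaled_rc_fourier(1)[OF n Cons.prems] by (simp add: eig_def mult_ac)
  finally have 1: "(\<Sum>k<n. (W (i # w) $$ (j, k)) \<omega> * wave n (i # w) s k) =
      altprod (eig s \<omega>) (i # w) * cnj (unity_root n s (j + 1))" .
  have "(\<Sum>k<n. (W (i # w) $$ (j, k)) \<omega> * cnj (wave n (i # w) s k)) =
      (\<Sum>l<n. (scaled_rc M n (X i) $$ (j, l)) \<omega> * (altprod (eig s \<omega>) w * cnj (unity_root n s (l + 1))))"
    unfolding W_Cons sum_mult_mat_entry[OF scaled_rc_carrier_mat carr Cons.prems] wave_Cons complex_cnj_cnj
    by (intro sum.cong arg_cong2[of _ _ _ _ "(*)"] A) auto
  also have "\<dots> = (\<Sum>l<n. (scaled_rc M n (X i) $$ (j, l)) \<omega> * cnj (unity_root n s (l + 1))) * altprod (eig s \<omega>) w"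
    unfolding sum_distrib_right by (intro sum.cong) (simp_all only: mult_ac)
  also have "\<dots> = cnj (altprod (eig s \<omega>) (i # w)) * unity_root n s (j + 1)"
    unfolding scaled_rc_fourier(2)[OF n Cons.prems] by (simp add: eig_def mult_ac)
  finally show ?case using 1 by simp
qed

text \<open>The inner product of a wave with \<open>cnj f\<^sub>s\<close>. It equals \<open>n\<close> for words of even length, where the two
  agree. For odd length it is mostly zero, but the bound by \<open>n\<close> suffices, because the corresponding
  limiting moments vanish.\<close>
definition wave_trace :: "nat \<Rightarrow> 'i list \<Rightarrow> nat \<Rightarrow> complex" where
  "wave_trace n w s = (\<Sum>j<n. cnj (wave n w s j) * cnj (unity_root n s (j + 1)))"

lemma wave_trace_even: "even (length w) \<Longrightarrow> wave_trace n w s = of_nat n"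
  by (simp add: wave_trace_def wave_def unity_root_cnj)

lemma norm_wave_trace_le: "norm (wave_trace n w s) \<le> real n"
proof -
  have "norm (wave_trace n w s) \<le> (\<Sum>j<n. norm (cnj (wave n w s j) * cnj (unity_root n s (j + 1))))"
    unfolding wave_trace_def by (rule norm_sum)
  also have "\<dots> = real n"
    by (cases "even (length w)") (simp_all add: norm_mult wave_def)
  finally show ?thesis .
qed

lemma wave_orthogonal:
  assumes "j < n" "k < n"
  shows "(\<Sum>s<n. cnj (wave n w s j) * wave n w s k) = (if j = k then of_nat n else 0)"
proof (cases "even (length w)")
  case True
  have "(\<Sum>s<n. cnj (wave n w s j) * wave n w s k) = (\<Sum>s<n. cnj (unity_root n s (k + 1)) * unity_root n s (j + 1))"
    using True by (simp add: wave_def mult.commute)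
  then show ?thesis using unity_root_orthogonal[OF assms(2,1)] by auto
next
  case False
  then show ?thesis using unity_root_orthogonal[OF assms] by (simp add: wave_def)
qed

text \<open>The trace in the orthogonal basis formed by the waves.\<close>
lemma mat_trace_monomial_scaled_rc:
  assumes n: "n > 0"
  shows "mat_trace (monomial (random_matrix_algebra M n) (\<lambda>i. scaled_rc M n (X i)) w) \<omega> =
    (\<Sum>s<n. wave_trace n w s * altprod (\<lambda>i. linear_form (fourier_coeffs n s) (X i) {..<n} \<omega>) w) / of_nat n"
proof -
  define m where "m = monomial (random_matrix_algebra M n) (\<lambda>i. scaled_rc M n (X i)) w"
  define \<Lambda> where "\<Lambda> s = altprod (\<lambda>i. linear_form (fourier_coeffs n s) (X i) {..<n} \<omega>) w" for s
  have carr: "m \<in> carrier_mat n n"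
    unfolding m_def by (rule monomial_carrier_mat) (rule scaled_rc_carrier_mat)
  have "(\<Sum>s<n. wave_trace n w s * \<Lambda> s) = (\<Sum>s<n. \<Sum>j<n. cnj (wave n w s j) * (\<Lambda> s * cnj (unity_root n s (j + 1))))"
    by (simp add: wave_trace_def sum_distrib_right sum_distrib_left mult_ac)
  also have "\<dots> = (\<Sum>s<n. \<Sum>j<n. cnj (wave n w s j) * (\<Sum>k<n. (m $$ (j, k)) \<omega> * wave n w s k))"
  proof (intro sum.cong refl arg_cong2[of _ _ _ _ "(*)"])
    fix s j assume "j \<in> {..<n}"
    then have "j < n" by simp
    from monomial_scaled_rc_fourier[OF n this, where M = M and X = X and w = w and s = s and \<omega> = \<omega>]
    show "\<Lambda> s * cnj (unity_root n s (j + 1)) = (\<Sum>k<n. (m $$ (j, k)) \<omega> * wave n w s k)"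
      unfolding m_def \<Lambda>_def by (rule sym[OF conjunct1])
  qed
  also have "\<dots> = (\<Sum>j<n. \<Sum>s<n. cnj (wave n w s j) * (\<Sum>k<n. (m $$ (j, k)) \<omega> * wave n w s k))"
    by (rule sum.swap)
  also have "\<dots> = (\<Sum>j<n. \<Sum>k<n. (m $$ (j, k)) \<omega> * (\<Sum>s<n. cnj (wave n w s j) * wave n w s k))"
  proof (rule sum.cong[OF refl])
    fix j
    have "(\<Sum>s<n. cnj (wave n w s j) * (\<Sum>k<n. (m $$ (j, k)) \<omega> * wave n w s k)) =
       (\<Sum>s<n. \<Sum>k<n. (m $$ (j, k)) \<omega> * (cnj (wave n w s j) * wave n w s k))"
      by (simp add: sum_distrib_left mult_ac)
    also have "\<dots> = (\<Sum>k<n. \<Sum>s<n. (m $$ (j, k)) \<omega> * (cnj (wave n w s j) * wave n w s k))"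
      by (rule sum.swap)
    finally show "(\<Sum>s<n. cnj (wave n w s j) * (\<Sum>k<n. (m $$ (j, k)) \<omega> * wave n w s k)) =
       (\<Sum>k<n. (m $$ (j, k)) \<omega> * (\<Sum>s<n. cnj (wave n w s j) * wave n w s k))"
      by (simp add: sum_distrib_left)
  qed
  also have "\<dots> = (\<Sum>j<n. \<Sum>k<n. if j = k then of_nat n * (m $$ (j, k)) \<omega> else 0)"
    by (intro sum.cong refl) (auto simp: wave_orthogonal)
  also have "\<dots> = of_nat n * mat_trace m \<omega>"
    using carr by (simp add: mat_trace_apply sum_distrib_left)
  finally show ?thesis
    using n by (simp add: m_def \<Lambda>_def)
qed

section \<open>Convergence of the moments\<close>

lemma norm_prod_le_power:
  fixes a :: "'i \<Rightarrow> complex"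
  assumes "\<And>i. i \<in> J \<Longrightarrow> norm (a i) \<le> B"
  shows "norm (prod a J) \<le> B ^ card J"
proof -
  have "norm (prod a J) = (\<Prod>i\<in>J. norm (a i))"
    by (rule prod_norm[symmetric])
  also have "\<dots> \<le> (\<Prod>i\<in>J. B)"
    by (rule prod_mono) (simp add: assms)
  finally show ?thesis by simp
qed

lemma norm_prod_diff_le:
  fixes a b :: "'i \<Rightarrow> complex"
  assumes "finite J" "1 \<le> B" "0 \<le> \<delta>"
    and "\<And>i. i \<in> J \<Longrightarrow> norm (a i) \<le> B" "\<And>i. i \<in> J \<Longrightarrow> norm (b i) \<le> B"
    and "\<And>i. i \<in> J \<Longrightarrow> norm (a i - b i) \<le> \<delta>"
  shows "norm (prod a J - prod b J) \<le> real (card J) * B ^ card J * \<delta>"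
  using assms(1,4-6)
proof (induction J rule: finite_induct)
  case (insert i J)
  have B: "norm (prod b J) \<le> B ^ card J"
    using insert.prems(2) by (intro norm_prod_le_power) auto
  have "prod a (insert i J) - prod b (insert i J) =
      a i * (prod a J - prod b J) + (a i - b i) * prod b J"
    using insert.hyps by (simp add: algebra_simps)
  also have "norm \<dots> \<le> B * (real (card J) * B ^ card J * \<delta>) + \<delta> * B ^ card J"
    using insert B assms(2,3)
    by (intro order_trans[OF norm_triangle_ineq] add_mono; unfold norm_mult; intro mult_mono) auto
  also have "\<dots> \<le> B * (real (card J) * B ^ card J * \<delta>) + \<delta> * (B * B ^ card J)"
    using assms(2,3) by (intro add_left_mono mult_left_mono) (auto simp: mult_le_cancel_right1)
  also have "\<dots> = real (card (insert i J)) * B ^ card (insert i J) * \<delta>"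
    using insert.hyps by (simp add: algebra_simps)
  finally show ?case .
qed auto

lemma fourier_coeffs_norm:
  "norm (fourier_coeffs n s t) = 1 / sqrt (real n)"
  by (simp add: fourier_coeffs_def norm_divide)

lemma sum_norm_fourier_coeffs: "n > 0 \<Longrightarrow> (\<Sum>t<n. (norm (fourier_coeffs n s t))\<^sup>2) = 1"
  by (simp add: fourier_coeffs_norm power_divide)

lemma sum_fourier_coeffs_squared:
  assumes "n > 0" "\<not> n dvd 2 * s"
  shows "(\<Sum>t<n. (fourier_coeffs n s t)\<^sup>2) = 0"
proof -
  have "(fourier_coeffs n s t)\<^sup>2 = unity_root n (2 * s) t / of_nat n" for t
  proof -
    have "(unity_root n s t)\<^sup>2 = unity_root n (2 * s) t"
      using unity_root_add[of n t s s] by (simp add: unity_root_commute[of n _ t] power2_eq_square mult_2)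
    moreover have "(complex_of_real (sqrt (real n)))\<^sup>2 = of_nat n"
      by (simp flip: of_real_power)
    ultimately show ?thesis by (simp add: fourier_coeffs_def power_divide)
  qed
  then show ?thesis
    using sum_unity_root[of n "2 * s"] assms by (simp add: sum_divide_distrib[symmetric])
qed

text \<open>The indices for which \<open>f\<^sub>s\<close> is real; there the linear form is not asymptotically circular.\<close>
lemma card_dvd_double_le: "card {s \<in> {..<n}. n dvd 2 * s} \<le> 2" for n :: nat
proof -
  have "s = 0 \<or> s = n div 2" if s: "s < n" and d: "n dvd 2 * s" for s
  proof -
    obtain k where k: "2 * s = n * k" using d by (elim dvdE)
    then have "n * k < n * 2" using s by linarith
    then have "k < 2" unfolding mult_less_cancel1 by (rule conjunct2)
    then have "k = 0 \<or> k = 1" by auto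
    then show ?thesis using k by auto
  qed
  then have "{s \<in> {..<n}. n dvd 2 * s} \<subseteq> {0, n div 2}" by auto
  then have "card {s \<in> {..<n}. n dvd 2 * s} \<le> card {0, n div 2}"
    by (intro card_mono) auto
  also have "\<dots> \<le> 2" by (simp add: card_insert_if)
  finally show ?thesis .
qed

text \<open>The moment condition is stated for the values of the link function at \<open>m \<le> l \<le> n\<close>. Taking
  \<open>l = n\<close> reaches every index \<open>t < n\<close>, the index \<open>0\<close> through \<open>m = n\<close>.\<close>
lemma assumption_I_moment_bounds:
  assumes "assumption_I p M X"
  obtains C where "\<And>n i t k. n \<ge> 1 \<Longrightarrow> i \<in> {1..p} \<Longrightarrow> t < n \<Longrightarrow> integrable (M n) (\<lambda>\<omega>. \<bar>X n i t \<omega>\<bar> ^ k)"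
    "\<And>n i t k. n \<ge> 1 \<Longrightarrow> i \<in> {1..p} \<Longrightarrow> t < n \<Longrightarrow> (\<integral>\<omega>. \<bar>X n i t \<omega>\<bar> ^ k \<partial>M n) \<le> C k"
proof -
  define Q where "Q k c \<longleftrightarrow> (\<forall>n\<ge>1. \<forall>i\<in>{1..p}. \<forall>t<n. integrable (M n) (\<lambda>\<omega>. \<bar>X n i t \<omega>\<bar> ^ k)
     \<and> (\<integral>\<omega>. \<bar>X n i t \<omega>\<bar> ^ k \<partial>M n) \<le> c)" for k and c :: real
  have "\<exists>c. Q k c" for k
  proof (cases "k = 0")
    case True
    have "Q k 1"
      unfolding Q_def
    proof (intro allI impI ballI)
      fix n t :: nat and i assume "(1 :: nat) \<le> n"
      then interpret prob_space "M n" using assms by (auto simp: assumption_I_def)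
      show "integrable (M n) (\<lambda>\<omega>. \<bar>X n i t \<omega>\<bar> ^ k) \<and> (\<integral>\<omega>. \<bar>X n i t \<omega>\<bar> ^ k \<partial>M n) \<le> 1"
        using True by (simp add: prob_space)
    qed
    then show ?thesis by blast
  next
    case False
    then obtain c where c: "\<forall>n\<ge>1. \<forall>i\<in>{1..p}. \<forall>m l. 1 \<le> m \<and> m \<le> l \<and> l \<le> n \<longrightarrow>
        integrable (M n) (\<lambda>\<omega>. \<bar>X n i (rc_link n m l) \<omega>\<bar> ^ k) \<and>
        prob_space.expectation (M n) (\<lambda>\<omega>. \<bar>X n i (rc_link n m l) \<omega>\<bar> ^ k) \<le> c"
      using assms unfolding assumption_I_def by (metis One_nat_def Suc_le_eq neq0_conv)
    have "Q k c"
      unfolding Q_def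
    proof (intro allI impI ballI)
      fix n t :: nat and i assume n: "1 \<le> n" and i: "i \<in> {1..p}" and t: "t < n"
      define m where "m = (if t = 0 then n else t)"
      have "rc_link n m n = t" "1 \<le> m" "m \<le> n"
        using n t by (auto simp: rc_link_def m_def)
      then show "integrable (M n) (\<lambda>\<omega>. \<bar>X n i t \<omega>\<bar> ^ k) \<and> (\<integral>\<omega>. \<bar>X n i t \<omega>\<bar> ^ k \<partial>M n) \<le> c"
        using c n i by (metis order_refl)
    qed
    then show ?thesis by blast
  qed
  then obtain C where "Q k (C k)" for k by metis
  then show ?thesis by (intro that[of C]) (auto simp: Q_def)
qed

text \<open>One sequence of moment bounds serves for all sizes and all matrices.\<close>
lemma assumption_I_standardized_family:
  assumes I: "assumption_I p M X"
  obtains C where "\<And>n i. n \<ge> 1 \<Longrightarrow> i \<in> {1..p} \<Longrightarrow> standardized_family (M n) C {..<n} (X n i)"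
proof -
  obtain C where C: "\<And>n i t k. n \<ge> 1 \<Longrightarrow> i \<in> {1..p} \<Longrightarrow> t < n \<Longrightarrow> integrable (M n) (\<lambda>\<omega>. \<bar>X n i t \<omega>\<bar> ^ k)"
    "\<And>n i t k. n \<ge> 1 \<Longrightarrow> i \<in> {1..p} \<Longrightarrow> t < n \<Longrightarrow> (\<integral>\<omega>. \<bar>X n i t \<omega>\<bar> ^ k \<partial>M n) \<le> C k"
    using assumption_I_moment_bounds[OF I] by blast
  have "standardized_family (M n) C {..<n} (X n i)" if n: "n \<ge> 1" and i: "i \<in> {1..p}" for n i
  proof -
    interpret prob_space "M n" using I n by (auto simp: assumption_I_def)
    have joint: "indep_vars (\<lambda>_. borel) (\<lambda>(i, t). X n i t) ({1..p} \<times> {..<n})"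
      using I n by (auto simp: assumption_I_def)
    have "indep_vars (\<lambda>t. PiM {(i, t)} (\<lambda>_. borel))
        (\<lambda>t \<omega>. restrict (\<lambda>q. (case q of (i, t) \<Rightarrow> X n i t) \<omega>) {(i, t)}) {..<n}"
      using i by (intro indep_vars_restrict[OF joint]) (auto simp: disjoint_family_on_def)
    then have "indep_vars (\<lambda>_. borel)
        (\<lambda>t \<omega>. (\<lambda>f. f (i, t)) (restrict (\<lambda>q. (case q of (i, t) \<Rightarrow> X n i t) \<omega>) {(i, t)})) {..<n}"
      by (rule indep_vars_compose2) measurable
    then have ind: "indep_vars (\<lambda>_. borel) (X n i) {..<n}"
      by simp
    show ?thesis
    proof (intro standardized_family.intro standardized_family_axioms.intro prob_space_axioms ind)
      fix t assume t: "t \<in> {..<n}"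
      show m: "expectation (X n i t) = 0"
        using I n i t unfolding assumption_I_def by blast
      have "variance (X n i t) = 1"
        using I n i t unfolding assumption_I_def by blast
      then show "expectation (\<lambda>\<omega>. (X n i t \<omega>)\<^sup>2) = 1"
        using m by simp
    qed (use C n i in auto)
  qed
  then show ?thesis by (rule that)
qed

lemma (in prob_space) indep_linear_forms:
  assumes joint: "indep_vars (\<lambda>_. borel) (\<lambda>(i, t). X i t) (J \<times> T)" and "finite T"
  shows "indep_vars (\<lambda>_. borel) (\<lambda>i. linear_form c (X i) T) J"
proof -
  have "indep_vars (\<lambda>i. PiM ({i} \<times> T) (\<lambda>_. borel))
      (\<lambda>i \<omega>. restrict (\<lambda>q. (case q of (i, t) \<Rightarrow> X i t) \<omega>) ({i} \<times> T)) J"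
    by (intro indep_vars_restrict[OF joint]) (auto simp: disjoint_family_on_def)
  then have "indep_vars (\<lambda>_. borel)
      (\<lambda>i \<omega>. (\<lambda>f. \<Sum>t\<in>T. c t * complex_of_real (f (i, t)))
        (restrict (\<lambda>q. (case q of (i, t) \<Rightarrow> X i t) \<omega>) ({i} \<times> T))) J"
    by (rule indep_vars_compose2) measurable
  moreover have "(\<lambda>\<omega>. (\<lambda>f. \<Sum>t\<in>T. c t * complex_of_real (f (i, t)))
        (restrict (\<lambda>q. (case q of (i, t) \<Rightarrow> X i t) \<omega>) ({i} \<times> T))) = linear_form c (X i) T" for i
    by (auto simp: linear_form_def fun_eq_iff)
  ultimately show ?thesis by simp
qed

lemma scaled_rc_in_carrier:
  assumes "standardized_family M C {..<n} x"
  shows "scaled_rc M n x \<in> carrier (random_matrix_algebra M n)"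
proof -
  interpret standardized_family M C "{..<n}" x by fact
  have "scaled_rc M n x $$ (j, k) \<in> moment_algebra M" if "j < n" "k < n" for j k
  proof -
    have "rc_link n (j + 1) (k + 1) \<in> {..<n}"
      using that by (simp add: rc_link_def)
    then have "(\<lambda>\<omega>. complex_of_real (1 / sqrt (real n)) * complex_of_real (x (rc_link n (j + 1) (k + 1)) \<omega>))
        \<in> moment_algebra M"
      by (intro moment_algebra_intros X_moment_algebra)
    also have "(\<lambda>\<omega>. complex_of_real (1 / sqrt (real n)) * complex_of_real (x (rc_link n (j + 1) (k + 1)) \<omega>)) =
        scaled_rc M n x $$ (j, k)"
      using that by (intro ext) (simp add: scaled_rc_entry)
    finally show ?thesis .
  qed
  then show ?thesis
    using scaled_rc_carrier_mat[of M n x] by (simp add: random_matrix_algebra_simps(1))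
qed

lemma expected_trace_scaled_rc:
  assumes n: "n \<ge> 1" and fam: "\<And>i. i \<in> J \<Longrightarrow> standardized_family M C {..<n} (X i)"
    and w: "w \<in> lists J" and J: "finite J" and "prob_space M"
    and joint: "prob_space.indep_vars M (\<lambda>_. borel) (\<lambda>(i, t). X i t) (J \<times> {..<n})"
  shows "expected_trace M n (monomial (random_matrix_algebra M n) (\<lambda>i. scaled_rc M n (X i)) w) =
    (\<Sum>s<n. wave_trace n w s * (\<Prod>i\<in>J. \<integral>\<omega>. mixed_power (odd_count w i) (even_count w i)
        (linear_form (fourier_coeffs n s) (X i) {..<n} \<omega>) \<partial>M)) / (of_nat n)\<^sup>2"
proof -
  interpret prob_space M by fact
  have ma: "linear_form (fourier_coeffs n s) (X i) {..<n} \<in> moment_algebra M" if "i \<in> J" for s i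
    using fam[OF that] by (rule standardized_family.linear_form_moment_algebra)
  have int: "integrable M (\<lambda>\<omega>. altprod (\<lambda>i. linear_form (fourier_coeffs n s) (X i) {..<n} \<omega>) w)" for s
    using w by (intro moment_algebra_integrable altprod_in_moment_algebra ma) auto
  have E: "expectation (\<lambda>\<omega>. altprod (\<lambda>i. linear_form (fourier_coeffs n s) (X i) {..<n} \<omega>) w) =
     (\<Prod>i\<in>J. \<integral>\<omega>. mixed_power (odd_count w i) (even_count w i)
        (linear_form (fourier_coeffs n s) (X i) {..<n} \<omega>) \<partial>M)" for s
    by (rule expectation_altprod[OF J w indep_linear_forms[OF joint] ma]) auto
  show ?thesis
    unfolding expected_trace_def mat_trace_monomial_scaled_rc[OF n[unfolded One_nat_def Suc_le_eq]] E[symmetric]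
    using int by (simp add: power2_eq_square)
qed

text \<open>The trace averages over \<open>s\<close> the products over \<open>i\<close> of mixed moments. Each product is within
  \<open>O(1 / sqrt n)\<close> of the limit, except for at most two values of \<open>s\<close>, which have total weight
  \<open>2 / n\<close> and bounded products.\<close>
lemma expected_trace_scaled_rc_tendsto:
  assumes I: "assumption_I p M X" and w: "w \<in> lists {1..p}"
  shows "(\<lambda>n. expected_trace (M n) n (monomial (random_matrix_algebra (M n) n) (\<lambda>i. scaled_rc (M n) n (X n i)) w))
    \<longlonglongrightarrow> complex_of_real (word_limit {1..p} w)"
proof -
  define J where "J = {1..p}"
  have J: "finite J" by (simp add: J_def)
  obtain C where fam: "\<And>n i. n \<ge> 1 \<Longrightarrow> i \<in> J \<Longrightarrow> standardized_family (M n) C {..<n} (X n i)"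
    using assumption_I_standardized_family[OF I] J_def by blast
  define m where "m n s i = (\<integral>\<omega>. mixed_power (odd_count w i) (even_count w i)
        (linear_form (fourier_coeffs n s) (X n i) {..<n} \<omega>) \<partial>M n)" for n s i
  define g where "g i = complex_of_real (gaussian_moment (odd_count w i) (even_count w i))" for i
  define L where "L = complex_of_real (word_limit J w)"
  have L: "L = prod g J" by (simp add: L_def word_limit_def g_def)
  define K where "K = (\<Sum>i\<in>J. moment_error (stein_bound C) (odd_count w i) (even_count w i))"
  define B where "B = 1 + (\<Sum>i\<in>J. form_moment_bound C (odd_count w i + even_count w i) + norm (g i))"
  have K: "moment_error (stein_bound C) (odd_count w i) (even_count w i) \<le> K" if "i \<in> J" for i
    unfolding K_def using that J stein_bound_nonneg by (intro member_le_sum moment_error_nonneg)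
  have B': "form_moment_bound C (odd_count w i + even_count w i) + norm (g i) \<le> B" if "i \<in> J" for i
    unfolding B_def using that J form_moment_bound_nonneg
    by (intro order_trans[OF member_le_sum[of i J "\<lambda>i. form_moment_bound C (odd_count w i + even_count w i) + norm (g i)"]])
       (auto intro!: add_nonneg_nonneg)
  have K0: "0 \<le> K"
    unfolding K_def by (intro sum_nonneg moment_error_nonneg stein_bound_nonneg)
  have B1: "1 \<le> B"
    unfolding B_def using form_moment_bound_nonneg by (auto intro!: sum_nonneg add_nonneg_nonneg)
  have Bg: "norm (g i) \<le> B" if "i \<in> J" for i
    using B'[OF that] form_moment_bound_nonneg[of C "odd_count w i + even_count w i"] by linarith
  define A where "A = real (card J) * B ^ card J * K"
  have A0: "0 \<le> A" using B1 K0 by (simp add: A_def)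
  have bound: "norm (expected_trace (M n) n (monomial (random_matrix_algebra (M n) n) (\<lambda>i. scaled_rc (M n) n (X n i)) w) - L)
      \<le> A * (1 / sqrt (real n)) + 4 * B ^ card J * (1 / real n)" if n: "n \<ge> 1" for n
  proof -
    have n0: "n > 0" using n by simp
    have Bm: "norm (m n s i) \<le> B" if "i \<in> J" for s i
    proof -
      have "norm (m n s i) \<le> form_moment_bound C (odd_count w i + even_count w i)"
        unfolding m_def using sum_norm_fourier_coeffs[OF n0]
        by (intro standardized_family.mixed_moment_bound[OF fam[OF n that]]) simp
      then show ?thesis using B'[OF that] norm_ge_zero[of "g i"] by linarith
    qed
    have good: "norm (prod (m n s) J - L) \<le> A * (1 / sqrt (real n))" if "\<not> n dvd 2 * s" for s
    proof -
      have "norm (prod (m n s) J - prod g J) \<le> real (card J) * B ^ card J * (K * (1 / sqrt (real n)))"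
      proof (intro norm_prod_diff_le J B1 Bm Bg)
        fix i assume i: "i \<in> J"
        have "norm (m n s i - g i) \<le> moment_error (stein_bound C) (odd_count w i) (even_count w i) * (1 / sqrt (real n))"
          unfolding m_def g_def using sum_norm_fourier_coeffs[OF n0] sum_fourier_coeffs_squared[OF n0 that]
          by (intro standardized_family.mixed_moment_approx[OF fam[OF n i]]) (auto simp: fourier_coeffs_norm)
        also have "\<dots> \<le> K * (1 / sqrt (real n))"
          using K[OF i] by (intro mult_right_mono) auto
        finally show "norm (m n s i - g i) \<le> K * (1 / sqrt (real n))" .
      qed (use K0 in auto)
      then show ?thesis by (simp add: L A_def mult.assoc)
    qed
    \<comment> \<open>The crude bound, used for the indices \<open>s\<close> with \<open>n\<close> dividing \<open>2 s\<close>.\<close>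
    have bad: "norm (prod (m n s) J - L) \<le> 2 * B ^ card J" for s
      using norm_prod_le_power[of J "m n s" B] norm_prod_le_power[of J g B] Bm Bg
        norm_triangle_ineq4[of "prod (m n s) J" "prod g J"] by (simp add: L)
    have "(\<Sum>s<n. norm (prod (m n s) J - L)) \<le>
        (\<Sum>s<n. A * (1 / sqrt (real n)) + (if n dvd 2 * s then 2 * B ^ card J else 0))"
    proof (rule sum_mono)
      fix s
      have "0 \<le> A * (1 / sqrt (real n))" using A0 by simp
      then show "norm (prod (m n s) J - L) \<le> A * (1 / sqrt (real n)) + (if n dvd 2 * s then 2 * B ^ card J else 0)"
        using good[of s] bad[of s] by (cases "n dvd 2 * s") (simp_all del: times_divide_eq_right)
    qed
    also have "\<dots> = real n * (A * (1 / sqrt (real n))) + real (card {s \<in> {..<n}. n dvd 2 * s}) * (2 * B ^ card J)"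
      by (simp add: sum.distrib sum.inter_filter[symmetric])
    also have "\<dots> \<le> real n * (A * (1 / sqrt (real n))) + 2 * (2 * B ^ card J)"
      using card_dvd_double_le[of n] B1 by (intro add_left_mono mult_right_mono) auto
    finally have sum_le: "(\<Sum>s<n. norm (prod (m n s) J - L)) \<le> real n * (A * (1 / sqrt (real n))) + 4 * B ^ card J"
      by simp
    have joint: "prob_space.indep_vars (M n) (\<lambda>_. borel) (\<lambda>(i, t). X n i t) (J \<times> {..<n})" and ps: "prob_space (M n)"
      using I n by (auto simp: assumption_I_def J_def)
    have tr: "expected_trace (M n) n (monomial (random_matrix_algebra (M n) n) (\<lambda>i. scaled_rc (M n) n (X n i)) w) =
       (\<Sum>s<n. wave_trace n w s * prod (m n s) J) / (of_nat n)\<^sup>2"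
      unfolding m_def by (rule expected_trace_scaled_rc[OF n fam[OF n] w[folded J_def] J ps joint])
    \<comment> \<open>For odd length both sides vanish, so the weights need not add up to one.\<close>
    have LL: "L = (\<Sum>s<n. wave_trace n w s * L) / (of_nat n)\<^sup>2"
    proof (cases "even (length w)")
      case True
      then show ?thesis using n0 by (simp add: wave_trace_even power2_eq_square)
    next
      case False
      then show ?thesis using word_limit_odd[OF J w[folded J_def]] by (simp add: L_def)
    qed
    have "expected_trace (M n) n (monomial (random_matrix_algebra (M n) n) (\<lambda>i. scaled_rc (M n) n (X n i)) w) - L =
       (\<Sum>s<n. wave_trace n w s * (prod (m n s) J - L)) / (of_nat n)\<^sup>2"
      unfolding tr by (subst LL) (simp add: sum_subtractf right_diff_distrib diff_divide_distrib)
    also have "norm \<dots> = norm (\<Sum>s<n. wave_trace n w s * (prod (m n s) J - L)) / (real n)\<^sup>2"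
      by (simp add: norm_divide norm_power)
    also have "\<dots> \<le> (\<Sum>s<n. real n * norm (prod (m n s) J - L)) / (real n)\<^sup>2"
      using norm_wave_trace_le
      by (intro divide_right_mono sum_norm_le) (auto simp: norm_mult intro!: mult_right_mono)
    also have "\<dots> = (\<Sum>s<n. norm (prod (m n s) J - L)) / real n"
      using n0 by (simp add: sum_distrib_left[symmetric] power2_eq_square)
    also have "\<dots> \<le> (real n * (A * (1 / sqrt (real n))) + 4 * B ^ card J) / real n"
      using sum_le by (rule divide_right_mono) simp
    also have "\<dots> = A * (1 / sqrt (real n)) + 4 * B ^ card J * (1 / real n)"
      using n0 by (simp add: add_divide_distrib)
    finally show ?thesis .
  qed
  have "(\<lambda>n. 1 / sqrt (real n)) \<longlonglongrightarrow> 0"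
    using tendsto_real_sqrt[OF lim_inverse_n] by (simp add: real_sqrt_divide inverse_eq_divide)
  then have "(\<lambda>n. A * (1 / sqrt (real n)) + 4 * B ^ card J * (1 / real n)) \<longlonglongrightarrow> A * 0 + 4 * B ^ card J * 0"
    by (intro tendsto_intros lim_1_over_n)
  then have lim: "(\<lambda>n. A * (1 / sqrt (real n)) + 4 * B ^ card J * (1 / real n)) \<longlonglongrightarrow> 0"
    by simp
  have "(\<lambda>n. expected_trace (M n) n (monomial (random_matrix_algebra (M n) n) (\<lambda>i. scaled_rc (M n) n (X n i)) w) - L) \<longlonglongrightarrow> 0"
    by (rule Lim_null_comparison[OF eventually_mono[OF eventually_ge_at_top[of 1]] lim]) (rule bound)
  then show ?thesis unfolding L_def J_def by (rule LIM_zero_cancel)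
qed

section \<open>The limiting two by two matrices\<close>

abbreviation mat2 :: "'a \<Rightarrow> 'a \<Rightarrow> 'a \<Rightarrow> 'a \<Rightarrow> 'a mat" where
  "mat2 a b c d \<equiv> mat_of_rows_list 2 [[a, b], [c, d]]"

lemma mat2_dims [simp]: "dim_row (mat2 a b c d) = 2" "dim_col (mat2 a b c d) = 2"
  by (simp_all add: mat_of_rows_list_def)

lemma mat2_carrier [simp]: "mat2 a b c d \<in> carrier_mat 2 2"
  by (rule carrier_matI) simp_all

lemma mat2_entries [simp]:
  "mat2 a b c d $$ (0, 0) = a" "mat2 a b c d $$ (0, Suc 0) = b"
  "mat2 a b c d $$ (Suc 0, 0) = c" "mat2 a b c d $$ (Suc 0, Suc 0) = d"
  by (simp_all add: mat_of_rows_list_def)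

lemma mat2_eqI:
  assumes "A \<in> carrier_mat 2 2" "A $$ (0, 0) = a" "A $$ (0, Suc 0) = b"
    "A $$ (Suc 0, 0) = c" "A $$ (Suc 0, Suc 0) = d"
  shows "A = mat2 a b c d"
  using assms by (intro eq_matI) (auto simp: less_2_cases_iff)

lemma upto_2: "{0..<2} = {0, Suc 0}" "{..<2} = {0, Suc 0}"
  by auto

lemma mat2_mult:
  "mat2 a b c d * mat2 a' b' c' d' =
     mat2 (a * a' + b * c') (a * b' + b * d') (c * a' + d * c') (c * b' + d * d')"
  for a b c d :: "'a :: comm_ring_1"
  by (rule mat2_eqI) (auto simp: scalar_prod_def upto_2 intro!: mult_carrier_mat[of _ 2 2 _ 2])

lemma mat2_add:
  "mat2 a b c d + mat2 a' b' c' d' = mat2 (a + a') (b + b') (c + c') (d + d')"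
  for a b c d :: "'a :: comm_ring_1"
  by (rule mat2_eqI) auto

lemma mat2_smult: "x \<cdot>\<^sub>m mat2 a b c d = mat2 (x * a) (x * b) (x * c) (x * d)"
  for a b c d :: "'a :: comm_ring_1"
  by (rule mat2_eqI) auto

lemma mat2_one: "1\<^sub>m 2 = mat2 1 0 0 (1 :: 'a :: comm_ring_1)"
  by (rule mat2_eqI) auto

lemma mat2_zero: "0\<^sub>m 2 2 = mat2 0 0 0 (0 :: 'a :: comm_ring_1)"
  by (rule mat2_eqI) auto

lemma mat2_in_carrier_iff:
  "mat2 a b c d \<in> carrier (random_matrix_algebra M 2) \<longleftrightarrow>
     a \<in> moment_algebra M \<and> b \<in> moment_algebra M \<and> c \<in> moment_algebra M \<and> d \<in> moment_algebra M"
  by (auto simp: random_matrix_algebra_simps less_2_cases_iff)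

lemma expected_trace_mat2:
  assumes "integrable M a" "integrable M d"
  shows "expected_trace M 2 (mat2 a b c d) = ((\<integral>\<omega>. a \<omega> \<partial>M) + (\<integral>\<omega>. d \<omega> \<partial>M)) / 2"
  using assms by (simp add: expected_trace_def mat_trace_apply upto_2)

text \<open>The exact counterpart of the action of a word of reverse circulant matrices on the waves.\<close>
lemma monomial_off_diagonal:
  "monomial (random_matrix_algebra M 2) (\<lambda>i. off_diagonal (\<eta> i)) w =
    (if even (length w)
     then mat2 (\<lambda>\<omega>. altprod (\<lambda>i. \<eta> i \<omega>) w) 0 0 (\<lambda>\<omega>. cnj (altprod (\<lambda>i. \<eta> i \<omega>) w))
     else mat2 0 (\<lambda>\<omega>. altprod (\<lambda>i. \<eta> i \<omega>) w) (\<lambda>\<omega>. cnj (altprod (\<lambda>i. \<eta> i \<omega>) w)) 0)"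
proof (induction w)
  case Nil
  then show ?case
    by (simp add: monomial_Nil random_matrix_algebra_simps mat2_one one_fun_def)
next
  case (Cons i w)
  show ?case
    unfolding monomial_Cons Cons.IH random_matrix_algebra_simps(2)
    by (simp add: off_diagonal_def mat2_mult times_fun_def zero_fun_def plus_fun_def)
qed

lemma half_commute_off_diagonal:
  "half_commute (random_matrix_algebra M 2) J (\<lambda>i. off_diagonal (\<eta> i))"
  unfolding half_commute_def random_matrix_algebra_simps off_diagonal_def
  by (simp add: mat2_mult mult_ac)

abbreviation scalar2 :: "('v \<Rightarrow> complex) \<Rightarrow> ('v \<Rightarrow> complex) mat" where
  "scalar2 f \<equiv> mat2 f 0 0 f"

lemma off_diagonal_square:
  "off_diagonal f * off_diagonal f = scalar2 (\<lambda>\<omega>. f \<omega> * cnj (f \<omega>))"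
  by (simp add: off_diagonal_def mat2_mult times_fun_def plus_fun_def zero_fun_def mult.commute)

lemma prod_word_scalar2:
  "distinct ks \<Longrightarrow> prod_word (random_matrix_algebra M 2) (map (\<lambda>k. scalar2 (f k)) ks) =
     scalar2 (\<lambda>\<omega>. \<Prod>k\<in>set ks. f k \<omega>)"
  by (induction ks)
     (auto simp: prod_word_def random_matrix_algebra_simps mat2_one mat2_mult one_fun_def
      times_fun_def plus_fun_def zero_fun_def)

text \<open>A unital subalgebra containing the square of \<open>off_diagonal \<eta>\<close>. All Borel functions \<open>g\<close> are admitted,
  and not just polynomials in \<open>\<bar>\<eta>\<bar>\<^sup>2\<close>, because independence of random variables passes to them directly.\<close>
definition scalar_functions_of :: "'v measure \<Rightarrow> ('v \<Rightarrow> complex) \<Rightarrow> ('v \<Rightarrow> complex) mat set" where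
  "scalar_functions_of M \<eta> =
     {scalar2 (\<lambda>\<omega>. g (\<eta> \<omega>)) | g. g \<in> borel_measurable borel \<and> (\<lambda>\<omega>. g (\<eta> \<omega>)) \<in> moment_algebra M}"

lemma scalar_functions_ofI:
  "A = scalar2 (\<lambda>\<omega>. g (\<eta> \<omega>)) \<Longrightarrow> g \<in> borel_measurable borel \<Longrightarrow>
     (\<lambda>\<omega>. g (\<eta> \<omega>)) \<in> moment_algebra M \<Longrightarrow> A \<in> scalar_functions_of M \<eta>"
  unfolding scalar_functions_of_def by blast

context prob_space
begin

lemma zero_fun_in_moment_algebra [simp]: "0 \<in> moment_algebra M"
  using moment_algebra_const[of 0] by (simp add: zero_fun_def)

lemma unital_subalgebra_scalar_functions:
  "unital_subalgebra (random_matrix_algebra M 2) (scalar_functions_of M \<eta>)"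
proof -
  let ?A = "random_matrix_algebra M 2" and ?S = "scalar_functions_of M \<eta>"
  interpret R: ring ?A by (rule ring_random_matrix_algebra)
  interpret A: module complex_ring ?A by (rule module_random_matrix_algebra)
  have sub: "?S \<subseteq> carrier ?A"
    by (auto simp: scalar_functions_of_def mat2_in_carrier_iff)
  have const: "scalar2 (\<lambda>\<omega>. c) \<in> ?S" for c
    unfolding scalar_functions_of_def
    by (auto intro!: exI[of _ "\<lambda>_. c"] moment_algebra_const)
  have one: "\<one>\<^bsub>?A\<^esub> \<in> ?S" and zero: "\<zero>\<^bsub>?A\<^esub> \<in> ?S"
    using const[of 1] const[of 0]
    by (simp_all add: random_matrix_algebra_simps mat2_one mat2_zero one_fun_def zero_fun_def)
  have smult: "c \<odot>\<^bsub>?A\<^esub> h \<in> ?S" if h: "h \<in> ?S" for c h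
  proof -
    obtain g where g: "h = scalar2 (\<lambda>\<omega>. g (\<eta> \<omega>))" "g \<in> borel_measurable borel" "(\<lambda>\<omega>. g (\<eta> \<omega>)) \<in> moment_algebra M"
      using h by (auto simp: scalar_functions_of_def)
    have "c \<odot>\<^bsub>?A\<^esub> h = scalar2 (\<lambda>\<omega>. c * g (\<eta> \<omega>))"
      by (simp add: g random_matrix_algebra_simps mat2_smult times_fun_def zero_fun_def)
    moreover have "(\<lambda>z. c * g z) \<in> borel_measurable borel" "(\<lambda>\<omega>. c * g (\<eta> \<omega>)) \<in> moment_algebra M"
      using g by (auto intro: moment_algebra_intros)
    ultimately show ?thesis by (rule scalar_functions_ofI[where g = "\<lambda>z. c * g z"])
  qed
  have mult: "h \<otimes>\<^bsub>?A\<^esub> h' \<in> ?S" and add: "h \<oplus>\<^bsub>?A\<^esub> h' \<in> ?S" if h: "h \<in> ?S" and h': "h' \<in> ?S" for h h'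
  proof -
    obtain g where g: "h = scalar2 (\<lambda>\<omega>. g (\<eta> \<omega>))" "g \<in> borel_measurable borel" "(\<lambda>\<omega>. g (\<eta> \<omega>)) \<in> moment_algebra M"
      using h by (auto simp: scalar_functions_of_def)
    obtain g' where g': "h' = scalar2 (\<lambda>\<omega>. g' (\<eta> \<omega>))" "g' \<in> borel_measurable borel" "(\<lambda>\<omega>. g' (\<eta> \<omega>)) \<in> moment_algebra M"
      using h' by (auto simp: scalar_functions_of_def)
    have "h \<otimes>\<^bsub>?A\<^esub> h' = scalar2 (\<lambda>\<omega>. g (\<eta> \<omega>) * g' (\<eta> \<omega>))" "h \<oplus>\<^bsub>?A\<^esub> h' = scalar2 (\<lambda>\<omega>. g (\<eta> \<omega>) + g' (\<eta> \<omega>))"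
      by (simp_all add: g g' random_matrix_algebra_simps mat2_mult mat2_add times_fun_def plus_fun_def zero_fun_def)
    moreover have "(\<lambda>z. g z * g' z) \<in> borel_measurable borel" "(\<lambda>\<omega>. g (\<eta> \<omega>) * g' (\<eta> \<omega>)) \<in> moment_algebra M"
      "(\<lambda>z. g z + g' z) \<in> borel_measurable borel" "(\<lambda>\<omega>. g (\<eta> \<omega>) + g' (\<eta> \<omega>)) \<in> moment_algebra M"
      using g g' by (auto intro: moment_algebra_intros)
    ultimately show "h \<otimes>\<^bsub>?A\<^esub> h' \<in> ?S" "h \<oplus>\<^bsub>?A\<^esub> h' \<in> ?S"
      by (auto intro: scalar_functions_ofI[where g = "\<lambda>z. g z * g' z"] scalar_functions_ofI[where g = "\<lambda>z. g z + g' z"])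
  qed
  have inv: "\<ominus>\<^bsub>?A\<^esub> h \<in> ?S" if h: "h \<in> ?S" for h
  proof -
    obtain g where g: "h = scalar2 (\<lambda>\<omega>. g (\<eta> \<omega>))"
      using h by (auto simp: scalar_functions_of_def)
    have "(-1) \<odot>\<^bsub>?A\<^esub> h \<oplus>\<^bsub>?A\<^esub> h = \<zero>\<^bsub>?A\<^esub>"
      by (simp add: g random_matrix_algebra_simps mat2_smult mat2_add mat2_zero times_fun_def plus_fun_def zero_fun_def)
    then have "\<ominus>\<^bsub>?A\<^esub> h = (-1) \<odot>\<^bsub>?A\<^esub> h"
      using sub h smult[OF h, of "-1"] by (intro abelian_group.minus_equality[OF abelian_group_random_matrix_algebra]) auto
    then show ?thesis using smult[OF h] by simp
  qed
  show ?thesis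
    unfolding unital_subalgebra_def
    by (intro conjI R.subringI A.submoduleI sub one zero inv mult add smult)
qed

lemma gen_subalgebra_subset:
  assumes "f \<in> moment_algebra M"
  shows "gen_subalgebra (random_matrix_algebra M 2) {off_diagonal f * off_diagonal f} \<subseteq> scalar_functions_of M f"
proof -
  have "off_diagonal f * off_diagonal f \<in> scalar_functions_of M f"
    unfolding off_diagonal_square scalar_functions_of_def
    using assms by (auto intro!: exI[of _ "\<lambda>z. z * cnj z"] moment_algebra_intros
        borel_measurable_times borel_measurable_cnj)
  then show ?thesis
    unfolding gen_subalgebra_def using unital_subalgebra_scalar_functions by (intro Inter_lower) auto
qed

text \<open>Elements of the generated subalgebras are scalar matrices \<open>g(\<eta>\<^sub>i) 1\<close>, on which the functional is the
  plain expectation; both conditions then concern scalar random variables.\<close>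
lemma nc_independent_off_diagonal_squares:
  assumes indep: "indep_vars (\<lambda>_. borel) \<eta> J"
    and ma: "\<And>i. i \<in> J \<Longrightarrow> \<eta> i \<in> moment_algebra M"
  shows "nc_independent (random_matrix_algebra M 2) (expected_trace M 2) J
    (\<lambda>i. off_diagonal (\<eta> i) \<otimes>\<^bsub>random_matrix_algebra M 2\<^esub> off_diagonal (\<eta> i))"
  unfolding nc_independent_def random_matrix_algebra_simps(2)
proof (intro conjI ballI impI allI)
  fix i j b c
  assume "i \<in> J" "j \<in> J" and b: "b \<in> gen_subalgebra (random_matrix_algebra M 2) {off_diagonal (\<eta> i) * off_diagonal (\<eta> i)}"
    and c: "c \<in> gen_subalgebra (random_matrix_algebra M 2) {off_diagonal (\<eta> j) * off_diagonal (\<eta> j)}"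
  have "b \<in> scalar_functions_of M (\<eta> i)" "c \<in> scalar_functions_of M (\<eta> j)"
    using gen_subalgebra_subset[OF ma] \<open>i \<in> J\<close> \<open>j \<in> J\<close> b c by blast+
  then show "b * c = c * b"
    by (auto simp: scalar_functions_of_def mat2_mult mult.commute)
next
  fix ks bs
  assume asm: "distinct ks \<and> set ks \<subseteq> J \<and> length bs = length ks \<and>
    (\<forall>m<length ks. bs ! m \<in> gen_subalgebra (random_matrix_algebra M 2) {off_diagonal (\<eta> (ks ! m)) * off_diagonal (\<eta> (ks ! m))})"
  \<comment> \<open>Since \<open>ks\<close> is distinct, the list \<open>bs\<close> can be reindexed by the letters themselves.\<close>
  define b where "b = the \<circ> map_of (zip ks bs)"
  have b: "bs = map b ks"
    using asm by (intro nth_equalityI) (auto simp: b_def map_of_zip_nth)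
  have "b k \<in> scalar_functions_of M (\<eta> k)" if "k \<in> set ks" for k
  proof -
    obtain m where m: "m < length ks" "k = ks ! m"
      using \<open>k \<in> set ks\<close> by (auto simp: in_set_conv_nth)
    have "bs ! m \<in> scalar_functions_of M (\<eta> k)"
      using asm m gen_subalgebra_subset[OF ma, of k] that by blast
    then show ?thesis using m by (simp add: b)
  qed
  then have "\<forall>k\<in>set ks. \<exists>g. b k = scalar2 (\<lambda>\<omega>. g (\<eta> k \<omega>)) \<and> g \<in> borel_measurable borel \<and>
      (\<lambda>\<omega>. g (\<eta> k \<omega>)) \<in> moment_algebra M"
    by (auto simp: scalar_functions_of_def)
  then obtain g where g: "\<And>k. k \<in> set ks \<Longrightarrow> b k = scalar2 (\<lambda>\<omega>. g k (\<eta> k \<omega>))"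
      "\<And>k. k \<in> set ks \<Longrightarrow> g k \<in> borel_measurable borel"
      "\<And>k. k \<in> set ks \<Longrightarrow> (\<lambda>\<omega>. g k (\<eta> k \<omega>)) \<in> moment_algebra M"
    by metis
  have bs: "bs = map (\<lambda>k. scalar2 (\<lambda>\<omega>. g k (\<eta> k \<omega>))) ks"
    using g(1) by (simp add: b)
  have \<phi>: "expected_trace M 2 (scalar2 f) = expectation f" if "f \<in> moment_algebra M" for f
    using that by (simp add: expected_trace_mat2 moment_algebra_integrable)
  have "expected_trace M 2 (prod_word (random_matrix_algebra M 2) bs) =
      expectation (\<lambda>\<omega>. \<Prod>k\<in>set ks. g k (\<eta> k \<omega>))"
    unfolding bs using asm g(3) by (subst prod_word_scalar2) (auto intro!: \<phi> moment_algebra_prod)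
  also have "\<dots> = (\<Prod>k\<in>set ks. expectation (\<lambda>\<omega>. g k (\<eta> k \<omega>)))"
  proof (rule indep_vars_lebesgue_integral)
    show "indep_vars (\<lambda>_. borel) (\<lambda>k \<omega>. g k (\<eta> k \<omega>)) (set ks)"
      using asm by (intro indep_vars_compose2[OF indep_vars_subset[OF indep]] g(2)) auto
  qed (use g(3) in \<open>auto intro: moment_algebra_integrable\<close>)
  also have "\<dots> = prod_list (map (expected_trace M 2) bs)"
    unfolding bs map_map using asm \<phi>[OF g(3)] by (simp add: prod.distinct_set_conv_list comp_def cong: map_cong)
  finally show "expected_trace M 2 (prod_word (random_matrix_algebra M 2) bs) = prod_list (map (expected_trace M 2) bs)" .
qed

lemma off_diagonal_in_carrier:
  "f \<in> moment_algebra M \<Longrightarrow> off_diagonal f \<in> carrier (random_matrix_algebra M 2)"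
  by (simp add: off_diagonal_def mat2_in_carrier_iff moment_algebra_cnj)

text \<open>For even length the two diagonal entries are conjugate with a real expectation; for odd length the
  diagonal is zero, and so is the product of Gaussian moments.\<close>
lemma expected_trace_off_diagonal:
  assumes J: "finite J" and indep: "indep_vars (\<lambda>_. borel) \<eta> J"
    and gauss: "\<forall>i\<in>J. standard_complex_gaussian M (\<eta> i)" and w: "w \<in> lists J"
  shows "expected_trace M 2 (monomial (random_matrix_algebra M 2) (\<lambda>i. off_diagonal (\<eta> i)) w) =
    complex_of_real (word_limit J w)"
proof -
  have ma: "\<eta> i \<in> moment_algebra M" if "i \<in> J" for i
    using gauss that by (auto intro: complex_gaussian_moments)
  show ?thesis
  proof (cases "even (length w)")
    case True
    have alt: "(\<lambda>\<omega>. altprod (\<lambda>i. \<eta> i \<omega>) w) \<in> moment_algebra M"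
      using w by (intro altprod_in_moment_algebra ma) auto
    have E: "expectation (\<lambda>\<omega>. altprod (\<lambda>i. \<eta> i \<omega>) w) = complex_of_real (word_limit J w)"
    proof -
      have "expectation (\<lambda>\<omega>. altprod (\<lambda>i. \<eta> i \<omega>) w) =
          (\<Prod>i\<in>J. expectation (\<lambda>\<omega>. mixed_power (odd_count w i) (even_count w i) (\<eta> i \<omega>)))"
        by (rule expectation_altprod[OF J w indep]) (rule ma)
      also have "\<dots> = (\<Prod>i\<in>J. complex_of_real (gaussian_moment (odd_count w i) (even_count w i)))"
        using gauss by (intro prod.cong refl complex_gaussian_moments(2)) auto
      finally show ?thesis by (simp add: word_limit_def)
    qed
    show ?thesis
      using True E moment_algebra_integrable[OF alt] moment_algebra_integrable[OF moment_algebra_cnj[OF alt]]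
      by (simp add: monomial_off_diagonal expected_trace_mat2)
  next
    case False
    then show ?thesis
      using word_limit_odd[OF J w]
      by (simp add: monomial_off_diagonal expected_trace_mat2 zero_fun_def)
  qed
qed

end

theorem theorem1:
  fixes p :: nat
    and M :: "nat \<Rightarrow> 'w measure"
    and X :: "nat \<Rightarrow> nat \<Rightarrow> nat \<Rightarrow> 'w \<Rightarrow> real"
    and N :: "'v measure"
    and \<eta> :: "nat \<Rightarrow> 'v \<Rightarrow> complex"
  assumes "assumption_I p M X"
    and "prob_space N"
    and "prob_space.indep_vars N (\<lambda>_. borel) \<eta> {1..p}"
    and "\<forall>i\<in>{1..p}. standard_complex_gaussian N (\<eta> i)"
  shows "converges_in_law {1..p}
           (\<lambda>n. random_matrix_algebra (M n) n) (\<lambda>n. expected_trace (M n) n)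
           (\<lambda>n i. complex_of_real (1 / sqrt (real n)) \<odot>\<^bsub>random_matrix_algebra (M n) n\<^esub>
                    reverse_circulant n (X n i))
           (random_matrix_algebra N 2) (expected_trace N 2) (\<lambda>i. off_diagonal (\<eta> i)) \<and>
         half_independent (random_matrix_algebra N 2) (expected_trace N 2)
           {1..p} (\<lambda>i. off_diagonal (\<eta> i))"
proof -
  interpret N: prob_space N by fact
  obtain C where fam: "\<And>n i. n \<ge> 1 \<Longrightarrow> i \<in> {1..p} \<Longrightarrow> standardized_family (M n) C {..<n} (X n i)"
    using assumption_I_standardized_family[OF assms(1)] by blast
  have ma: "\<eta> i \<in> moment_algebra N" if "i \<in> {1..p}" for i
    using assms(4) that by (auto intro: N.complex_gaussian_moments)
  have carrier: "(\<lambda>i. off_diagonal (\<eta> i)) ` {1..p} \<subseteq> carrier (random_matrix_algebra N 2)"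
    using ma by (auto intro: N.off_diagonal_in_carrier)
  have word: "expected_trace N 2 (monomial (random_matrix_algebra N 2) (\<lambda>i. off_diagonal (\<eta> i)) w) =
      complex_of_real (word_limit {1..p} w)" if "w \<in> lists {1..p}" for w
    using assms(3,4) that by (intro N.expected_trace_off_diagonal) auto
  show ?thesis
    unfolding scaled_rc_def[symmetric]
  proof (intro conjI converges_in_lawI)
    fix n :: nat assume n: "n \<ge> 1"
    then interpret prob_space "M n" using assms(1) by (auto simp: assumption_I_def)
    show "nc_prob_space (random_matrix_algebra (M n) n) (expected_trace (M n) n)"
      using n by (rule nc_prob_space_random_matrix_algebra)
    show "(\<lambda>i. scaled_rc (M n) n (X n i)) ` {1..p} \<subseteq> carrier (random_matrix_algebra (M n) n)"
      by (rule image_subsetI) (rule scaled_rc_in_carrier[OF fam[OF n]])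
  next
    show "nc_prob_space (random_matrix_algebra N 2) (expected_trace N 2)"
      by (rule N.nc_prob_space_random_matrix_algebra) simp
    show "(\<lambda>n. expected_trace (M n) n
          (monomial (random_matrix_algebra (M n) n) (\<lambda>i. scaled_rc (M n) n (X n i)) w))
        \<longlonglongrightarrow> expected_trace N 2 (monomial (random_matrix_algebra N 2) (\<lambda>i. off_diagonal (\<eta> i)) w)"
      if "w \<in> lists {1..p}" for w
      unfolding word[OF that] by (rule expected_trace_scaled_rc_tendsto[OF assms(1) that])
    show "half_independent (random_matrix_algebra N 2) (expected_trace N 2) {1..p} (\<lambda>i. off_diagonal (\<eta> i))"
      unfolding half_independent_def
    proof (intro conjI ballI impI carrier half_commute_off_diagonal
        N.nc_independent_off_diagonal_squares[OF assms(3) ma])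
      fix w assume w: "w \<in> lists {1..p}" and "\<not> symmetric_word {1..p} w"
      then have "word_limit {1..p} w = 0"
        by (intro word_limit_nonsymmetric[OF finite_atLeastAtMost])
      then show "expected_trace N 2 (monomial (random_matrix_algebra N 2) (\<lambda>i. off_diagonal (\<eta> i)) w) = 0"
        unfolding word[OF w] by simp
    qed
  qed (rule carrier)
qed

end
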